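(* Let $\beta>1$ and $\alpha\in I_\beta=[0,\Lambda(\beta)]$. Let $\{\theta(n)\}_{n\geq1}$ be a slowly varying sequence with $\theta(n)\to\infty$ as $n\to\infty$, and let $\phi(n)=[\theta(n)]$ for $n\geq1$. Then \[ \dim_H ER_\phi^\beta(\alpha)=\begin{cases} h^\beta(\alpha), & 0\leq\alpha\leq\alpha^\ast(\beta);\\ 1, & \alpha^\ast(\beta)<\alpha\leq\Lambda(\beta).\end{cases} \]
   Context: $\beta$-expansions: Let $I=[0,1)$ and $T_\beta(x)=\beta x-[\beta x]$ on $I$ ($[\cdot]$ the floor function). For $x\in I$ the digits are $\varepsilon_n(x,\beta)=[\beta T_\beta^{n-1}(x)]$, $n\geq1$, so $x=\sum_{n\ge1}\varepsilon_n(x,\beta)\beta^{-n}$. An $n$-word $(\varepsilon_1,\dots,\varepsilon_n)$ is $\beta$-admissible if the $\beta$-expansion of some $x\in I$ begins with it; $\Sigma_\beta^n$ denotes the set of $\beta$-admissible $n$-words. Put $S_n(x,\beta)=\sum_{i=1}^n\varepsilon_i(x,\beta)$, $S_0=0$, and $A_n(x,\beta)=S_n(x,\beta)/n$. Infinite expansion of 1: let $1=\sum_{n\ge1}\varepsilon_n(1,\beta)\beta^{-n}$ be the greedy expansion ($t_0=1$, $\varepsilon_n(1,\beta)=[\beta t_{n-1}]$, $t_n=\beta t_{n-1}-\varepsilon_n(1,\beta)$). If it terminates, i.e. $\varepsilon_n(1,\beta)\neq0$ and $\varepsilon_k(1,\beta)=0$ for all $k>n$, set $(\varepsilon^*_i(1,\beta))_{i\ge1}=(\varepsilon_1(1,\beta),\dots,\varepsilon_{n-1}(1,\beta),\varepsilon_n(1,\beta)-1)^\infty$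 (periodic repetition); otherwise $\varepsilon_i^*(1,\beta)=\varepsilon_i(1,\beta)$. For each $m$ with $\varepsilon_m^*(1,\beta)\geq1$ let $\beta_m$ be the unique positive root $x$ of $1=\sum_{i=1}^m\varepsilon_i^*(1,\beta)x^{-i}$; then $\beta_m<\beta$ and $\beta_m\uparrow\beta$. Entropy function: for $\alpha$, $n\geq1$, $\delta>0$ let $h^\beta(\alpha,n,\delta)=\#\{(\varepsilon_1,\dots,\varepsilon_n)\in\Sigma_\beta^n: n(\alpha-\delta)<\sum_{i=1}^n\varepsilon_i<n(\alpha+\delta)\}$ and \[h^\beta(\alpha)=\lim_{\delta\to0}\lim_{m\to\infty}\liminf_{n\to\infty}\frac{\log h^{\beta_m}(\alpha,n,\delta)}{n\log\beta}\] ($m$ ranging over indices with $\varepsilon_m^*(1,\beta)\ge1$; the value is unchanged with $\limsup_n$). $\Lambda(\beta)=\sup_{x\in I}\limsup_{n\to\infty}A_n(x,\beta)$, $I_\beta=[0,\Lambda(\beta)]$. $\alpha^\ast(\beta)=\int_I\varepsilon_1(x,\beta)\,d\mu_\beta$, where $\mu_\beta$ is the $T_\beta$-invariant probability measure equivalent to Lebesgue measure (Lebesgue measure itself if $\beta$ is an integer, giving $\alpha^*(\beta)=(\beta-1)/2$); equivalently $\lim_n A_n(x,\beta)=\alpha^*(\beta)$ for Lebesgue-a.e. $x$. Erdős–Rényi average: for an integer function $\phi$ on $\mathbb N\setminus\{0\}$ (the paper's standing convention is $1\le\phi(n)\le n$) and $n$ with $1\le\phi(n)\le n$, let $I_{n,\phi(n)}(x,\beta)=\max_{0\leq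 i\leq n-\phi(n)}(S_{i+\phi(n)}(x,\beta)-S_i(x,\beta))$, $A_{n,\phi(n)}(x,\beta)=I_{n,\phi(n)}(x,\beta)/\phi(n)$, and $A_\phi(x,\beta)=\lim_{n\to\infty}A_{n,\phi(n)}(x,\beta)$ when the limit exists. $ER_\phi^\beta(\alpha)=\{x\in I: A_\phi(x,\beta)=\alpha\}$. Slowly varying: a sequence $\{\theta(n)\}$ with $\theta(n)>0$ is slowly varying if there are positive numbers $f(n)$ with $\lim_n\theta(n)/f(n)=K>0$ and $\lim_n n\,(1-f(n-1)/f(n))=0$. *)

theory Defs
  imports "HOL-Probability.Probability"
begin

(* Convention for s = 0: a nonempty set, even a single point, contributes 1
   (note that 0 powr 0 = 0). *)
definition hausdorff_gauge :: "real \<Rightarrow> 'a::metric_space set \<Rightarrow> ennreal" where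
  "hausdorff_gauge s U =
     (if U = {} then 0 else if s = 0 then 1 else ennreal (diameter U powr s))"

(* Boundedness is required because diameter is an unspecified value on unbounded sets. *)
definition hausdorff_premeasure :: "real \<Rightarrow> real \<Rightarrow> 'a::metric_space set \<Rightarrow> ennreal" where
  "hausdorff_premeasure s d E =
     (INF U \<in> {U :: nat \<Rightarrow> 'a set. E \<subseteq> (\<Union>i. U i) \<and> (\<forall>i. bounded (U i) \<and> diameter (U i) \<le> d)}.
        \<Sum>i. hausdorff_gauge s (U i))"

definition hausdorff_measure :: "real \<Rightarrow> 'a::metric_space set \<Rightarrow> ennreal" where
  "hausdorff_measure s E = (SUP d \<in> {0<..}. hausdorff_premeasure s d E)"

definition hausdorff_dim :: "'a::metric_space set \<Rightarrow> ereal" where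
  "hausdorff_dim E = Inf (ereal ` {s. 0 \<le> s \<and> hausdorff_measure s E = 0})"

definition beta_map :: "real \<Rightarrow> real \<Rightarrow> real" where
  "beta_map \<beta> x = \<beta> * x - of_int \<lfloor>\<beta> * x\<rfloor>"

(* Digits are indexed from n = 1; the value at n = 0 is never used.
   At x = 1 the same formula gives the greedy expansion of 1, as t_n is the n-th iterate
   of beta_map applied to 1. *)
definition beta_digit :: "real \<Rightarrow> nat \<Rightarrow> real \<Rightarrow> int" where
  "beta_digit \<beta> n x = \<lfloor>\<beta> * (beta_map \<beta> ^^ (n - 1)) x\<rfloor>"

definition admissible_words :: "real \<Rightarrow> nat \<Rightarrow> int list set" where
  "admissible_words \<beta> n =
     {w. length w = n \<and> (\<exists>x\<in>{0..<1}. \<forall>i<n. w ! i = beta_digit \<beta> (Suc i) x)}"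

definition digit_sum :: "real \<Rightarrow> nat \<Rightarrow> real \<Rightarrow> int" where
  "digit_sum \<beta> n x = (\<Sum>i=1..n. beta_digit \<beta> i x)"

definition digit_average :: "real \<Rightarrow> nat \<Rightarrow> real \<Rightarrow> real" where
  "digit_average \<beta> n x = of_int (digit_sum \<beta> n x) / real n"

definition ends_at :: "real \<Rightarrow> nat \<Rightarrow> bool" where
  "ends_at \<beta> n \<longleftrightarrow> 1 \<le> n \<and> beta_digit \<beta> n 1 \<noteq> 0 \<and> (\<forall>k>n. beta_digit \<beta> k 1 = 0)"

(* Meaningful for i >= 1. In the terminating case n is the period, and the positions i
   divisible by n carry the lowered last digit. *)
definition star_digit :: "real \<Rightarrow> nat \<Rightarrow> int" where
  "star_digit \<beta> i =
     (if \<exists>n. ends_at \<beta> n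
      then let n = (THE n. ends_at \<beta> n)
           in if i mod n = 0 then beta_digit \<beta> n 1 - 1 else beta_digit \<beta> (i mod n) 1
      else beta_digit \<beta> i 1)"

definition star_indices :: "real \<Rightarrow> nat set" where
  "star_indices \<beta> = {m. 1 \<le> m \<and> 1 \<le> star_digit \<beta> m}"

definition beta_approx :: "real \<Rightarrow> nat \<Rightarrow> real" where
  "beta_approx \<beta> m = (THE x. 0 < x \<and> 1 = (\<Sum>i=1..m. of_int (star_digit \<beta> i) / x ^ i))"

definition word_count :: "real \<Rightarrow> real \<Rightarrow> nat \<Rightarrow> real \<Rightarrow> nat" where
  "word_count \<beta> \<alpha> n \<delta> =
     card {w \<in> admissible_words \<beta> n.
             real n * (\<alpha> - \<delta>) < of_int (sum_list w) \<and> of_int (sum_list w) < real n * (\<alpha> + \<delta>)}"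

(* Extended logarithm: log 0 is minus infinity, whereas ln 0 = 0 in the library. *)
definition log_count :: "nat \<Rightarrow> ereal" where
  "log_count k = (if k = 0 then - \<infinity> else ereal (ln (real k)))"

(* The middle limit is over m tending to infinity inside star_indices. *)
definition digit_entropy :: "real \<Rightarrow> real \<Rightarrow> ereal" where
  "digit_entropy \<beta> \<alpha> =
     Lim (at_right 0) (\<lambda>\<delta>.
       Lim (inf sequentially (principal (star_indices \<beta>))) (\<lambda>m.
         liminf (\<lambda>n. log_count (word_count (beta_approx \<beta> m) \<alpha> n \<delta>) / ereal (real n * ln \<beta>))))"

definition max_average :: "real \<Rightarrow> ereal" where
  "max_average \<beta> = (SUP x \<in> {0..<1}. limsup (\<lambda>n. ereal (digit_average \<beta> n x)))"

(* Equivalence with Lebesgue measure is mutual absolute continuity. For integer base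
   Lebesgue measure itself satisfies the predicate. *)
definition is_invariant_acpm :: "real \<Rightarrow> real measure \<Rightarrow> bool" where
  "is_invariant_acpm \<beta> M \<longleftrightarrow>
     prob_space M \<and>
     sets M = sets (restrict_space lborel {0..<1}) \<and>
     beta_map \<beta> \<in> measurable M M \<and> distr M M (beta_map \<beta>) = M \<and>
     absolutely_continuous M (restrict_space lborel {0..<1}) \<and>
     absolutely_continuous (restrict_space lborel {0..<1}) M"

definition beta_measure :: "real \<Rightarrow> real measure" where
  "beta_measure \<beta> = (THE M. is_invariant_acpm \<beta> M)"

definition typical_average :: "real \<Rightarrow> real" where
  "typical_average \<beta> = (\<integral>x. of_int (beta_digit \<beta> 1 x) \<partial>beta_measure \<beta>)"

(* Intended for 1 <= k <= n; outside this range the value is a harmless default. *)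
definition ER_average :: "real \<Rightarrow> nat \<Rightarrow> nat \<Rightarrow> real \<Rightarrow> real" where
  "ER_average \<beta> n k x =
     of_int (Max ((\<lambda>i. digit_sum \<beta> (i + k) x - digit_sum \<beta> i x) ` {0..n - k})) / real k"

(* Only the values of \<phi> at large n matter. *)
definition ER_set :: "real \<Rightarrow> (nat \<Rightarrow> nat) \<Rightarrow> real \<Rightarrow> real set" where
  "ER_set \<beta> \<phi> \<alpha> = {x \<in> {0..<1}. (\<lambda>n. ER_average \<beta> n (\<phi> n) x) \<longlonglongrightarrow> \<alpha>}"

(* Sequences are indexed from n = 1; the value at 0 is irrelevant. *)
definition slowly_varying :: "(nat \<Rightarrow> real) \<Rightarrow> bool" where
  "slowly_varying \<theta> \<longleftrightarrow>
     (\<forall>n\<ge>1. 0 < \<theta> n) \<and>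
     (\<exists>f K. (\<forall>n\<ge>1. 0 < f n) \<and> 0 < K \<and>
        (\<lambda>n. \<theta> n / f n) \<longlonglongrightarrow> K \<and>
        (\<lambda>n. real n * (1 - f (n - 1) / f n)) \<longlonglongrightarrow> 0)"

end

theory Submission
  imports Defs "HOL-Real_Asymp.Real_Asymp"
begin

text \<open>Of the slow variation only \<open>\<phi> n = o(n)\<close> is needed. If all windows of length \<open>\<phi> n\<close> have mean at
  most \<open>\<alpha> + \<epsilon>\<close>, then so has the whole word of length \<open>n\<close>, up to \<open>o(n)\<close>; counting words of small
  digit sum bounds the dimension from above. When \<open>\<alpha>\<close> is at most the typical average, words of
  mean below \<open>\<alpha>\<close> can be mixed with typical ones, which are exponentially full, so that this
  count is governed by the entropy at \<open>\<alpha>\<close> itself.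

  Lowering the last nonzero digit of an admissible word makes it freely concatenable, at the
  cost of a linear factor in the counts. For the lower bound one concatenates freely chosen blocks
  of mean at most \<open>\<alpha>\<close> and inserts, around the positions \<open>2\<^sup>p\<close>, runs of length about
  \<open>max {\<phi> m | m = O(2\<^sup>p)}\<close> of a word whose mean approaches \<open>\<alpha>\<close> from below. The runs have
  density zero, so the dimension is the exponential rate of the free blocks: the entropy at
  \<open>\<alpha>\<close>, or 1 when \<open>\<alpha>\<close> exceeds the typical average.\<close>

section \<open>Words and cylinders\<close>

text \<open>The obstacle in the lower bound is that window averages must converge to \<alpha>
  itself. If blocks could have mean up to \<alpha> + \<epsilon>, long windows could keep that
  excess; so every block has mean at most \<alpha> exactly, and only the two blocks cut by the ends
  of a window contribute an error. Blocks must then be short compared with \<open>\<phi> n\<close>.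
  Means near \<alpha> are brought below \<alpha> by mixing in zeros, which has no room at \<alpha> =
  0; there the entropy is shown to be at most 0 by a separate estimate. Powers of two suit the runs
  because those below \<open>q\<close> sum to at most \<open>2 * q\<close>, while every
  \<open>n\<close> has one below it up to a bounded factor: the runs cost nothing in dimension, yet
  a run long enough for the window length in force lies among the first \<open>n\<close> digits. The
  dimension of the resulting set is bounded below by pulling covers back to the unit interval that
  parametrises it. The invariant measure enters through the limit of the Lebesgue means of the digit
  averages.\<close>

text \<open>\<open>wjoin b w y\<close> is the value in base \<open>b\<close> of the word \<open>w\<close> followed by an expansion of \<open>y\<close>.
  The greedy expansion of a point is characterised by all its tails having value below one
  (\<open>fits\<close>), a condition that is monotone in the base. This replaces Parry's lexicographic
  criterion throughout.\<close>

fun wjoin :: "real \<Rightarrow> int list \<Rightarrow> real \<Rightarrow> real" where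
  "wjoin b [] y = y"
| "wjoin b (d # w) y = (of_int d + wjoin b w y) / b"

fun fits :: "real \<Rightarrow> int list \<Rightarrow> real \<Rightarrow> bool" where
  "fits b [] y \<longleftrightarrow> 0 \<le> y \<and> y < 1"
| "fits b (d # w) y \<longleftrightarrow> 0 \<le> d \<and> wjoin b (d # w) y < 1 \<and> fits b w y"

definition full :: "real \<Rightarrow> int list \<Rightarrow> bool" where
  "full b w \<longleftrightarrow> (\<forall>y\<in>{0..<1}. fits b w y)"

lemma fullD: "full b w \<Longrightarrow> 0 \<le> y \<Longrightarrow> y < 1 \<Longrightarrow> fits b w y"
  unfolding full_def by simp

lemma join_append: "wjoin b (u @ v) y = wjoin b u (wjoin b v y)"
  by (induction u) auto

lemma join_affine: "b \<noteq> 0 \<Longrightarrow> wjoin b w y = wjoin b w 0 + y / b ^ length w"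
  by (induction w) (auto simp: field_simps)

lemma join_mono: "0 < b \<Longrightarrow> y \<le> z \<Longrightarrow> wjoin b w y \<le> wjoin b w z"
  by (subst (1 2) join_affine) (auto simp: divide_right_mono)

lemma join_nonneg: "0 < b \<Longrightarrow> \<forall>d\<in>set w. 0 \<le> d \<Longrightarrow> 0 \<le> y \<Longrightarrow> 0 \<le> wjoin b w y"
  by (induction w) auto

lemma join_antimono_base:
  "0 < b \<Longrightarrow> b \<le> c \<Longrightarrow> \<forall>d\<in>set w. 0 \<le> d \<Longrightarrow> 0 \<le> y \<Longrightarrow> wjoin c w y \<le> wjoin b w y"
proof (induction w)
  case (Cons d w)
  then have "wjoin c w y \<le> wjoin b w y" "0 \<le> wjoin c w y" by (auto intro: join_nonneg)
  with Cons.prems have "(of_int d + wjoin c w y) / c \<le> (of_int d + wjoin b w y) / b"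
    by (intro frac_le) auto
  then show ?case by simp
qed simp

lemma fits_digits: "fits b w y \<Longrightarrow> d \<in> set w \<Longrightarrow> 0 \<le> d"
  by (induction w) auto

lemma fits_tail: "fits b w y \<Longrightarrow> 0 \<le> y \<and> y < 1"
  by (induction w) auto

lemma fits_join: "0 < b \<Longrightarrow> fits b w y \<Longrightarrow> 0 \<le> wjoin b w y \<and> wjoin b w y < 1"
  by (cases w) (auto intro!: divide_nonneg_pos add_nonneg_nonneg join_nonneg
      dest: fits_digits fits_tail)

lemma fits_append:
  "0 < b \<Longrightarrow> fits b (u @ v) y \<longleftrightarrow> fits b u (wjoin b v y) \<and> fits b v y"
  by (induction u) (auto simp: join_append dest: fits_join)

lemma fits_antimono_tail: "0 < b \<Longrightarrow> fits b w y \<Longrightarrow> 0 \<le> z \<Longrightarrow> z \<le> y \<Longrightarrow> fits b w z"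
proof (induction w)
  case (Cons d w)
  have "wjoin b (d # w) z \<le> wjoin b (d # w) y" using Cons.prems by (intro join_mono) auto
  with Cons show ?case by (auto simp del: wjoin.simps)
qed auto

lemma fits_mono_base: "0 < b \<Longrightarrow> b \<le> c \<Longrightarrow> fits b w y \<Longrightarrow> fits c w y"
proof (induction w)
  case (Cons d w)
  have "wjoin c (d # w) y \<le> wjoin b (d # w) y"
    using Cons.prems fits_digits[of b "d # w" y] fits_tail[of b "d # w" y]
    by (intro join_antimono_base) auto
  with Cons show ?case by (auto simp del: wjoin.simps)
qed auto

lemma full_mono_base: "0 < b \<Longrightarrow> b \<le> c \<Longrightarrow> full b w \<Longrightarrow> full c w"
  by (auto simp: full_def intro: fits_mono_base)

lemma full_append: "0 < b \<Longrightarrow> full b u \<Longrightarrow> full b v \<Longrightarrow> full b (u @ v)"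
  by (auto simp: full_def fits_append dest: fits_join)

lemma full_Nil: "full b []"
  by (auto simp: full_def)

lemma full_concat: "0 < b \<Longrightarrow> \<forall>w\<in>set ws. full b w \<Longrightarrow> full b (concat ws)"
  by (induction ws) (auto simp: full_Nil full_append)

lemma fits_replicate_0: "1 \<le> b \<Longrightarrow> 0 \<le> y \<Longrightarrow> y < 1 \<Longrightarrow> fits b (replicate r 0) y"
proof (induction r)
  case (Suc r)
  then have "wjoin b (replicate r 0) y < 1" "0 \<le> wjoin b (replicate r 0) y"
    using fits_join[of b "replicate r 0" y] by auto
  with Suc show ?case by (auto simp: divide_less_eq)
qed auto

lemma full_replicate_0: "1 \<le> b \<Longrightarrow> full b (replicate r 0)"
  by (auto simp: full_def fits_replicate_0)

lemma full_fits0: "full b w \<Longrightarrow> fits b w 0"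
  by (auto simp: full_def)

text \<open>Multiplying by \<open>b\<close> exposes the first digit as the integer part, because the
  remaining tail has value in \<open>[0,1)\<close>; \<open>fits\<close> repeats this condition at
  every tail, so the greedy algorithm returns exactly \<open>w\<close> and then
  \<open>y\<close>.\<close>

lemma fits_beta_map:
  assumes "0 < b" "fits b w y"
  shows "(beta_map b ^^ length w) (wjoin b w y) = y
    \<and> (\<forall>i<length w. beta_digit b (Suc i) (wjoin b w y) = w ! i)"
  using assms(2)
proof (induction w)
  case (Cons d w)
  let ?x = "wjoin b (d # w) y"
  have f: "0 \<le> wjoin b w y" "wjoin b w y < 1"
    using Cons.prems fits_join[OF assms(1), of w y] by auto
  have bx: "b * ?x = of_int d + wjoin b w y" using assms(1) by simp
  have "\<lfloor>of_int d + wjoin b w y\<rfloor> = d" using f by (intro floor_unique) auto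
  then have fl: "\<lfloor>b * ?x\<rfloor> = d" by (simp only: bx)
  have "beta_map b ?x = b * ?x - of_int d" by (simp only: beta_map_def fl)
  then have T: "beta_map b ?x = wjoin b w y" by (simp only: bx)
  have "(beta_map b ^^ length w) (beta_map b ?x) = y" using Cons unfolding T by auto
  moreover have "beta_digit b (Suc i) ?x = (d # w) ! i" if "i < length (d # w)" for i
  proof (cases i)
    case 0
    then show ?thesis using fl by (simp add: beta_digit_def)
  next
    case (Suc j)
    have "beta_digit b (Suc i) ?x = beta_digit b (Suc j) (beta_map b ?x)"
      by (simp only: Suc beta_digit_def diff_Suc_1 funpow_Suc_right comp_def)
    then show ?thesis using Cons that Suc unfolding T by auto
  qed
  ultimately show ?case by (auto simp: funpow_Suc_right simp del: funpow.simps wjoin.simps)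
qed auto

lemma beta_map_range: "0 \<le> beta_map b x \<and> beta_map b x < 1"
  unfolding beta_map_def by linarith

lemma beta_iter_range: "0 \<le> x \<Longrightarrow> x < 1 \<Longrightarrow> 0 \<le> (beta_map b ^^ n) x \<and> (beta_map b ^^ n) x < 1"
  by (cases n) (auto simp: beta_map_range)

definition digit_word :: "real \<Rightarrow> nat \<Rightarrow> real \<Rightarrow> int list" where
  "digit_word b n x = map (\<lambda>i. beta_digit b (Suc i) x) [0..<n]"

lemma length_digit_word [simp]: "length (digit_word b n x) = n"
  by (simp add: digit_word_def)

lemma digit_word_Suc: "digit_word b (Suc n) x = \<lfloor>b * x\<rfloor> # digit_word b n (beta_map b x)"
proof (rule nth_equalityI)
  fix i assume "i < length (digit_word b (Suc n) x)"
  then show "digit_word b (Suc n) x ! i = (\<lfloor>b * x\<rfloor> # digit_word b n (beta_map b x)) ! i"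
    by (cases i) (auto simp: digit_word_def beta_digit_def funpow_Suc_right
        simp del: funpow.simps upt_Suc)
qed simp

text \<open>Converse of \<open>fits_beta_map\<close>: the tails of a greedy expansion are the
  iterates of \<open>beta_map\<close>, which stay in \<open>[0,1)\<close>.\<close>

lemma digit_word_fits:
  assumes "0 < b" "0 \<le> x" "x < 1"
  shows "fits b (digit_word b n x) ((beta_map b ^^ n) x)
    \<and> wjoin b (digit_word b n x) ((beta_map b ^^ n) x) = x"
  using assms(2,3)
proof (induction n arbitrary: x)
  case 0
  then show ?case by (auto simp: digit_word_def)
next
  case (Suc n)
  have "wjoin b (digit_word b (Suc n) x) ((beta_map b ^^ Suc n) x) = (of_int \<lfloor>b * x\<rfloor> + beta_map b x) / b"
    using Suc.IH[of "beta_map b x"] beta_map_range[of b x]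
    by (simp add: digit_word_Suc funpow_Suc_right del: funpow.simps)
  also have "\<dots> = x" using assms(1) by (simp add: beta_map_def)
  finally have j: "wjoin b (digit_word b (Suc n) x) ((beta_map b ^^ Suc n) x) = x" .
  have "fits b (digit_word b n (beta_map b x)) ((beta_map b ^^ n) (beta_map b x))"
    using Suc.IH[of "beta_map b x"] beta_map_range[of b x] by auto
  moreover have "0 \<le> \<lfloor>b * x\<rfloor>" using Suc.prems assms(1) by simp
  ultimately show ?case using j Suc.prems
    by (simp add: digit_word_Suc funpow_Suc_right del: funpow.simps)
qed

lemma digit_word_join: "0 < b \<Longrightarrow> fits b w y \<Longrightarrow> digit_word b (length w) (wjoin b w y) = w"
  using fits_beta_map[of b w y] by (intro nth_equalityI) (auto simp: digit_word_def)

text \<open>Values increase with the tail, so a word that fits some tail fits the tail 0.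
  Admissibility is thereby tested at the left end of the cylinder alone.\<close>

lemma admissible_words_eq:
  assumes "0 < b"
  shows "admissible_words b n = {w. length w = n \<and> fits b w 0}"
proof (intro set_eqI iffI)
  fix w assume "w \<in> admissible_words b n"
  then obtain x where x: "length w = n" "0 \<le> x" "x < 1" "\<forall>i<n. w ! i = beta_digit b (Suc i) x"
    by (auto simp: admissible_words_def)
  then have "w = digit_word b n x" by (intro nth_equalityI) (auto simp: digit_word_def)
  moreover have "fits b (digit_word b n x) 0"
    using digit_word_fits[OF assms x(2,3), of n] beta_iter_range[OF x(2,3)]
    by (auto intro: fits_antimono_tail[OF assms])
  ultimately show "w \<in> {w. length w = n \<and> fits b w 0}" using x by simp
next
  fix w assume "w \<in> {w. length w = n \<and> fits b w 0}"
  then show "w \<in> admissible_words b n"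
    using fits_beta_map[OF assms, of w 0] fits_join[OF assms, of w 0]
    by (auto simp: admissible_words_def intro!: bexI[of _ "wjoin b w 0"])
qed

lemma digit_word_admissible:
  "0 < b \<Longrightarrow> 0 \<le> x \<Longrightarrow> x < 1 \<Longrightarrow> digit_word b n x \<in> admissible_words b n"
  by (auto simp: admissible_words_def digit_word_def)

lemma fits_digit_le:
  assumes "0 < b" "fits b w y" "d \<in> set w"
  shows "real_of_int d \<le> b"
  using assms(2,3)
proof (induction w)
  case (Cons e w)
  have "real_of_int e + wjoin b w y < b" using Cons.prems assms(1) by (auto simp: divide_less_eq)
  moreover have "0 \<le> wjoin b w y" using Cons.prems fits_join[OF assms(1), of w y] by auto
  ultimately show ?case using Cons by auto
qed auto

lemma finite_admissible_words:
  assumes "0 < b" shows "finite (admissible_words b n)"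
proof (rule finite_subset)
  show "admissible_words b n \<subseteq> {w. set w \<subseteq> {0..\<lfloor>b\<rfloor>} \<and> length w = n}"
    using fits_digit_le[OF assms] fits_digits
    by (auto simp: admissible_words_eq[OF assms] le_floor_iff)
qed (simp add: finite_lists_length_eq)

lemma sum_list_fits:
  assumes "0 < b" "fits b w y"
  shows "0 \<le> sum_list w \<and> real_of_int (sum_list w) \<le> b * real (length w)"
  using assms(2)
proof (induction w)
  case (Cons d w)
  have "real_of_int d \<le> b" using fits_digit_le[OF assms(1) Cons.prems] by simp
  with Cons show ?case by (auto simp: algebra_simps)
qed auto

lemma sum_list_digit_word: "sum_list (digit_word b n x) = digit_sum b n x"
proof -
  have "sum_list (digit_word b n x) = (\<Sum>i<n. beta_digit b (Suc i) x)"
    by (simp add: digit_word_def sum_list_sum_nth atLeast0LessThan)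
  also have "\<dots> = digit_sum b n x"
    by (simp add: digit_sum_def sum.atLeast1_atMost_eq)
  finally show ?thesis .
qed

section \<open>Changing the base\<close>

lemma admissible_words_mono: "0 < b \<Longrightarrow> b \<le> c \<Longrightarrow> admissible_words b n \<subseteq> admissible_words c n"
  by (auto simp: admissible_words_eq intro: fits_mono_base)

lemma isCont_join: "b \<noteq> 0 \<Longrightarrow> isCont (\<lambda>b. wjoin b w y) b"
  by (induction w) auto

text \<open>Apart from conditions free of the base, \<open>fits\<close> is a finite conjunction of
  strict inequalities between functions continuous in the base, so it survives a small decrease of
  the base.\<close>

lemma fits_eventually:
  assumes "0 < b" "fits b w y"
  shows "eventually (\<lambda>c. fits c w y) (at_left b)"
  using assms(2)
proof (induction w)
  case (Cons d w)
  have "((\<lambda>c. wjoin c (d # w) y) \<longlongrightarrow> wjoin b (d # w) y) (at_left b)"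
    using isCont_join[of b "d # w" y] assms(1)
    by (auto simp: isCont_def intro: filterlim_mono[OF _ order_refl at_le])
  then have "eventually (\<lambda>c. wjoin c (d # w) y < 1) (at_left b)"
    using Cons.prems by (intro order_tendstoD) auto
  moreover have "eventually (\<lambda>c. fits c w y) (at_left b)" using Cons by auto
  ultimately show ?case by eventually_elim (use Cons.prems in auto)
qed auto

text \<open>There are finitely many words of a fixed length, so one base \<open>c < b\<close> serves
  all of them. This is how families found in base \<open>b\<close> become families in a smaller
  base. The bound \<open>1 \<le> c\<close> keeps words of zeros full and makes
  \<open>full_lower\<close> applicable.\<close>

lemma admissible_words_base_below:
  assumes "1 < b" "a < b"
  shows "\<exists>c. 1 \<le> c \<and> a < c \<and> c < b \<and> admissible_words b n \<subseteq> admissible_words c n"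
proof -
  have "eventually (\<lambda>c. \<forall>w\<in>admissible_words b n. fits c w 0) (at_left b)"
    using assms finite_admissible_words[of b n]
    by (subst eventually_ball_finite_distrib) (auto simp: admissible_words_eq intro: fits_eventually)
  moreover have "eventually (\<lambda>c. max 1 a < c \<and> c < b) (at_left b)"
    using eventually_at_left_real[of "max 1 a" b] assms
    by (auto elim: eventually_mono)
  ultimately have "eventually (\<lambda>c. 1 \<le> c \<and> a < c \<and> c < b \<and> admissible_words b n \<subseteq> admissible_words c n) (at_left b)"
    by eventually_elim (use assms in \<open>auto simp: admissible_words_eq\<close>)
  then show ?thesis by (auto dest: eventually_happens)
qed

section \<open>Making words freely concatenable\<close>

fun lower :: "int list \<Rightarrow> int list" where
  "lower [] = []"
| "lower (d # w) = (if set w \<subseteq> {0} then (if d = 0 then 0 else d - 1) # w else d # lower w)"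

lemma length_lower [simp]: "length (lower w) = length w"
  by (induction w) auto

lemma set_zero_replicate: "set w \<subseteq> {0} \<Longrightarrow> w = replicate (length w) (0::int)"
  by (induction w) auto

text \<open>The second conjunct is what the induction carries: in front of the lowered digit the
  value must not exceed that of the original word, so that the bound \<open>< 1\<close> is inherited
  at each earlier position. A word of zeros has nothing to lower, hence the guard.\<close>

lemma full_lower_aux:
  assumes "1 \<le> b" "fits b w 0" "0 \<le> y" "y < 1"
  shows "fits b (lower w) y \<and> (\<not> set w \<subseteq> {0} \<longrightarrow> wjoin b (lower w) y \<le> wjoin b w 0)"
  using assms(2)
proof (induction w)
  case Nil
  then show ?case using assms by auto
next
  case (Cons d w)
  have d: "0 \<le> d" using Cons.prems by auto
  show ?case
  proof (cases "set w \<subseteq> {0}")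
    case True
    obtain r where w: "w = replicate r 0" by (rule that[OF set_zero_replicate[OF True]])
    have f: "fits b w y" unfolding w by (rule fits_replicate_0[OF assms(1,3,4)])
    then have l1: "wjoin b w y < 1" using fits_join[of b w y] assms(1) by simp
    have j0: "wjoin b w 0 = 0" unfolding w by (induction r) auto
    show ?thesis
    proof (cases "d = 0")
      case True
      have "fits b (replicate (Suc r) 0) y" by (rule fits_replicate_0[OF assms(1,3,4)])
      then have "fits b (0 # w) y" by (simp only: w replicate_Suc)
      with True \<open>set w \<subseteq> {0}\<close> show ?thesis by (simp del: fits.simps)
    next
      case False
      with d have "1 \<le> d" by auto
      have "wjoin b ((d - 1) # w) y \<le> wjoin b (d # w) 0"
        using l1 j0 assms(1) by (auto intro!: divide_right_mono)
      moreover have "wjoin b (d # w) 0 < 1" using Cons.prems by auto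
      ultimately show ?thesis using \<open>1 \<le> d\<close> f False True by (auto simp del: wjoin.simps)
    qed
  next
    case False
    have "fits b w 0" using Cons.prems by simp
    from Cons.IH[OF this] False
    have IH: "fits b (lower w) y" "wjoin b (lower w) y \<le> wjoin b w 0" by blast+
    have "wjoin b (d # lower w) y \<le> wjoin b (d # w) 0"
      using IH(2) assms(1) by (auto intro!: divide_right_mono)
    moreover have "wjoin b (d # w) 0 < 1" using Cons.prems by simp
    ultimately show ?thesis using IH(1) False d by (auto simp del: wjoin.simps)
  qed
qed

text \<open>A word with its last nonzero digit lowered by one can be followed by any admissible
  sequence, since the lowered digit absorbs every tail of value below one.\<close>

lemma full_lower: "1 \<le> b \<Longrightarrow> fits b w 0 \<Longrightarrow> full b (lower w)"
  using full_lower_aux by (auto simp: full_def)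

lemma sum_list_lower: "sum_list (lower w) \<le> sum_list w \<and> sum_list w \<le> sum_list (lower w) + 1"
proof (induction w)
  case (Cons d w)
  then show ?case by simp
qed auto

text \<open>Raising one digit back recovers the word. The index \<open>length w\<close> lies past
  the end, where the list update does nothing; it serves the word of zeros.\<close>

lemma lower_inverse: "\<exists>i\<le>length w. w = (lower w)[i := lower w ! i + 1]"
proof (induction w)
  case (Cons d w)
  show ?case
  proof (cases "set w \<subseteq> {0}")
    case True
    show ?thesis
    proof (cases "d = 0")
      case True
      with \<open>set w \<subseteq> {0}\<close> show ?thesis
        by (intro exI[of _ "Suc (length w)"]) (auto simp: list_update_beyond)
    next
      case False
      with True show ?thesis by (intro exI[of _ 0]) auto
    qed
  next
    case False
    from Cons obtain i where "i \<le> length w" "w = (lower w)[i := lower w ! i + 1]" by auto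
    with False show ?thesis by (intro exI[of _ "Suc i"]) auto
  qed
qed simp

text \<open>A lowered word has at most \<open>n + 1\<close> originals, one for each index in
  \<open>lower_inverse\<close>. A linear loss is invisible on the exponential scale.\<close>

lemma card_lower:
  assumes "finite V" "\<forall>w\<in>V. length w = n"
  shows "card V \<le> card (lower ` V) * (n + 1)"
proof -
  have "V \<subseteq> (\<lambda>(v, i). v[i := v ! i + 1]) ` (lower ` V \<times> {..n})"
  proof
    fix w assume w: "w \<in> V"
    obtain i where "i \<le> length w" "w = (lower w)[i := lower w ! i + 1]" using lower_inverse by blast
    with w assms show "w \<in> (\<lambda>(v, i). v[i := v ! i + 1]) ` (lower ` V \<times> {..n})"
      by (intro image_eqI[of _ _ "(lower w, i)"]) auto
  qed
  then have "card V \<le> card (lower ` V \<times> {..n})"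
    using assms by (intro surj_card_le) auto
  then show ?thesis by (simp add: card_cartesian_product)
qed

lemma fits_unique:
  assumes "0 < b" "fits b u y" "fits b v z" "length u = length v" "wjoin b u y = wjoin b v z"
  shows "u = v"
proof -
  have "u = digit_word b (length u) (wjoin b u y)" using digit_word_join[OF assms(1,2)] by (rule sym)
  also have "\<dots> = digit_word b (length v) (wjoin b v z)" by (simp only: assms(4,5))
  also have "\<dots> = v" by (rule digit_word_join[OF assms(1,3)])
  finally show ?thesis .
qed

text \<open>All points of the half-open interval of length \<open>1 / b ^ n\<close> starting at
  \<open>wjoin b u 0\<close> have expansions beginning with \<open>u\<close>, so these intervals are
  disjoint for different full words.\<close>

lemma full_separated:
  assumes "0 < b" "full b u" "full b v" "length u = n" "length v = n" "u \<noteq> v"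
  shows "1 / b ^ n \<le> \<bar>wjoin b u 0 - wjoin b v 0\<bar>"
proof -
  have aux: "u = v" if "full b u" "full b v" "length u = n" "length v = n"
    "wjoin b u 0 \<le> wjoin b v 0" "wjoin b v 0 - wjoin b u 0 < 1 / b ^ n" for u v
  proof -
    \<comment> \<open>The tail that, placed after \<open>u\<close>, gives the left end of the
      cylinder of \<open>v\<close>.\<close>
    define y where "y = (wjoin b v 0 - wjoin b u 0) * b ^ n"
    have "0 \<le> y" "y < 1" using that assms(1) by (auto simp: y_def field_simps)
    moreover have "wjoin b u y = wjoin b v 0"
      using assms(1) that by (subst join_affine) (auto simp: y_def)
    ultimately show ?thesis
      using that assms(1) by (intro fits_unique[of b u y v 0]) (auto dest: fullD)
  qed
  have "\<not> wjoin b v 0 - wjoin b u 0 < 1 / b ^ n" if "wjoin b u 0 \<le> wjoin b v 0"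
    using aux[of u v] assms that by blast
  moreover have "\<not> wjoin b u 0 - wjoin b v 0 < 1 / b ^ n" if "wjoin b v 0 \<le> wjoin b u 0"
    using aux[of v u] assms that by blast
  ultimately show ?thesis by linarith
qed

section \<open>The entropy as an infimum of suprema over smaller bases\<close>

text \<open>Valid for every real \<open>x\<close>, in particular for \<open>x = 1\<close>, which
  lies outside the domain \<open>[0,1)\<close> of the map.\<close>

lemma digit_expansion:
  assumes "0 < b"
  shows "(\<Sum>i=1..n. of_int (beta_digit b i x) / b ^ i) + (beta_map b ^^ n) x / b ^ n = x"
proof (induction n)
  case (Suc n)
  have "(beta_map b ^^ Suc n) x = b * (beta_map b ^^ n) x - of_int (beta_digit b (Suc n) x)"
    by (simp add: beta_digit_def beta_map_def)
  then have "of_int (beta_digit b (Suc n) x) / b ^ Suc n + (beta_map b ^^ Suc n) x / b ^ Suc n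
      = (beta_map b ^^ n) x / b ^ n"
    using assms by (simp add: field_simps del: funpow.simps)
  with Suc show ?case by (simp del: funpow.simps)
qed simp

section \<open>The quasi-greedy expansion of 1 and the approximating bases\<close>

lemma beta_iter_one_range: "0 \<le> (beta_map b ^^ n) 1 \<and> (beta_map b ^^ n) 1 \<le> 1"
  by (cases n) (auto simp: beta_map_range less_imp_le)

lemma beta_digit_one_nonneg: "0 < b \<Longrightarrow> 0 \<le> beta_digit b n 1"
  by (auto simp: beta_digit_def beta_iter_one_range)

definition star_sum :: "real \<Rightarrow> nat \<Rightarrow> real \<Rightarrow> real" where
  "star_sum b m x = (\<Sum>i=1..m. of_int (star_digit b i) / x ^ i)"

lemma beta_digit_one_ge_1: "1 < b \<Longrightarrow> 1 \<le> beta_digit b (Suc 0) 1"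
  by (simp add: beta_digit_def)

text \<open>In the terminating case with period \<open>p\<close>, the first period sums to
  \<open>1 - 1 / b ^ p\<close> and each further period repeats this on a scale smaller by
  \<open>1 / b ^ p\<close>, so the total is again 1. Otherwise the greedy digits are kept; if only
  finitely many of them were positive, the last one would make the expansion terminate.\<close>

lemma star_facts:
  assumes b: "1 < b"
  shows "\<forall>i\<ge>1. 0 \<le> star_digit b i" and "1 \<le> star_digit b 1"
    and "infinite (star_indices b)"
    and "\<forall>m. star_sum b m b \<le> 1" and "(\<lambda>m. star_sum b m b) \<longlonglongrightarrow> 1"
proof -
  have "(\<forall>i\<ge>1. 0 \<le> star_digit b i) \<and> 1 \<le> star_digit b 1 \<and> infinite (star_indices b)
    \<and> (\<forall>m. star_sum b m b \<le> 1) \<and> (\<lambda>m. star_sum b m b) \<longlonglongrightarrow> 1"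
  proof (cases "\<exists>n. ends_at b n")
    case False
    then have st: "star_digit b i = beta_digit b i 1" for i by (simp add: star_digit_def)
    have ss: "star_sum b m b = 1 - (beta_map b ^^ m) 1 / b ^ m" for m
      using digit_expansion[of b 1 m] b by (simp add: star_sum_def st)
    have "(\<lambda>m. 1 / b ^ m) \<longlonglongrightarrow> 0"
      using LIMSEQ_inverse_realpow_zero[OF b] by (simp add: divide_inverse)
    moreover have "\<forall>m. norm ((beta_map b ^^ m) 1 / b ^ m) \<le> 1 / b ^ m"
      using beta_iter_one_range[where b = b] b by (auto intro!: divide_right_mono)
    ultimately have "(\<lambda>m. (beta_map b ^^ m) 1 / b ^ m) \<longlonglongrightarrow> 0"
      by (rule Lim_null_comparison[OF always_eventually, rotated])
    then have lim: "(\<lambda>m. star_sum b m b) \<longlonglongrightarrow> 1"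
      unfolding ss using tendsto_diff[OF tendsto_const[of "1::real"], of _ 0] by simp
    have le: "star_sum b m b \<le> 1" for m
      unfolding ss using beta_iter_one_range[where n = m] b by simp
    have "infinite (star_indices b)"
    proof
      assume fin: "finite (star_indices b)"
      have "1 \<in> star_indices b"
        using beta_digit_one_ge_1[OF b] by (simp add: star_indices_def st)
      then have ne: "star_indices b \<noteq> {}" by auto
      define m where "m = Max (star_indices b)"
      have m: "m \<in> star_indices b" unfolding m_def by (rule Max_in[OF fin ne])
      have "beta_digit b k 1 = 0" if "m < k" for k
      proof (rule ccontr)
        assume "beta_digit b k 1 \<noteq> 0"
        then have "1 \<le> beta_digit b k 1" using beta_digit_one_nonneg[of b k] b by linarith
        with that have "k \<in> star_indices b" by (auto simp: star_indices_def st)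
        then have "k \<le> m" unfolding m_def using fin by simp
        with that show False by simp
      qed
      moreover have "1 \<le> m" "beta_digit b m 1 \<noteq> 0" using m by (auto simp: star_indices_def st)
      ultimately show False using False by (auto simp: ends_at_def)
    qed
    then show ?thesis
      using lim le beta_digit_one_ge_1[OF b] beta_digit_one_nonneg[of b] b by (simp add: st)
  next
    case True
    then obtain p where p: "ends_at b p" by blast
    have "n = p" if "ends_at b n" for n
    proof (rule ccontr)
      assume "n \<noteq> p"
      with p that show False unfolding ends_at_def by (metis nat_neq_iff)
    qed
    then have the: "(THE n. ends_at b n) = p" using p by blast
    have p1: "1 \<le> p" and pn: "beta_digit b p 1 \<noteq> 0" and z: "\<And>k. p < k \<Longrightarrow> beta_digit b k 1 = 0"
      using p by (auto simp: ends_at_def)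
    have st: "star_digit b i = (if i mod p = 0 then beta_digit b p 1 - 1 else beta_digit b (i mod p) 1)" for i
      using True by (simp add: star_digit_def the)
    have dp: "1 \<le> beta_digit b p 1" using pn beta_digit_one_nonneg[of b p] b by linarith
    \<comment> \<open>Beyond \<open>p\<close> all digits vanish, so each step multiplies the iterate
      by \<open>b\<close>; being bounded by 1, it must be 0 from \<open>p\<close> on.\<close>
    have Tk: "(beta_map b ^^ (p + k)) 1 = b ^ k * (beta_map b ^^ p) 1" for k
    proof (induction k)
      case (Suc k)
      have "(beta_map b ^^ (p + Suc k)) 1
          = b * (beta_map b ^^ (p + k)) 1 - of_int (beta_digit b (Suc (p + k)) 1)"
        by (simp add: beta_digit_def beta_map_def)
      with Suc z[of "Suc (p + k)"] show ?case by simp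
    qed simp
    have T0: "(beta_map b ^^ p) 1 = 0"
    proof (rule ccontr)
      assume "(beta_map b ^^ p) 1 \<noteq> 0"
      then have pos: "0 < (beta_map b ^^ p) 1" using beta_iter_one_range[where n = p and b = b] by linarith
      obtain k where "1 / (beta_map b ^^ p) 1 < b ^ k" using real_arch_pow[OF b] by blast
      then have "1 < b ^ k * (beta_map b ^^ p) 1" using pos by (simp add: field_simps)
      then show False using Tk[of k] beta_iter_one_range[where n = "p + k" and b = b] by simp
    qed
    have per: "star_digit b (p + i) = star_digit b i" for i by (simp add: st)
    have nn: "0 \<le> star_digit b i" for i
      using dp beta_digit_one_nonneg[of b] b by (auto simp: st)
    have one: "1 \<le> star_digit b 1"
    proof (cases "p = 1")
      case True
      \<comment> \<open>Period 1 means that \<open>b\<close> is an integer, at least 2, and its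
        lowered digit \<open>b - 1\<close> is still positive.\<close>
      have "b = of_int \<lfloor>b\<rfloor>" using T0 True by (simp add: beta_map_def)
      with b have "2 \<le> \<lfloor>b\<rfloor>" by linarith
      with True show ?thesis by (simp add: st beta_digit_def)
    next
      case False
      with p1 have "1 mod p = 1" by simp
      then show ?thesis using beta_digit_one_ge_1[OF b] by (simp add: st)
    qed
    have sp: "star_sum b p b = 1 - 1 / b ^ p"
    proof -
      obtain q where q: "p = Suc q" using p1 by (cases p) auto
      have "star_sum b p b = (\<Sum>i=1..q. of_int (beta_digit b i 1) / b ^ i) + of_int (beta_digit b p 1 - 1) / b ^ p"
        unfolding star_sum_def q by (simp add: st q)
      also have "\<dots> = (\<Sum>i=1..p. of_int (beta_digit b i 1) / b ^ i) - 1 / b ^ p"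
        by (simp add: q diff_divide_distrib)
      finally show ?thesis using digit_expansion[of b 1 p] b T0 by simp
    qed
    have rec: "star_sum b (p + m) b = 1 - 1 / b ^ p + star_sum b m b / b ^ p" for m
    proof -
      have "star_sum b (p + m) b = star_sum b p b + (\<Sum>i=p+1..p+m. of_int (star_digit b i) / b ^ i)"
        unfolding star_sum_def using sum.ub_add_nat[of 1 p "\<lambda>i. of_int (star_digit b i) / b ^ i" m] by simp
      also have "(\<Sum>i=p+1..p+m. of_int (star_digit b i) / b ^ i) = (\<Sum>i=1..m. of_int (star_digit b (i + p)) / b ^ (i + p))"
        using sum.shift_bounds_cl_nat_ivl[of "\<lambda>i. of_int (star_digit b i) / b ^ i" 1 p m] by (simp add: add.commute)
      also have "\<dots> = star_sum b m b / b ^ p"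
        by (simp add: star_sum_def sum_divide_distrib power_add add.commute[of _ p] per mult.commute)
      finally show ?thesis by (simp add: sp)
    qed
    have inc: "star_sum b m b \<le> star_sum b (m + k) b" for m k
      unfolding star_sum_def using nn b by (intro sum_mono2) auto
    have le: "star_sum b m b \<le> 1" for m
    proof (induction m rule: less_induct)
      case (less m)
      show ?case
      proof (cases "m < p")
        case True
        then have "star_sum b m b \<le> star_sum b p b" using inc[of m "p - m"] by simp
        also have "\<dots> \<le> 1" using sp b by simp
        finally show ?thesis .
      next
        case False
        then have "star_sum b (m - p) b \<le> 1" using p1 by (intro less) auto
        then have "star_sum b (m - p) b / b ^ p \<le> 1 / b ^ p" using b by (intro divide_right_mono) auto
        with rec[of "m - p"] False show ?thesis by simp
      qed
    qed
    have "incseq (\<lambda>m. star_sum b m b)"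
      using inc by (intro incseq_SucI) (metis Suc_eq_plus1)
    then obtain L where L: "(\<lambda>m. star_sum b m b) \<longlonglongrightarrow> L"
      using le incseq_convergent[of "\<lambda>m. star_sum b m b" 1] by blast
    have "(\<lambda>m. star_sum b (m + p) b) \<longlonglongrightarrow> L" by (rule LIMSEQ_ignore_initial_segment[OF L])
    moreover have "(\<lambda>m. star_sum b (m + p) b) \<longlonglongrightarrow> 1 - 1 / b ^ p + L / b ^ p"
      unfolding add.commute[of _ p] rec by (intro tendsto_intros L) (use b in auto)
    \<comment> \<open>Passing to the limit in \<open>rec\<close> makes \<open>L\<close> a fixed
      point of an affine contraction whose only fixed point is 1.\<close>
    ultimately have "L = 1 - 1 / b ^ p + L / b ^ p" by (rule LIMSEQ_unique)
    then have "(L - 1) * (b ^ p - 1) = 0" using b by (simp add: field_simps)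
    moreover have "b ^ p \<noteq> 1" using one_less_power[OF b, of p] p1 by simp
    ultimately have "L = 1" by simp
    have "star_digit b (1 + q * p) = star_digit b 1" for q
      by (induction q) (auto simp: per add.left_commute[of 1] add.assoc simp del: add_Suc One_nat_def)
    then have "range (\<lambda>q. 1 + q * p) \<subseteq> star_indices b" using one by (auto simp: star_indices_def)
    moreover have "infinite (range (\<lambda>q. 1 + q * p))"
      using p1 by (intro range_inj_infinite) (auto simp: inj_on_def)
    ultimately have "infinite (star_indices b)" using finite_subset by blast
    with nn one le L \<open>L = 1\<close> show ?thesis by simp
  qed
  then show "\<forall>i\<ge>1. 0 \<le> star_digit b i" "1 \<le> star_digit b 1" "infinite (star_indices b)"
    "\<forall>m. star_sum b m b \<le> 1" "(\<lambda>m. star_sum b m b) \<longlonglongrightarrow> 1" by blast+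
qed

text \<open>A positive digit always follows later, so no partial sum reaches the bound 1.\<close>

lemma star_sum_less_one:
  assumes b: "1 < b" shows "star_sum b m b < 1"
proof -
  obtain k where k: "m < k" "k \<in> star_indices b"
    using star_facts(3)[OF b] by (meson infinite_nat_iff_unbounded)
  obtain j where j: "k = Suc j" using k by (cases k) auto
  have "star_sum b m b \<le> star_sum b j b"
    unfolding star_sum_def using star_facts(1)[OF b] b k j by (intro sum_mono2) auto
  also have "\<dots> < star_sum b k b"
    using k(2) b by (simp add: star_sum_def j star_indices_def)
  also have "\<dots> \<le> 1" using star_facts(4)[OF b] by blast
  finally show ?thesis .
qed

text \<open>Every summand has exponent at least 1, so raising the base from \<open>x\<close> to
  \<open>y\<close> shrinks it at least by the factor \<open>x / y\<close>. This yields both the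
  uniqueness of the root and, by comparison with the value at \<open>b\<close>, the convergence of
  \<open>beta_approx\<close>.\<close>

lemma star_sum_scale:
  assumes b: "1 < b" and "0 < x" "x \<le> y"
  shows "star_sum b m y \<le> x / y * star_sum b m x"
proof -
  have "of_int (star_digit b i) / y ^ i \<le> x / y * (of_int (star_digit b i) / x ^ i)" if i: "i \<in> {1..m}" for i
  proof -
    obtain j where j: "i = Suc j" using i by (cases i) auto
    have "x ^ j \<le> y ^ j" using assms by (intro power_mono) auto
    then have "of_int (star_digit b i) / (y * y ^ j) \<le> of_int (star_digit b i) / (y * x ^ j)"
      using assms star_facts(1)[OF b] i by (intro divide_left_mono mult_left_mono) auto
    also have "\<dots> = x / y * (of_int (star_digit b i) / x ^ i)" using assms by (simp add: j)
    finally show ?thesis by (simp add: j)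
  qed
  then show ?thesis unfolding star_sum_def sum_distrib_left by (rule sum_mono)
qed

lemma beta_approx_root:
  assumes b: "1 < b" and m: "1 \<le> m"
  shows "1 \<le> beta_approx b m \<and> beta_approx b m < b \<and> star_sum b m (beta_approx b m) = 1"
proof -
  have "1 \<le> (\<Sum>i\<in>{1}. real_of_int (star_digit b i))" using star_facts(2)[OF b] by simp
  also have "\<dots> \<le> (\<Sum>i=1..m. real_of_int (star_digit b i))"
    using m star_facts(1)[OF b] by (intro sum_mono2) auto
  also have "\<dots> = star_sum b m 1" by (simp add: star_sum_def)
  finally have "1 \<le> star_sum b m 1" .
  moreover have "continuous_on {1..b} (star_sum b m)"
    unfolding star_sum_def by (intro continuous_intros) auto
  ultimately obtain x where x: "1 \<le> x" "x \<le> b" "star_sum b m x = 1"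
    using IVT2'[of "star_sum b m" b 1 1] star_sum_less_one[OF b, of m] b by auto
  have uniq: "\<not> (y < z)" if "0 < y" "0 < z" "star_sum b m y = 1" "star_sum b m z = 1" for y z
  proof
    assume "y < z"
    then have "y / z < 1" "1 \<le> y / z" using that star_sum_scale[OF b, of y z m] by auto
    then show False by simp
  qed
  have "beta_approx b m = x"
    unfolding beta_approx_def star_sum_def[symmetric]
  proof (rule the_equality)
    show "y = x" if "0 < y \<and> 1 = star_sum b m y" for y
      using uniq[of x y] uniq[of y x] that x by force
  qed (use x in auto)
  moreover have "x \<noteq> b" using x star_sum_less_one[OF b, of m] by auto
  ultimately show ?thesis using x by auto
qed

text \<open>By \<open>star_sum_scale\<close> the partial sum at \<open>b\<close> is at most
  \<open>beta_approx b m / b\<close>, and the partial sums tend to 1.\<close>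

lemma beta_approx_tendsto:
  assumes b: "1 < b" and c: "1 \<le> c" "c < b"
  shows "eventually (\<lambda>m. c < beta_approx b m) sequentially"
proof -
  have "c / b < 1" using b c by simp
  then have "eventually (\<lambda>m. c / b < star_sum b m b) sequentially"
    using order_tendstoD(1)[OF star_facts(5)[OF b]] by blast
  then show ?thesis using eventually_ge_at_top[of 1]
  proof eventually_elim
    case (elim m)
    note r = beta_approx_root[OF b elim(2)]
    have "star_sum b m b \<le> beta_approx b m / b" using star_sum_scale[OF b, of "beta_approx b m" b m] r by auto
    with elim(1) have "c / b < beta_approx b m / b" by linarith
    then show ?case using b by (simp add: divide_less_cancel)
  qed
qed

text \<open>The inner lower limit of the entropy for an arbitrary base \<open>c\<close>, still in
  units of \<open>ln b\<close>. Being monotone in \<open>c\<close> and in \<open>d\<close>, it turns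
  the two outer limits into a supremum and an infimum.\<close>

definition word_growth :: "real \<Rightarrow> real \<Rightarrow> real \<Rightarrow> real \<Rightarrow> ereal" where
  "word_growth b c a d = liminf (\<lambda>n. log_count (word_count c a n d) / ereal (real n * ln b))"

lemma log_count_mono: "k \<le> l \<Longrightarrow> log_count k \<le> log_count l"
  by (auto simp: log_count_def)

lemma word_growth_mono:
  assumes b: "1 < b" and c: "0 < c" "c \<le> c'" and d: "d \<le> d'"
  shows "word_growth b c a d \<le> word_growth b c' a d'"
  unfolding word_growth_def
proof (rule Liminf_mono)
  show "eventually (\<lambda>n. log_count (word_count c a n d) / ereal (real n * ln b)
      \<le> log_count (word_count c' a n d') / ereal (real n * ln b)) sequentially"
    using eventually_gt_at_top[of 0]
  proof eventually_elim
    case (elim n)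
    have dd: "real n * (a - d') \<le> real n * (a - d)" "real n * (a + d) \<le> real n * (a + d')"
      using d by (auto intro: mult_left_mono)
    have "word_count c a n d \<le> word_count c' a n d'"
      unfolding word_count_def
      using admissible_words_mono[OF c, of n] finite_admissible_words[of c' n] c dd
      by (intro card_mono) (auto intro: order.strict_trans1 order.strict_trans2)
    then show ?case
      using elim b by (intro ereal_divide_right_mono log_count_mono) auto
  qed
qed

text \<open>Stated for an arbitrary filter because the entropy takes the limit along
  \<open>star_indices\<close> only.\<close>

lemma tendsto_SUP_from_below:
  fixes g :: "real \<Rightarrow> ereal"
  assumes "eventually (\<lambda>m. 1 \<le> f m \<and> f m < b) F"
    and "\<And>c. 1 \<le> c \<Longrightarrow> c < b \<Longrightarrow> eventually (\<lambda>m. c < f m) F"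
    and mono: "\<And>c c'. 1 \<le> c \<Longrightarrow> c \<le> c' \<Longrightarrow> c' < b \<Longrightarrow> g c \<le> g c'"
  shows "((\<lambda>m. g (f m)) \<longlongrightarrow> (SUP c\<in>{1..<b}. g c)) F"
proof (rule order_tendstoI)
  fix y assume "y < (SUP c\<in>{1..<b}. g c)"
  then obtain c where c: "1 \<le> c" "c < b" "y < g c" by (auto simp: less_SUP_iff)
  show "eventually (\<lambda>m. y < g (f m)) F"
    using assms(1) assms(2)[OF c(1,2)]
  proof eventually_elim
    case (elim m)
    then have "g c \<le> g (f m)" using c by (intro mono) auto
    with c(3) show ?case by (rule less_le_trans)
  qed
next
  fix y assume y: "(SUP c\<in>{1..<b}. g c) < y"
  show "eventually (\<lambda>m. g (f m) < y) F"
    using assms(1)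
  proof eventually_elim
    case (elim m)
    then have "g (f m) \<le> (SUP c\<in>{1..<b}. g c)" by (intro SUP_upper) auto
    then show ?case using y by (rule le_less_trans)
  qed
qed

lemma tendsto_INF_at_right:
  fixes g :: "real \<Rightarrow> ereal"
  assumes mono: "\<And>d d'. 0 < d \<Longrightarrow> d \<le> d' \<Longrightarrow> g d \<le> g d'"
  shows "(g \<longlongrightarrow> (INF d\<in>{0<..}. g d)) (at_right 0)"
proof (rule order_tendstoI)
  fix y assume y: "y < (INF d\<in>{0<..}. g d)"
  show "eventually (\<lambda>d. y < g d) (at_right 0)"
    using eventually_at_right_less[of "0::real"]
    by eventually_elim (use y in \<open>auto intro: less_le_trans INF_lower\<close>)
next
  fix y assume "(INF d\<in>{0<..}. g d) < y"
  then obtain e where e: "0 < e" "g e < y" by (auto simp: INF_less_iff)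
  show "eventually (\<lambda>d. g d < y) (at_right 0)"
    using eventually_at_right_real[OF e(1)]
    by eventually_elim (use e in \<open>auto intro!: le_less_trans[OF mono, of _ e]\<close>)
qed

lemma digit_entropy_eq:
  assumes b: "1 < b"
  shows "digit_entropy b a = (INF d\<in>{0<..}. SUP c\<in>{1..<b}. word_growth b c a d)"
proof -
  let ?F = "inf sequentially (principal (star_indices b))"
  \<comment> \<open>\<open>Lim\<close> determines a limit only along a nontrivial filter; here this
    is the infinitude of \<open>star_indices\<close>.\<close>
  have "?F \<noteq> bot"
  proof
    assume "?F = bot"
    then have "eventually (\<lambda>m. False) ?F" by simp
    then have "eventually (\<lambda>m. m \<notin> star_indices b) sequentially"
      by (simp add: eventually_inf_principal)
    then obtain N where "\<forall>n\<ge>N. n \<notin> star_indices b" by (auto simp: eventually_sequentially)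
    then have "star_indices b \<subseteq> {..N}" by (auto simp: not_less_eq_eq intro: nat_le_linear[THEN disjE])
    then show False using star_facts(3)[OF b] finite_subset by blast
  qed
  have ev: "eventually P ?F" if "eventually P sequentially" for P
    using that filter_leD[OF inf_le1] by blast
  have "((\<lambda>m. word_growth b (beta_approx b m) a d) \<longlongrightarrow> (SUP c\<in>{1..<b}. word_growth b c a d)) ?F" for d
  proof (rule tendsto_SUP_from_below)
    show "eventually (\<lambda>m. 1 \<le> beta_approx b m \<and> beta_approx b m < b) ?F"
      by (rule ev, rule eventually_mono[OF eventually_ge_at_top[of 1]]) (use beta_approx_root[OF b] in blast)
    show "eventually (\<lambda>m. c < beta_approx b m) ?F" if "1 \<le> c" "c < b" for c
      using beta_approx_tendsto[OF b that] by (rule ev)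
  qed (use word_growth_mono[OF b] in auto)
  then have 1: "Lim ?F (\<lambda>m. word_growth b (beta_approx b m) a d) = (SUP c\<in>{1..<b}. word_growth b c a d)" for d
    using \<open>?F \<noteq> bot\<close> by (intro tendsto_Lim) auto
  have "((\<lambda>d. SUP c\<in>{1..<b}. word_growth b c a d) \<longlongrightarrow> (INF d\<in>{0<..}. SUP c\<in>{1..<b}. word_growth b c a d)) (at_right 0)"
    by (intro tendsto_INF_at_right SUP_subset_mono order_refl word_growth_mono[OF b]) auto
  then have "Lim (at_right 0) (\<lambda>d. SUP c\<in>{1..<b}. word_growth b c a d) = (INF d\<in>{0<..}. SUP c\<in>{1..<b}. word_growth b c a d)"
    by (intro tendsto_Lim) auto
  then show ?thesis
    unfolding digit_entropy_def word_growth_def[symmetric] 1 .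
qed

section \<open>Exponentially large families of concatenable words\<close>

text \<open>The sum has an absolute centre and an absolute error, in place of a mean, so that both
  parameters add under concatenation.\<close>

definition block_family :: "real \<Rightarrow> nat \<Rightarrow> real \<Rightarrow> real \<Rightarrow> int list set \<Rightarrow> bool" where
  "block_family c N m e W \<longleftrightarrow> finite W \<and>
     (\<forall>w\<in>W. length w = N \<and> full c w \<and> \<bar>real_of_int (sum_list w) - m\<bar> \<le> e)"

definition cat :: "int list set \<Rightarrow> int list set \<Rightarrow> int list set" where
  "cat A B = (\<lambda>(u, v). u @ v) ` (A \<times> B)"

fun cat_pow :: "int list set \<Rightarrow> nat \<Rightarrow> int list set" where
  "cat_pow W 0 = {[]}"
| "cat_pow W (Suc q) = cat W (cat_pow W q)"

lemma block_cat:
  assumes "0 < c" "block_family c M m e A" "block_family c N n f B"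
  shows "block_family c (M + N) (m + n) (e + f) (cat A B) \<and> card (cat A B) = card A * card B"
proof
  show "block_family c (M + N) (m + n) (e + f) (cat A B)"
    using assms(2,3) full_append[OF assms(1)]
    by (fastforce simp: block_family_def cat_def)
  have "inj_on (\<lambda>(u, v). u @ v) (A \<times> B)"
    using assms(2,3) by (auto simp: block_family_def inj_on_def)
  then show "card (cat A B) = card A * card B"
    by (simp add: cat_def card_image card_cartesian_product)
qed

lemma block_pow:
  assumes "0 < c" "block_family c N m e W"
  shows "block_family c (q * N) (real q * m) (real q * e) (cat_pow W q) \<and> card (cat_pow W q) = card W ^ q"
proof (induction q)
  case 0
  then show ?case by (simp add: block_family_def full_Nil)
next
  case (Suc q)
  then show ?case
    using block_cat[OF assms(1,2), of "q * N" "real q * m" "real q * e" "cat_pow W q"]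
    by (simp add: algebra_simps)
qed

lemma block_mono_base: "0 < c \<Longrightarrow> c \<le> c' \<Longrightarrow> block_family c N m e W \<Longrightarrow> block_family c' N m e W"
  by (auto simp: block_family_def intro: full_mono_base)

lemma block_recentre:
  "block_family c N m e W \<Longrightarrow> \<bar>m - m'\<bar> + e \<le> e' \<Longrightarrow> block_family c N m' e' W"
  by (fastforce simp: block_family_def)

text \<open>Fullness in a base \<open>c < b\<close>, not just in base \<open>b\<close>, is what lets the concatenations be counted
  for the approximating bases in the definition of the entropy.\<close>

definition rich_at :: "real \<Rightarrow> real \<Rightarrow> real \<Rightarrow> real \<Rightarrow> bool" where
  "rich_at b g s h \<longleftrightarrow> (\<exists>c W N. 1 \<le> c \<and> c < b \<and> 1 \<le> N \<and>
     block_family c N (g * real N) (h * real N) W \<and> b powr ((s - h) * real N) \<le> real (card W))"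

text \<open>For \<open>b > 1\<close> this says that \<open>s\<close> is at most the entropy at
  \<open>g\<close>, by \<open>entropy_ge_of_rich\<close> and \<open>rich_of_entropy_ge\<close>. A
  single tolerance serves the mean and the exponent together.\<close>

definition rich :: "real \<Rightarrow> real \<Rightarrow> real \<Rightarrow> bool" where
  "rich b g s \<longleftrightarrow> (\<forall>h>0. rich_at b g s h)"

lemma rich_at_weaken:
  assumes b: "1 < b" and r: "rich_at b g s h" and h: "h + \<bar>g - g'\<bar> \<le> h'" "s' - h' \<le> s - h"
  shows "rich_at b g' s' h'"
proof -
  obtain c W N where W: "1 \<le> c" "c < b" "1 \<le> N"
    "block_family c N (g * real N) (h * real N) W" "b powr ((s - h) * real N) \<le> real (card W)"
    using r unfolding rich_at_def by blast
  have "(h + \<bar>g - g'\<bar>) * real N \<le> h' * real N" using h by (intro mult_right_mono) auto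
  moreover have "\<bar>g * real N - g' * real N\<bar> = \<bar>g - g'\<bar> * real N"
    by (simp add: abs_mult flip: left_diff_distrib)
  ultimately have "\<bar>g * real N - g' * real N\<bar> + h * real N \<le> h' * real N"
    by (simp add: algebra_simps)
  then have "block_family c N (g' * real N) (h' * real N) W" using W(4) block_recentre by blast
  moreover have "b powr ((s' - h') * real N) \<le> b powr ((s - h) * real N)"
    using b h by (intro powr_mono mult_right_mono) auto
  ultimately show ?thesis unfolding rich_at_def using W by (meson order_trans)
qed

lemma powr_mult_nat:
  assumes "1 < (b::real)" shows "b powr (x * real k) = (b powr x) ^ k"
proof -
  have "b powr (x * real k) = (b powr x) powr real k" by (rule powr_powr[symmetric])
  also have "\<dots> = (b powr x) ^ k" using assms by (intro powr_realpow) simp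
  finally show ?thesis .
qed

text \<open>Concavity of the entropy. Concatenating blocks of the two kinds with total lengths in
  proportion \<open>A\<close> to \<open>Q - A\<close> gives the convex combination of means and of
  exponents; the second \<open>h\<close> pays for rounding \<open>p\<close> to
  \<open>A / Q\<close>.\<close>

lemma rich_at_mix:
  assumes b: "1 < b" and h: "0 < h" and p: "0 \<le> p" "p \<le> 1"
    and "rich_at b g1 s1 h" "rich_at b g2 s2 h"
  shows "rich_at b (p * g1 + (1 - p) * g2) (p * s1 + (1 - p) * s2) (2 * h)"
proof -
  obtain c1 W1 N1 where W1: "1 \<le> c1" "c1 < b" "1 \<le> N1"
    "block_family c1 N1 (g1 * real N1) (h * real N1) W1" "b powr ((s1 - h) * real N1) \<le> real (card W1)"
    using assms(5) unfolding rich_at_def by blast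
  obtain c2 W2 N2 where W2: "1 \<le> c2" "c2 < b" "1 \<le> N2"
    "block_family c2 N2 (g2 * real N2) (h * real N2) W2" "b powr ((s2 - h) * real N2) \<le> real (card W2)"
    using assms(6) unfolding rich_at_def by blast
  define c where "c = max c1 c2"
  have c: "1 \<le> c" "c < b" "0 < c" using W1 W2 by (auto simp: c_def)
  \<comment> \<open>Rounding moves the mean by at most \<open>\<bar>g1 - g2\<bar> / Q\<close> and
    the exponent by at most \<open>\<bar>s1 - s2\<bar> / Q\<close>; both stay within
    \<open>h\<close>. The summand 1 makes \<open>Q\<close> positive.\<close>
  obtain Q :: nat where Q: "(\<bar>g1 - g2\<bar> + \<bar>s1 - s2\<bar> + 1) / h < real Q" using reals_Archimedean2 by blast
  have hQ: "\<bar>g1 - g2\<bar> + \<bar>s1 - s2\<bar> + 1 \<le> h * real Q" using Q h by (simp add: field_simps)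
  then have Q1: "1 \<le> Q" using h by (cases Q) auto
  define A where "A = nat \<lfloor>p * real Q\<rfloor>"
  have pQ: "0 \<le> p * real Q" "p * real Q \<le> real Q" using p mult_right_mono[of p 1 "real Q"] by auto
  then have A: "real A \<le> p * real Q" "p * real Q \<le> real A + 1"
    unfolding A_def using of_nat_floor[OF pQ(1)] by linarith+
  then have AQ: "A \<le> Q" using pQ by linarith
  have dA: "\<bar>real A - p * real Q\<bar> \<le> 1" using A by linarith
  \<comment> \<open>The factors \<open>N2\<close> and \<open>N1\<close> equalise the block lengths,
    so the two parts have lengths \<open>N1 * N2 * A\<close> and
    \<open>N1 * N2 * (Q - A)\<close>.\<close>
  define W where "W = cat (cat_pow W1 (N2 * A)) (cat_pow W2 (N1 * (Q - A)))"
  define N where "N = N1 * N2 * Q"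
  note P1 = block_pow[OF c(3) block_mono_base[OF _ _ W1(4)], of "N2 * A"]
  note P2 = block_pow[OF c(3) block_mono_base[OF _ _ W2(4)], of "N1 * (Q - A)"]
  have f1: "block_family c (N2 * A * N1) (real (N2 * A) * (g1 * real N1)) (real (N2 * A) * (h * real N1)) (cat_pow W1 (N2 * A))"
    and k1: "card (cat_pow W1 (N2 * A)) = card W1 ^ (N2 * A)"
    using P1 W1 W2 by (auto simp: c_def)
  have f2: "block_family c (N1 * (Q - A) * N2) (real (N1 * (Q - A)) * (g2 * real N2)) (real (N1 * (Q - A)) * (h * real N2)) (cat_pow W2 (N1 * (Q - A)))"
    and k2: "card (cat_pow W2 (N1 * (Q - A))) = card W2 ^ (N1 * (Q - A))"
    using P2 W1 W2 by (auto simp: c_def)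
  have len: "N2 * A * N1 + N1 * (Q - A) * N2 = N"
    using AQ by (simp add: N_def algebra_simps flip: distrib_left)
  let ?n = "real N1 * real N2"
  have rQA: "real (Q - A) = real Q - real A" using AQ by simp
  have fW: "block_family c N (real (N2 * A) * (g1 * real N1) + real (N1 * (Q - A)) * (g2 * real N2))
     (real (N2 * A) * (h * real N1) + real (N1 * (Q - A)) * (h * real N2)) W"
    and kW: "card W = card W1 ^ (N2 * A) * card W2 ^ (N1 * (Q - A))"
    using block_cat[OF c(3) f1 f2] k1 k2 by (auto simp: len W_def)
  have e: "real (N2 * A) * (h * real N1) + real (N1 * (Q - A)) * (h * real N2) = h * real N"
    unfolding N_def of_nat_mult rQA by (simp add: algebra_simps)
  have m: "real (N2 * A) * (g1 * real N1) + real (N1 * (Q - A)) * (g2 * real N2)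
      - (p * g1 + (1 - p) * g2) * real N = ?n * ((real A - p * real Q) * (g1 - g2))"
    unfolding N_def of_nat_mult rQA by (simp add: algebra_simps)
  have "\<bar>(real A - p * real Q) * (g1 - g2)\<bar> \<le> 1 * \<bar>g1 - g2\<bar>"
    unfolding abs_mult by (rule mult_right_mono[OF dA]) auto
  also have "\<dots> \<le> h * real Q" by (rule order_trans[OF _ hQ]) simp
  finally have "?n * \<bar>(real A - p * real Q) * (g1 - g2)\<bar> \<le> ?n * (h * real Q)"
    by (intro mult_left_mono) auto
  then have "\<bar>?n * ((real A - p * real Q) * (g1 - g2))\<bar> \<le> h * real N"
    by (simp add: abs_mult N_def mult_ac)
  then have F: "block_family c N ((p * g1 + (1 - p) * g2) * real N) (2 * h * real N) W"
    using m e by (intro block_recentre[OF fW]) (simp add: algebra_simps)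
  have "- \<bar>s1 - s2\<bar> \<le> (real A - p * real Q) * (s1 - s2)"
  proof -
    have "\<bar>(real A - p * real Q) * (s1 - s2)\<bar> \<le> 1 * \<bar>s1 - s2\<bar>"
      unfolding abs_mult by (rule mult_right_mono[OF dA]) auto
    from abs_le_D2[OF this] show ?thesis by simp
  qed
  then have "0 \<le> (real A - p * real Q) * (s1 - s2) + h * real Q"
    using hQ abs_ge_zero[of "g1 - g2"] by linarith
  then have "0 \<le> ?n * ((real A - p * real Q) * (s1 - s2) + h * real Q)" by simp
  also have "\<dots> = (s1 - h) * real N1 * real (N2 * A) + (s2 - h) * real N2 * real (N1 * (Q - A))
      - (p * s1 + (1 - p) * s2 - 2 * h) * real N"
    unfolding N_def of_nat_mult rQA by (simp add: algebra_simps)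
  finally have "b powr ((p * s1 + (1 - p) * s2 - 2 * h) * real N)
      \<le> b powr ((s1 - h) * real N1 * real (N2 * A) + (s2 - h) * real N2 * real (N1 * (Q - A)))"
    using b by (intro powr_mono) auto
  also have "\<dots> = (b powr ((s1 - h) * real N1)) ^ (N2 * A) * (b powr ((s2 - h) * real N2)) ^ (N1 * (Q - A))"
    using b by (simp only: powr_add powr_mult_nat)
  also have "\<dots> \<le> real (card W1) ^ (N2 * A) * real (card W2) ^ (N1 * (Q - A))"
    using W1(5) W2(5) by (intro mult_mono power_mono) auto
  finally have "b powr ((p * s1 + (1 - p) * s2 - 2 * h) * real N) \<le> real (card W)" by (simp add: kW)
  moreover have "1 \<le> N" using W1 W2 Q1 by (simp add: N_def Suc_le_eq)
  ultimately show ?thesis unfolding rich_at_def using F c by blast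
qed

text \<open>Serves the situations where a rich mean is found but only the side of \<open>g\<close>
  on which it lies is known: a rich mean on the other side completes the mixture.\<close>

lemma rich_at_between:
  assumes b: "1 < b" and h: "0 < h" and g: "g1 \<le> g" "g \<le> g2" and s: "s \<le> s1" "s \<le> s2"
    and r: "rich_at b g1 s1 h" "rich_at b g2 s2 h"
  shows "rich_at b g s (2 * h)"
proof (cases "g1 = g2")
  case True
  with g have "g1 = g" by auto
  then show ?thesis using rich_at_weaken[OF b r(1), of g "2 * h" s] h s by auto
next
  case False
  define p where "p = (g2 - g) / (g2 - g1)"
  have p: "0 \<le> p" "p \<le> 1" using g False by (auto simp: p_def)
  have "g2 - p * (g2 - g1) = g" using False by (simp add: p_def)
  then have eq: "p * g1 + (1 - p) * g2 = g" by (simp add: algebra_simps)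
  have "p * s + (1 - p) * s \<le> p * s1 + (1 - p) * s2" using p s by (intro add_mono mult_left_mono) auto
  then have "s \<le> p * s1 + (1 - p) * s2" by (simp add: algebra_simps)
  then show ?thesis
    using rich_at_weaken[OF b rich_at_mix[OF b h p r], of g "2 * h" s] eq by auto
qed

section \<open>Extracting concatenable families from large sets of words\<close>

lemma poly_le_exp_eventually:
  assumes "1 < b" "0 < h" "0 < K"
  shows "eventually (\<lambda>n. (b * real n + 1) * (real n + 1) \<le> K * b powr (h * real n)) sequentially"
proof -
  define q where "q = b powr h"
  have q: "1 < q" using assms by (simp add: q_def)
  have "((\<lambda>n. (b * real n + 1) * (real n + 1) / q ^ n) \<longlongrightarrow> 0) sequentially"
    using q assms(1) by real_asymp
  then have "eventually (\<lambda>n. (b * real n + 1) * (real n + 1) / q ^ n < K) sequentially"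
    using assms(3) by (rule order_tendstoD(2))
  then show ?thesis
  proof eventually_elim
    case (elim n)
    have "b powr (h * real n) = q ^ n"
      using assms(1) by (simp add: q_def powr_powr[symmetric] powr_realpow)
    with elim q show ?case by (simp add: field_simps)
  qed
qed

text \<open>One of the at most \<open>b * n + 1\<close> possible digit sums is taken by a large part
  of \<open>V\<close>; lowering those words loses a factor \<open>n + 1\<close>, and
  \<open>poly_le_exp_eventually\<close> absorbs both factors into the tolerance. The conclusion
  names a word of \<open>V\<close>, so whatever is known about the means in \<open>V\<close> passes
  to the rich mean. The constant \<open>K\<close> admits bounds that come from a positive
  probability.\<close>

lemma rich_at_pigeonhole:
  assumes b: "1 < b" and h: "0 < h" and K: "0 < K"
  shows "eventually (\<lambda>n. \<forall>V. V \<subseteq> admissible_words b n \<longrightarrow> K * b powr (real n * s) \<le> real (card V) \<longrightarrow>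
     (\<exists>w\<in>V. rich_at b (real_of_int (sum_list w) / real n) s h)) sequentially"
  using poly_le_exp_eventually[OF b h K] eventually_ge_at_top[of 1]
    eventually_ge_at_top[of "nat \<lceil>1 / h\<rceil>"]
proof eventually_elim
  case (elim n)
  show ?case
  proof (intro allI impI)
    fix V assume V: "V \<subseteq> admissible_words b n" and cV: "K * b powr (real n * s) \<le> real (card V)"
    have b0: "0 < b" using b by simp
    have fin: "finite V" using V finite_admissible_words[OF b0] finite_subset by blast
    let ?B = "{0..\<lfloor>b * real n\<rfloor>}"
    have fl: "0 \<le> \<lfloor>b * real n\<rfloor>" using b by simp
    have fits: "fits b w 0" "length w = n" if "w \<in> V" for w
      using V that by (auto simp: admissible_words_eq[OF b0])
    have "sum_list \<in> V \<rightarrow> ?B"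
      using sum_list_fits[OF b0 fits(1)] fits(2) by (auto simp: le_floor_iff)
    then obtain y where y: "y \<in> ?B" "card V \<le> card (sum_list -` {y} \<inter> V) * card ?B"
      using pigeonhole_card[of sum_list V ?B] fin fl by auto
    define U where "U = sum_list -` {y} \<inter> V"
    have cU: "card U \<le> card (lower ` U) * (n + 1)"
      using fin fits by (intro card_lower) (auto simp: U_def)
    have cB: "real (card ?B) \<le> b * real n + 1" using fl by simp
    have "real (card V) \<le> real (card U * card ?B)" using y(2) unfolding U_def by (rule of_nat_mono)
    with cV have "K * b powr (real n * s) \<le> real (card U) * real (card ?B)"
      unfolding of_nat_mult by (rule order_trans)
    also have "\<dots> \<le> real (card (lower ` U) * (n + 1)) * (b * real n + 1)"
      using cU cB by (intro mult_mono) (auto simp del: of_nat_mult of_nat_add)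
    finally have 1: "K * b powr (real n * s) \<le> real (card (lower ` U)) * ((b * real n + 1) * (real n + 1))"
      by (simp add: algebra_simps)
    have "0 < K * b powr (real n * s)" using K b by simp
    then have "0 < card U" using cV y(2) by (auto simp: U_def intro: ccontr)
    then obtain w where w: "w \<in> U" by (metis card_gt_0_iff ex_in_conv)
    have pos: "0 < (b * real n + 1) * (real n + 1)" using b by (intro mult_pos_pos add_nonneg_pos) auto
    have "b powr ((s - h) * real n) * ((b * real n + 1) * (real n + 1)) \<le> b powr ((s - h) * real n) * (K * b powr (h * real n))"
      using elim(1) by (intro mult_left_mono) auto
    also have "\<dots> = K * b powr (real n * s)"
      by (simp add: powr_add[symmetric] algebra_simps)
    also note 1
    finally have cl: "b powr ((s - h) * real n) \<le> real (card (lower ` U))"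
      using pos by (simp only: mult_le_cancel_right_pos)
    obtain c where c: "1 \<le> c" "c < b" "admissible_words b n \<subseteq> admissible_words c n"
      using admissible_words_base_below[OF b, of 0] b by auto
    \<comment> \<open>Lowering changes a digit sum by at most 1, which is within the tolerance
      \<open>h * n\<close> for such \<open>n\<close>.\<close>
    have hn: "1 \<le> h * real n"
    proof -
      have "1 / h \<le> real n" using elim(3) by linarith
      with h show ?thesis by (simp add: field_simps)
    qed
    have yn: "y = sum_list w" using w by (simp add: U_def)
    have "block_family c n (real_of_int (sum_list w) / real n * real n) (h * real n) (lower ` U)"
      unfolding block_family_def
    proof (intro conjI ballI)
      show "finite (lower ` U)" using fin by (simp add: U_def)
      fix v assume "v \<in> lower ` U"
      then obtain u where u: "u \<in> V" "sum_list u = y" "v = lower u" by (auto simp: U_def)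
      then show "length v = n" using fits(2) by simp
      have "u \<in> admissible_words c n" using u V c by blast
      then have "fits c u 0" using c by (simp add: admissible_words_eq)
      then show "full c v" using full_lower c(1) u by blast
      have "real_of_int (sum_list v) \<le> real_of_int y" "real_of_int y \<le> real_of_int (sum_list v + 1)"
        using sum_list_lower[of u] u by (simp_all only: of_int_le_iff)
      then show "\<bar>real_of_int (sum_list v) - real_of_int (sum_list w) / real n * real n\<bar> \<le> h * real n"
        using elim(2) hn yn by simp
    qed
    then have "rich_at b (real_of_int (sum_list w) / real n) s h"
      unfolding rich_at_def using c cl elim(2) by blast
    then show "\<exists>w\<in>V. rich_at b (real_of_int (sum_list w) / real n) s h"
      using w by (auto simp: U_def)
  qed
qed

section \<open>Rich means and the entropy\<close>

lemma rich_zero: "1 < b \<Longrightarrow> rich b 0 0"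
  unfolding rich_def rich_at_def
proof (intro allI impI)
  fix h :: real assume b: "1 < b" and h: "0 < h"
  have "b powr ((0 - h) * real 1) \<le> b powr 0" using b h by (intro powr_mono) auto
  moreover have "block_family 1 1 (0 * real 1) (h * real 1) {[0]}"
    using full_replicate_0[of 1 1] h by (simp add: block_family_def)
  ultimately show "\<exists>c W N. 1 \<le> c \<and> c < b \<and> 1 \<le> N \<and> block_family c N (0 * real N) (h * real N) W
      \<and> b powr ((0 - h) * real N) \<le> real (card W)"
    using b by (intro exI[of _ 1] exI[of _ "{[0]}"]) auto
qed


text \<open>Every length \<open>n\<close> is reached by repeating blocks and padding with fewer than
  \<open>N\<close> zeros, so the bound holds for the lower limit. Beyond the two thresholds on
  \<open>n\<close> the padding is negligible in the mean and in the exponent.\<close>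

lemma entropy_ge_of_rich:
  assumes b: "1 < b" and r: "rich b g s"
  shows "ereal s \<le> digit_entropy b g"
  unfolding digit_entropy_eq[OF b]
proof (rule INF_greatest)
  fix d :: real assume "d \<in> {0<..}"
  then have d: "0 < d" by simp
  show "ereal s \<le> (SUP c\<in>{1..<b}. word_growth b c g d)"
  proof (rule ereal_le_epsilon2)
    show "ereal s \<le> (SUP c\<in>{1..<b}. word_growth b c g d) + ereal e" if e: "0 < e" for e
    proof -
      define h where "h = min (e / 2) (d / 2)"
      have h: "0 < h" "h \<le> d / 2" "h \<le> e / 2" using e d by (auto simp: h_def)
      obtain c W N where W: "1 \<le> c" "c < b" "1 \<le> N" "block_family c N (g * real N) (h * real N) W"
        and cW: "b powr ((s - h) * real N) \<le> real (card W)"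
        using r h unfolding rich_def rich_at_def by blast
      have c0: "0 < c" using W by simp
      have "ereal (s - 2 * h) \<le> word_growth b c g d"
        unfolding word_growth_def
      proof (rule Liminf_bounded)
        show "eventually (\<lambda>n. ereal (s - 2 * h) \<le> log_count (word_count c g n d) / ereal (real n * ln b)) sequentially"
          using eventually_ge_at_top[of 1] eventually_gt_at_top[of "nat \<lceil>2 * (\<bar>g\<bar> * real N) / d\<rceil>"]
            eventually_ge_at_top[of "nat \<lceil>\<bar>s - h\<bar> * real N / h\<rceil>"]
        proof eventually_elim
          case (elim n)
          define q where "q = n div N"
          define m where "m = n mod N"
          have n: "n = q * N + m" "m < N" using W(3) by (auto simp: q_def m_def)
          define V where "V = cat (cat_pow W q) {replicate m 0}"
          have Z: "block_family c m 0 0 {replicate m 0}"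
            using full_replicate_0[OF W(1), of m] by (simp add: block_family_def sum_list_replicate)
          note P = block_pow[OF c0 W(4), of q]
          note C = block_cat[OF c0 conjunct1[OF P] Z]
          have bV: "block_family c n (real q * (g * real N)) (real q * (h * real N)) V"
            and kV: "card V = card W ^ q"
            using C conjunct2[OF P] by (auto simp: V_def n(1))
          have "2 * (\<bar>g\<bar> * real N) / d < real n" using elim(2) by linarith
          then have gN: "\<bar>g\<bar> * real N < d / 2 * real n" using d by (simp add: field_simps)
          have shN: "\<bar>s - h\<bar> * real N \<le> h * real n"
          proof -
            have "\<bar>s - h\<bar> * real N / h \<le> real n" using elim(3) by linarith
            then show ?thesis using h by (simp add: field_simps)
          qed
          have rn: "real n = real q * real N + real m" using n(1) by simp
          have "V \<subseteq> {w \<in> admissible_words c n. real n * (g - d) < of_int (sum_list w) \<and> of_int (sum_list w) < real n * (g + d)}"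
          proof
            fix w assume w: "w \<in> V"
            have l: "length w = n" "full c w" "\<bar>real_of_int (sum_list w) - real q * (g * real N)\<bar> \<le> real q * (h * real N)"
              using bV w by (auto simp: block_family_def)
            have "h * (real q * real N) \<le> d / 2 * real n" using h rn by (intro mult_mono) auto
            moreover have "\<bar>g * real m\<bar> \<le> \<bar>g\<bar> * real N" using n(2) by (auto simp: abs_mult intro: mult_left_mono)
            moreover have "real q * (g * real N) = g * real n - g * real m" by (simp add: rn algebra_simps)
            ultimately have "\<bar>real_of_int (sum_list w) - g * real n\<bar> < d * real n"
              using l(3) gN by (simp add: algebra_simps)
            then show "w \<in> {w \<in> admissible_words c n. real n * (g - d) < of_int (sum_list w) \<and> of_int (sum_list w) < real n * (g + d)}"
              using l(1,2) by (auto simp: admissible_words_eq[OF c0] full_fits0 abs_less_iff algebra_simps)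
          qed
          then have "card V \<le> word_count c g n d"
            unfolding word_count_def using finite_admissible_words[OF c0] by (intro card_mono) auto
          moreover have "b powr ((s - 2 * h) * real n) \<le> real (card V)"
          proof -
            have "(s - h) * real m \<le> \<bar>s - h\<bar> * real N" using n(2) by (intro mult_mono) auto
            with shN have "(s - h) * real m \<le> h * real n" by linarith
            then have "(s - 2 * h) * real n \<le> (s - h) * real N * real q"
              by (simp add: rn algebra_simps)
            then have "b powr ((s - 2 * h) * real n) \<le> b powr ((s - h) * real N * real q)"
              using b by (intro powr_mono) auto
            also have "\<dots> = (b powr ((s - h) * real N)) ^ q" by (rule powr_mult_nat[OF b])
            also have "\<dots> \<le> real (card W) ^ q" using cW by (intro power_mono) auto
            finally show ?thesis by (simp add: kV)
          qed
          ultimately have le: "b powr ((s - 2 * h) * real n) \<le> real (word_count c g n d)" by linarith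
          moreover have "0 < b powr ((s - 2 * h) * real n)" using b by simp
          ultimately have pos: "0 < word_count c g n d" by (cases "word_count c g n d") auto
          have "(s - 2 * h) * real n * ln b \<le> ln (real (word_count c g n d))"
            using le b pos by (subst (asm) ln_le_cancel_iff[symmetric]) (auto simp: ln_powr)
          then have "s - 2 * h \<le> ln (real (word_count c g n d)) / (real n * ln b)"
            using elim(1) b by (subst pos_le_divide_eq) (auto simp: mult.assoc)
          then show ?case using pos elim(1) b by (simp add: log_count_def)
        qed
      qed
      also have "\<dots> \<le> (SUP c\<in>{1..<b}. word_growth b c g d)" using W by (intro SUP_upper) auto
      finally have "ereal (s - 2 * h) + ereal (2 * h) \<le> (SUP c\<in>{1..<b}. word_growth b c g d) + ereal e"
        using h by (intro add_mono) auto
      then show "ereal s \<le> (SUP c\<in>{1..<b}. word_growth b c g d) + ereal e" by simp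
    qed
  qed
qed

text \<open>The words counted by the entropy form the set \<open>V\<close> of the pigeonhole
  argument. Their means are within \<open>h / 2\<close> of \<open>g\<close>, and two quarters of
  \<open>h\<close> pay for approximating the entropy and for the pigeonhole.\<close>

lemma rich_of_entropy_ge:
  assumes b: "1 < b" and s: "ereal s \<le> digit_entropy b g"
  shows "rich b g s"
  unfolding rich_def
proof (intro allI impI)
  fix h :: real assume h: "0 < h"
  have "ereal (s - h / 4) < ereal s" using h by simp
  also have "ereal s \<le> (SUP c\<in>{1..<b}. word_growth b c g (h / 2))"
    using s h unfolding digit_entropy_eq[OF b] by (auto simp: le_INF_iff)
  finally obtain c where c: "1 \<le> c" "c < b" "ereal (s - h / 4) < word_growth b c g (h / 2)"
    by (auto simp: less_SUP_iff)
  have "eventually (\<lambda>n. ereal (s - h / 4) < log_count (word_count c g n (h / 2)) / ereal (real n * ln b)) sequentially"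
    using c(3) unfolding word_growth_def by (rule less_LiminfD)
  moreover have "0 < h / 4" using h by simp
  note rich_at_pigeonhole[OF b this zero_less_one, of "s - h / 4"]
  ultimately have "eventually (\<lambda>n. rich_at b g s h) sequentially"
    using eventually_ge_at_top[of 1]
  proof eventually_elim
    case (elim n)
    let ?k = "word_count c g n (h / 2)"
    define V where "V = {w \<in> admissible_words c n. real n * (g - h / 2) < of_int (sum_list w) \<and> of_int (sum_list w) < real n * (g + h / 2)}"
    have nb: "0 < real n * ln b" using elim(3) b by simp
    \<comment> \<open>An empty count has logarithm minus infinity and cannot exceed a real
      bound.\<close>
    have k0: "?k \<noteq> 0"
    proof
      assume "?k = 0"
      then show False using elim(1) nb by (simp add: log_count_def)
    qed
    then have "s - h / 4 < ln (real ?k) / (real n * ln b)"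
      using elim(1,3) b by (simp add: log_count_def)
    then have "(s - h / 4) * (real n * ln b) < ln (real ?k)" using nb by (simp add: pos_less_divide_eq)
    then have "exp ((s - h / 4) * (real n * ln b)) < exp (ln (real ?k))" by (simp only: exp_less_cancel_iff)
    then have "b powr (real n * (s - h / 4)) < real ?k"
      using k0 b by (simp add: powr_def mult.assoc mult.commute mult.left_commute)
    then have "1 * b powr (real n * (s - h / 4)) \<le> real (card V)"
      by (simp add: V_def word_count_def)
    moreover have "V \<subseteq> admissible_words b n"
      using admissible_words_mono[of c b n] c by (auto simp: V_def)
    ultimately obtain w where w: "w \<in> V" "rich_at b (real_of_int (sum_list w) / real n) (s - h / 4) (h / 4)"
      using elim(2) by blast
    have "\<bar>real_of_int (sum_list w) - g * real n\<bar> \<le> h / 2 * real n"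
      using w(1) unfolding V_def by (intro abs_leI) (auto simp: algebra_simps)
    moreover have "real_of_int (sum_list w) / real n - g = (real_of_int (sum_list w) - g * real n) / real n"
      using elim(3) by (simp add: diff_divide_distrib)
    ultimately have "\<bar>real_of_int (sum_list w) / real n - g\<bar> \<le> h / 2"
      using elim(3) by (simp add: abs_divide pos_divide_le_eq)
    then show ?case using rich_at_weaken[OF b w(2), of g h s] h by auto
  qed
  then show "rich_at b g s h" by (auto dest: eventually_happens)
qed

text \<open>The pigeonhole only finds some rich mean up to \<open>g + h / 4\<close>; if it falls
  short of \<open>g\<close>, interpolation with \<open>g'\<close> repairs it, and
  \<open>s \<le> 1\<close> preserves the exponent. Since \<open>freq\<close> asks for infinitely
  many \<open>n\<close>, its failure is an eventual upper bound on the counts, as a covering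
  argument needs.\<close>

lemma rich_of_sparse_count:
  assumes b: "1 < b" and typical: "rich b g' 1" and g: "g \<le> g'" and s: "s \<le> 1"
    and freq: "\<And>e. 0 < e \<Longrightarrow> \<exists>\<^sub>F n in sequentially. b powr (real n * s)
       \<le> real (card {w \<in> admissible_words b n. of_int (sum_list w) \<le> (g + e) * real n})"
  shows "rich b g s"
  unfolding rich_def
proof (intro allI impI)
  fix h :: real assume h: "0 < h"
  then have h4: "0 < h / 4" by simp
  define V where "V n = {w \<in> admissible_words b n. of_int (sum_list w) \<le> (g + h / 4) * real n}" for n
  have "\<exists>\<^sub>F n in sequentially. b powr (real n * s) \<le> real (card (V n)) \<and>
      (\<forall>V. V \<subseteq> admissible_words b n \<longrightarrow> 1 * b powr (real n * s) \<le> real (card V) \<longrightarrow>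
     (\<exists>w\<in>V. rich_at b (real_of_int (sum_list w) / real n) s (h / 4))) \<and> 1 \<le> n"
    using freq[OF h4] eventually_conj[OF rich_at_pigeonhole[OF b h4 zero_less_one, of s] eventually_ge_at_top[of 1]]
    unfolding V_def by (rule frequently_rev_mp[OF _ eventually_mono]) blast
  then obtain n where n: "b powr (real n * s) \<le> real (card (V n))" "1 \<le> n"
    "\<And>V. V \<subseteq> admissible_words b n \<Longrightarrow> 1 * b powr (real n * s) \<le> real (card V) \<Longrightarrow>
     (\<exists>w\<in>V. rich_at b (real_of_int (sum_list w) / real n) s (h / 4))"
    by (auto dest!: frequently_ex)
  have "\<exists>w\<in>V n. rich_at b (real_of_int (sum_list w) / real n) s (h / 4)"
    using n(1) by (intro n(3)) (auto simp: V_def)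
  then obtain w where w: "w \<in> V n" "rich_at b (real_of_int (sum_list w) / real n) s (h / 4)" by blast
  let ?a = "real_of_int (sum_list w) / real n"
  have a: "?a \<le> g + h / 4" using w(1) n(2) by (auto simp: V_def field_simps)
  show "rich_at b g s h"
  proof (cases "g \<le> ?a")
    case True
    then show ?thesis using rich_at_weaken[OF b w(2), of g h s] a h by auto
  next
    case False
    have "rich_at b g s (2 * (h / 4))"
      using rich_at_between[OF b h4 _ g _ s w(2)] typical h4 False by (auto simp: rich_def)
    then show ?thesis using rich_at_weaken[OF b, of g s "2 * (h / 4)" g h s] h by auto
  qed
qed

text \<open>A single word already meets the pigeonhole bound for exponent 0, so prefixes of a point
  with large upper digit average give rich means near or above \<open>a\<close>; an excess is
  removed by mixing with zeros.\<close>

lemma rich_of_le_max_average: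
  assumes b: "1 < b" and a: "0 \<le> a" "ereal a \<le> max_average b"
  shows "rich b a 0"
  unfolding rich_def
proof (intro allI impI)
  fix h :: real assume h: "0 < h"
  then have h4: "0 < h / 4" by simp
  have b0: "0 < b" using b by simp
  have "ereal (a - h / 4) < ereal a" using h by simp
  also note a(2)
  finally obtain x where x: "0 \<le> x" "x < 1" "ereal (a - h / 4) < limsup (\<lambda>n. ereal (digit_average b n x))"
    unfolding max_average_def by (auto simp: less_SUP_iff)
  have "\<exists>\<^sub>F n in sequentially. a - h / 4 < digit_average b n x"
  proof (rule ccontr)
    assume "\<not> ?thesis"
    then have "eventually (\<lambda>n. ereal (digit_average b n x) \<le> ereal (a - h / 4)) sequentially"
      by (auto simp: not_frequently not_less elim: eventually_mono)
    then have "limsup (\<lambda>n. ereal (digit_average b n x)) \<le> ereal (a - h / 4)" by (rule Limsup_bounded)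
    with x(3) show False by simp
  qed
  then have "\<exists>\<^sub>F n in sequentially. a - h / 4 < digit_average b n x \<and>
      (\<forall>V. V \<subseteq> admissible_words b n \<longrightarrow> 1 * b powr (real n * 0) \<le> real (card V) \<longrightarrow>
     (\<exists>w\<in>V. rich_at b (real_of_int (sum_list w) / real n) 0 (h / 4)))"
    using rich_at_pigeonhole[OF b h4 zero_less_one, of 0]
    by (rule frequently_rev_mp[OF _ eventually_mono]) blast
  then obtain n where n: "a - h / 4 < digit_average b n x"
    "\<And>V. V \<subseteq> admissible_words b n \<Longrightarrow> 1 * b powr (real n * 0) \<le> real (card V) \<Longrightarrow>
     (\<exists>w\<in>V. rich_at b (real_of_int (sum_list w) / real n) 0 (h / 4))"
    by (auto dest!: frequently_ex)
  have "\<exists>w\<in>{digit_word b n x}. rich_at b (real_of_int (sum_list w) / real n) 0 (h / 4)"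
    using digit_word_admissible[OF b0 x(1,2)] by (intro n(2)) auto
  then have r: "rich_at b (digit_average b n x) 0 (h / 4)"
    by (simp add: sum_list_digit_word digit_average_def)
  show "rich_at b a 0 h"
  proof (cases "digit_average b n x \<le> a")
    case True
    then show ?thesis using rich_at_weaken[OF b r, of a h 0] n(1) h by auto
  next
    case False
    have "rich_at b a 0 (2 * (h / 4))"
      using rich_at_between[OF b h4 a(1) _ order_refl order_refl _ r] rich_zero[OF b] h4 False
      by (auto simp: rich_def)
    then show ?thesis using rich_at_weaken[OF b, of a 0 "2 * (h / 4)" a h 0] h by auto
  qed
qed

text \<open>Turns means within a tolerance of \<open>a\<close> into means at most \<open>a\<close>,
  by mixing in a small proportion \<open>k\<close> of zeros.\<close>

lemma rich_below:
  assumes b: "1 < b" and r: "rich b a s" and a: "0 < a" and h: "0 < h"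
  shows "\<exists>c W N. 1 \<le> c \<and> c < b \<and> 1 \<le> N \<and> finite W \<and> b powr ((s - h) * real N) \<le> real (card W) \<and>
    (\<forall>w\<in>W. length w = N \<and> full c w \<and> (a - h) * real N \<le> of_int (sum_list w) \<and> of_int (sum_list w) \<le> a * real N)"
proof -
  \<comment> \<open>Mixing lowers the mean by \<open>k * a\<close> and the exponent by
    \<open>k * s\<close>, neither by more than \<open>h / 2\<close>. Then \<open>e\<close> makes the
    tolerance \<open>2 * e\<close> of the mixture at most \<open>k * a\<close>, so the digit sums do
    not exceed \<open>a * N\<close>.\<close>
  define k where "k = min 1 (h / (2 * (a + \<bar>s\<bar> + 1)))"
  define e where "e = min (k * a / 2) (h / 4)"
  have D: "0 < 2 * (a + \<bar>s\<bar> + 1)" using a by simp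
  have k: "0 < k" "k \<le> 1" using h D by (auto simp: k_def)
  have "k \<le> h / (2 * (a + \<bar>s\<bar> + 1))" by (simp add: k_def)
  then have "k * (2 * (a + \<bar>s\<bar> + 1)) \<le> h" using D by (simp only: pos_le_divide_eq)
  then have kk: "k * a + k * \<bar>s\<bar> + k \<le> h / 2" by (simp add: algebra_simps)
  have "0 \<le> k * a" "0 \<le> k * \<bar>s\<bar>" "k * s \<le> k * \<bar>s\<bar>" using k a by auto
  with kk k have ka: "k * a \<le> h / 2" "k * s \<le> h / 2" by linarith+
  have "e \<le> k * a / 2" "e \<le> h / 4" "0 < e" using k a h by (auto simp: e_def)
  then have e: "0 < e" "2 * e \<le> k * a" "2 * e \<le> h / 2" by linarith+
  have "rich_at b ((1 - k) * a + (1 - (1 - k)) * 0) ((1 - k) * s + (1 - (1 - k)) * 0) (2 * e)"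
    using r rich_zero[OF b] e k by (intro rich_at_mix[OF b]) (auto simp: rich_def)
  then obtain c W N where W: "1 \<le> c" "c < b" "1 \<le> N"
    "block_family c N ((1 - k) * a * real N) (2 * e * real N) W"
    "b powr (((1 - k) * s - 2 * e) * real N) \<le> real (card W)"
    unfolding rich_at_def by auto
  have "s - h \<le> (1 - k) * s - 2 * e" using ka e by (simp add: algebra_simps)
  then have "b powr ((s - h) * real N) \<le> b powr (((1 - k) * s - 2 * e) * real N)"
    using b by (intro powr_mono mult_right_mono) auto
  with W(5) have c: "b powr ((s - h) * real N) \<le> real (card W)" by linarith
  have "(a - h) * real N \<le> of_int (sum_list w) \<and> of_int (sum_list w) \<le> a * real N" if "w \<in> W" for w
  proof -
    have "\<bar>real_of_int (sum_list w) - (1 - k) * a * real N\<bar> \<le> 2 * e * real N"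
      using W(4) that by (auto simp: block_family_def)
    moreover have "((1 - k) * a + 2 * e) * real N \<le> a * real N"
      using e by (intro mult_right_mono) (auto simp: algebra_simps)
    moreover have "(a - h) * real N \<le> ((1 - k) * a - 2 * e) * real N"
      using e ka by (intro mult_right_mono) (auto simp: algebra_simps)
    ultimately show ?thesis by (simp add: algebra_simps abs_le_iff)
  qed
  with W c show ?thesis
    by (intro exI[of _ c] exI[of _ W] exI[of _ N]) (auto simp: block_family_def)
qed

text \<open>Enlarging the set of words to all combinations of first digits and tails makes the
  exponential weights factorise; each position contributes at most a geometric series.\<close>

lemma sum_power_words_le:
  fixes z :: real
  assumes z: "0 < z" "z < 1" and "finite W" "\<forall>w\<in>W. length w = N \<and> (\<forall>d\<in>set w. 0 \<le> d)"
  shows "(\<Sum>w\<in>W. z ^ nat (sum_list w)) \<le> (1 / (1 - z)) ^ N"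
  using assms(3,4)
proof (induction N arbitrary: W)
  case 0
  then have "W \<subseteq> {[]}" by auto
  then have "(\<Sum>w\<in>W. z ^ nat (sum_list w)) \<le> (\<Sum>w\<in>{[]}. z ^ nat (sum_list w))"
    using z by (intro sum_mono2) auto
  then show ?case by simp
next
  case (Suc N)
  let ?D = "hd ` W" and ?T = "tl ` W"
  have ne: "w \<noteq> []" if "w \<in> W" for w using Suc.prems that by auto
  have D: "0 \<le> d" if "d \<in> ?D" for d using that Suc.prems ne by auto
  have T: "length v = N \<and> (\<forall>d\<in>set v. 0 \<le> d)" if "v \<in> ?T" for v
  proof -
    obtain w where w: "w \<in> W" "v = tl w" using \<open>v \<in> ?T\<close> by auto
    then show ?thesis using Suc.prems(2) list.set_sel(2)[OF ne[OF w(1)]] by auto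
  qed
  have nnT: "0 \<le> sum_list v" if "v \<in> ?T" for v using T[OF that] by (intro sum_list_nonneg) auto
  have "W \<subseteq> (\<lambda>(d, v). d # v) ` (?D \<times> ?T)"
  proof
    fix w assume "w \<in> W"
    then show "w \<in> (\<lambda>(d, v). d # v) ` (?D \<times> ?T)"
      using ne by (intro image_eqI[of _ _ "(hd w, tl w)"]) auto
  qed
  then have "(\<Sum>w\<in>W. z ^ nat (sum_list w)) \<le> (\<Sum>w\<in>(\<lambda>(d, v). d # v) ` (?D \<times> ?T). z ^ nat (sum_list w))"
    using z Suc.prems by (intro sum_mono2) auto
  also have "\<dots> = (\<Sum>(d, v)\<in>?D \<times> ?T. z ^ nat (d + sum_list v))"
    by (subst sum.reindex) (auto simp: inj_on_def intro!: sum.cong)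
  also have "\<dots> = (\<Sum>(d, v)\<in>?D \<times> ?T. z ^ nat d * z ^ nat (sum_list v))"
    using D nnT by (intro sum.cong) (auto simp: nat_add_distrib power_add)
  also have "\<dots> = (\<Sum>d\<in>?D. z ^ nat d) * (\<Sum>v\<in>?T. z ^ nat (sum_list v))"
    by (simp add: sum_product sum.cartesian_product)
  also have "\<dots> \<le> 1 / (1 - z) * (1 / (1 - z)) ^ N"
  proof (intro mult_mono)
    have inj: "inj_on nat ?D" by (rule inj_onI) (metis D eq_nat_nat_iff)
    have "(\<Sum>d\<in>?D. z ^ nat d) = (\<Sum>k\<in>nat ` ?D. z ^ k)"
      by (subst sum.reindex[OF inj]) (simp only: comp_def)
    also have "\<dots> \<le> (\<Sum>k. z ^ k)"
      using z Suc.prems by (intro sum_le_suminf summable_geometric) auto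
    also have "\<dots> = 1 / (1 - z)" using z by (simp add: suminf_geometric)
    finally show "(\<Sum>d\<in>?D. z ^ nat d) \<le> 1 / (1 - z)" .
    show "(\<Sum>v\<in>?T. z ^ nat (sum_list v)) \<le> (1 / (1 - z)) ^ N"
      using Suc.prems T by (intro Suc.IH) auto
  qed (use z in \<open>auto intro!: sum_nonneg\<close>)
  finally show ?case by simp
qed

text \<open>A Chernoff bound for words of small digit sum. It settles \<alpha> = 0, which
  \<open>rich_below\<close> excludes.\<close>

lemma rich_zero_mean_nonpos:
  assumes b: "1 < b" and r: "rich b 0 s"
  shows "s \<le> 0"
proof (rule ccontr)
  assume "\<not> s \<le> 0"
  then have s: "0 < s" by simp
  \<comment> \<open>Chosen so that the total weight is at most \<open>b powr (s / 4 * N)\<close>.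
    The second bound in \<open>h\<close> makes each word weigh at least
    \<open>b powr (- (s / 4) * N)\<close>. Hence there are at most \<open>b powr (s / 2 * N)\<close>
    words, fewer than the \<open>b powr ((s - h) * N)\<close> that richness provides.\<close>
  define z where "z = 1 - b powr (- s / 4)"
  have "b powr (- s / 4) < b powr 0" using b s by (intro powr_less_mono) auto
  then have z: "0 < z" "z < 1" using b by (auto simp: z_def)
  have iz: "1 / (1 - z) = b powr (s / 4)" using b by (simp add: z_def powr_minus_divide)
  have lz: "0 < - ln z" using z by simp
  define h where "h = min (s / 8) (s / 4 * ln b / (- ln z))"
  have "0 < s / 4 * ln b / (- ln z)" using s b lz by (intro divide_pos_pos mult_pos_pos) auto
  then have h: "0 < h" "h \<le> s / 8" using s by (auto simp: h_def)
  have "h * (- ln z) \<le> s / 4 * ln b / (- ln z) * (- ln z)"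
    using lz by (intro mult_right_mono) (auto simp: h_def)
  then have hz: "h * (- ln z) \<le> s / 4 * ln b" using lz by simp
  obtain c W N where W: "1 \<le> c" "c < b" "1 \<le> N" "block_family c N (0 * real N) (h * real N) W"
      and cW: "b powr ((s - h) * real N) \<le> real (card W)"
    using r h unfolding rich_def rich_at_def by blast
  have nn: "0 \<le> d" if "w \<in> W" "d \<in> set w" for w d
    using W(4) that by (auto simp: block_family_def dest: full_fits0 fits_digits)
  have "b powr (- (s / 4) * real N) \<le> z ^ nat (sum_list w)" if "w \<in> W" for w
  proof -
    have "0 \<le> sum_list w" using nn that by (intro sum_list_nonneg) auto
    then have "real (nat (sum_list w)) \<le> h * real N" using W(4) that by (auto simp: block_family_def)
    then have "z powr (h * real N) \<le> z powr real (nat (sum_list w))" using z by (intro powr_mono') auto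
    moreover have "z powr real (nat (sum_list w)) = z ^ nat (sum_list w)" using z by (simp add: powr_realpow)
    moreover have "b powr (- (s / 4) * real N) \<le> z powr (h * real N)"
      using b z mult_right_mono[OF hz, of "real N"] by (simp add: powr_def algebra_simps)
    ultimately show ?thesis by linarith
  qed
  then have "real (card W) * b powr (- (s / 4) * real N) \<le> (\<Sum>w\<in>W. z ^ nat (sum_list w))"
    by (intro sum_bounded_below)
  also have "\<dots> \<le> (1 / (1 - z)) ^ N"
    using W(4) nn by (intro sum_power_words_le[OF z]) (auto simp: block_family_def)
  also have "\<dots> = b powr (s / 4 * real N)"
    using b by (simp add: iz powr_realpow[symmetric] powr_powr)
  finally have "real (card W) * b powr (- (s / 4) * real N) \<le> b powr (s / 4 * real N)" .
  moreover have "b powr ((s - h) * real N) * b powr (- (s / 4) * real N) \<le> real (card W) * b powr (- (s / 4) * real N)"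
    using cW by (intro mult_right_mono) auto
  ultimately have "b powr ((s - h) * real N + - (s / 4) * real N) \<le> b powr (s / 4 * real N)"
    unfolding powr_add by linarith
  then have "(s - h) * real N + - (s / 4) * real N \<le> s / 4 * real N" using b by simp
  then have "(s - h - s / 2) * real N \<le> 0" by (simp add: algebra_simps)
  then have "s - h - s / 2 \<le> 0" using W(3) by (simp add: mult_le_0_iff)
  with h s show False by linarith
qed

section \<open>The invariant measure and the typical average\<close>

lemma measurable_beta_map [measurable]: "beta_map b \<in> borel_measurable borel"
  unfolding beta_map_def by measurable

lemma measurable_beta_iter [measurable]: "(beta_map b ^^ k) \<in> borel_measurable borel"
  by (induction k) (auto intro: measurable_comp)

text \<open>The cut at \<open>a\<close> makes the family closed under taking preimages: the last
  branch of \<open>beta_map b\<close> on \<open>{0..<a}\<close> ends at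
  \<open>beta_map b a\<close>.\<close>

definition iter_set :: "real \<Rightarrow> real set \<Rightarrow> nat \<Rightarrow> real \<Rightarrow> real set" where
  "iter_set b B k a = {x \<in> {0..<a}. (beta_map b ^^ k) x \<in> B}"

lemma iter_set_borel [measurable]:
  assumes "B \<in> sets borel" shows "iter_set b B k a \<in> sets borel"
proof -
  have "iter_set b B k a = {0..<a} \<inter> ((beta_map b ^^ k) -` B \<inter> space borel)"
    by (auto simp: iter_set_def)
  also have "\<dots> \<in> sets borel"
    by (rule sets.Int[OF _ measurable_sets[OF measurable_beta_iter assms]]) simp
  finally show ?thesis .
qed

lemma measure_affine_preimage:
  assumes "0 < b" "B \<in> sets borel" "emeasure lborel B < \<infinity>"
  shows "integrable lborel (\<lambda>x. indicator B (b * x - t) :: real)"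
    and "(\<integral>x. indicator B (b * x - t) \<partial>lborel) = measure lborel B / b"
proof -
  have i: "integrable lborel (indicator B :: real \<Rightarrow> real)" using assms by simp
  have "integrable lborel (\<lambda>x. indicator B (- t + b * x) :: real)"
    using lborel_integrable_real_affine[OF i, of b "- t"] assms by simp
  then show "integrable lborel (\<lambda>x. indicator B (b * x - t) :: real)" by (simp add: add.commute)
  have "(\<integral>x. (indicator B x :: real) \<partial>lborel) = \<bar>b\<bar> *\<^sub>R (\<integral>x. indicator B (- t + b * x) \<partial>lborel)"
    using assms by (intro lborel_integral_real_affine) auto
  then show "(\<integral>x. indicator B (b * x - t) \<partial>lborel) = measure lborel B / b"
    using assms by (simp add: add.commute field_simps)
qed

text \<open>On \<open>{0..<a}\<close> the map has \<open>\<lfloor>b * a\<rfloor>\<close> branches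
  onto the unit interval and a last one onto the interval ending at \<open>beta_map b a\<close>. In
  this pointwise form it passes to measures by an affine substitution in each term.\<close>

lemma branch_indicator:
  assumes b: "0 < b" and a: "0 \<le> a" and B: "B \<subseteq> {0..<1}"
  shows "indicator {x \<in> {0..<a}. beta_map b x \<in> B} x =
    (\<Sum>j<nat \<lfloor>b * a\<rfloor>. indicator B (b * x - real j))
      + (indicator (B \<inter> {0..<beta_map b a}) (b * x - real (nat \<lfloor>b * a\<rfloor>)) :: real)"
proof -
  define m where "m = \<lfloor>b * x\<rfloor>"
  define d where "d = nat \<lfloor>b * a\<rfloor>"
  define y where "y = beta_map b x"
  define u where "u = beta_map b a"
  have y: "0 \<le> y" "y < 1" "b * x = of_int m + y" using beta_map_range[of b x]
    by (auto simp: y_def m_def beta_map_def)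
  have "0 \<le> \<lfloor>b * a\<rfloor>" using a b by simp
  then have u: "0 \<le> u" "u < 1" "b * a = real d + u" using beta_map_range[of b a]
    by (auto simp: u_def d_def beta_map_def)
  have key: "b * x - real j \<in> B \<longleftrightarrow> m = int j \<and> y \<in> B" for j
  proof
    assume "b * x - real j \<in> B"
    then have "b * x - real j \<in> {0..<1}" using B by (rule subsetD[rotated])
    then have "of_int (int j) \<le> b * x \<and> b * x < of_int (int j) + 1"
      unfolding atLeastLessThan_iff of_int_of_nat_eq by linarith
    then have "\<lfloor>b * x\<rfloor> = int j" by (simp only: floor_eq_iff)
    then have "m = int j" by (simp only: m_def)
    moreover then have "b * x - real j = y" using y(3) by simp
    ultimately show "m = int j \<and> y \<in> B" using \<open>b * x - real j \<in> B\<close> by (simp only: simp_thms)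
  next
    assume "m = int j \<and> y \<in> B"
    moreover then have "b * x - real j = y" using y(3) by simp
    ultimately show "b * x - real j \<in> B" by (simp only:)
  qed
  have "(\<Sum>j<d. indicator B (b * x - real j)) = (\<Sum>j<d. if nat m = j then (if 0 \<le> m \<and> y \<in> B then 1 else 0) else 0 :: real)"
    by (intro sum.cong refl) (auto simp: indicator_def key)
  also have "\<dots> = (if nat m < d \<and> 0 \<le> m \<and> y \<in> B then 1 else 0)" by simp
  finally have s: "(\<Sum>j<d. indicator B (b * x - real j)) = (if nat m < d \<and> 0 \<le> m \<and> y \<in> B then 1 else 0 :: real)" .
  have l: "b * x - real d \<in> B \<inter> {0..<u} \<longleftrightarrow> m = int d \<and> y \<in> B \<and> y < u"
    using key[of d] y by auto
  have x0: "0 \<le> x \<longleftrightarrow> 0 \<le> m" using b by (simp add: m_def zero_le_mult_iff)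
  have "x < a \<longleftrightarrow> b * x < b * a" using b by simp
  also have "\<dots> \<longleftrightarrow> m < int d \<or> (m = int d \<and> y < u)"
  proof -
    have "real_of_int m + y < real d + u \<longleftrightarrow> m < int d \<or> (m = int d \<and> y < u)"
    proof (cases "m < int d")
      case True
      then have "real_of_int m + 1 \<le> real d" by linarith
      with y u True show ?thesis by auto
    next
      case False
      show ?thesis
      proof (cases "m = int d")
        case False
        with \<open>\<not> m < int d\<close> have "real d + 1 \<le> real_of_int m" by linarith
        with y u False \<open>\<not> m < int d\<close> show ?thesis by auto
      qed auto
    qed
    then show ?thesis using y(3) u(3) by simp
  qed
  finally have xa: "x < a \<longleftrightarrow> m < int d \<or> (m = int d \<and> y < u)" .
  have S: "x \<in> {x \<in> {0..<a}. beta_map b x \<in> B} \<longleftrightarrow> 0 \<le> m \<and> (m < int d \<or> (m = int d \<and> y < u)) \<and> y \<in> B"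
    unfolding mem_Collect_eq atLeastLessThan_iff x0 xa y_def by blast
  have "indicator {x \<in> {0..<a}. beta_map b x \<in> B} x =
    (\<Sum>j<d. indicator B (b * x - real j)) + (indicator (B \<inter> {0..<u}) (b * x - real d) :: real)"
    unfolding s unfolding indicator_def S l by (auto simp: nat_less_iff)
  then show ?thesis by (simp only: d_def u_def)
qed

lemma measure_branches:
  assumes b: "0 < b" and a: "0 \<le> a" and B: "B \<in> sets borel" "B \<subseteq> {0..<1}"
  shows "measure lborel {x \<in> {0..<a}. beta_map b x \<in> B} =
    (of_int \<lfloor>b * a\<rfloor> * measure lborel B + measure lborel (B \<inter> {0..<beta_map b a})) / b"
proof -
  have fin: "emeasure lborel A < \<infinity>" if "A \<subseteq> {0..<1}" "A \<in> sets borel" for A :: "real set"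
  proof -
    have "emeasure lborel A \<le> emeasure lborel {0..<1::real}" using that by (intro emeasure_mono) auto
    also have "\<dots> < \<infinity>" by simp
    finally show ?thesis .
  qed
  let ?C = "B \<inter> {0..<beta_map b a}"
  have C: "?C \<in> sets borel" "emeasure lborel ?C < \<infinity>" using B fin[of ?C] by auto
  note i1 = measure_affine_preimage[OF b B(1) fin[OF B(2,1)]] and i2 = measure_affine_preimage[OF b C]
  have "measure lborel {x \<in> {0..<a}. beta_map b x \<in> B} = (\<integral>x. indicator {x \<in> {0..<a}. beta_map b x \<in> B} x \<partial>lborel)"
    by simp
  also have "\<dots> = (\<integral>x. (\<Sum>j<nat \<lfloor>b * a\<rfloor>. indicator B (b * x - real j))
      + (indicator ?C (b * x - real (nat \<lfloor>b * a\<rfloor>)) :: real) \<partial>lborel)"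
    by (intro Bochner_Integration.integral_cong refl branch_indicator b a B)
  also have "\<dots> = (\<Sum>j<nat \<lfloor>b * a\<rfloor>. measure lborel B / b) + measure lborel ?C / b"
    using i1 i2 by (subst Bochner_Integration.integral_add) (auto simp: Bochner_Integration.integral_sum)
  also have "\<dots> = (of_int \<lfloor>b * a\<rfloor> * measure lborel B + measure lborel ?C) / b"
    using a b by (simp add: add_divide_distrib)
  finally show ?thesis .
qed

lemma iter_set_1: "iter_set b B k 1 \<subseteq> {0..<1}"
  by (auto simp: iter_set_def)

lemma iter_set_Suc: "iter_set b B (Suc k) a = {x \<in> {0..<a}. beta_map b x \<in> iter_set b B k 1}"
  using beta_map_range by (auto simp: iter_set_def funpow_Suc_right simp del: funpow.simps)

lemma iter_set_Int: "a \<le> 1 \<Longrightarrow> iter_set b B k 1 \<inter> {0..<a} = iter_set b B k a"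
  by (auto simp: iter_set_def)

text \<open>The integral over \<open>{0..<a}\<close> of the number of visits to \<open>B\<close> at
  times below \<open>n\<close>.\<close>

definition visits :: "real \<Rightarrow> real set \<Rightarrow> nat \<Rightarrow> real \<Rightarrow> real" where
  "visits b B n a = (\<Sum>k<n. measure lborel (iter_set b B k a))"

lemma measure_iter_set_Suc:
  assumes "0 < b" "0 \<le> a" "B \<in> sets borel"
  shows "measure lborel (iter_set b B (Suc k) a) =
    (of_int \<lfloor>b * a\<rfloor> * measure lborel (iter_set b B k 1) + measure lborel (iter_set b B k (beta_map b a))) / b"
  unfolding iter_set_Suc
  using assms measure_branches[OF assms(1,2) iter_set_borel[OF assms(3), of b k 1] iter_set_1]
    iter_set_Int[of "beta_map b a" b B k] beta_map_range[of b a] by simp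

lemma measure_iter_set_le:
  assumes "0 \<le> a" "B \<in> sets borel"
  shows "measure lborel (iter_set b B k a) \<le> a"
proof -
  have "measure lborel (iter_set b B k a) \<le> measure lborel {0..<a}"
    using assms by (intro measure_mono_fmeasurable) (auto simp: iter_set_def fmeasurable_def intro: iter_set_borel[unfolded iter_set_def])
  with assms show ?thesis by simp
qed

text \<open>The digit expansion \<open>a = (floor (b a) + T a) / b\<close> makes the deviation
  \<open>visits a - a * visits 1\<close> contract by \<open>1 / b\<close> up to a bounded error.\<close>

lemma visits_proportional:
  assumes b: "1 < b" and B: "B \<in> sets borel" and a: "0 \<le> a" "a \<le> 1"
  shows "\<bar>visits b B n a - a * visits b B n 1\<bar> \<le> b / (b - 1)"
  using a
proof (induction n arbitrary: a)
  case 0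
  then show ?case using b by (simp add: visits_def)
next
  case (Suc n)
  have b0: "0 < b" using b by simp
  let ?c = "\<lambda>k a. measure lborel (iter_set b B k a)"
  have "visits b B (Suc n) a = ?c 0 a + (\<Sum>k<n. ?c (Suc k) a)"
    unfolding visits_def by (rule sum.lessThan_Suc_shift)
  also have "(\<Sum>k<n. ?c (Suc k) a) = (of_int \<lfloor>b * a\<rfloor> * visits b B n 1 + visits b B n (beta_map b a)) / b"
    unfolding visits_def sum_distrib_left sum.distrib[symmetric] sum_divide_distrib
    by (intro sum.cong refl measure_iter_set_Suc b0 Suc.prems B)
  finally have e: "visits b B (Suc n) a = ?c 0 a + (of_int \<lfloor>b * a\<rfloor> * visits b B n 1 + visits b B n (beta_map b a)) / b" .
  \<comment> \<open>The sum over \<open>{0..<a}\<close> was peeled at time 0, the one over the unit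
    interval is peeled at time \<open>n\<close>; the two leftover terms form the error bounded by
    1.\<close>
  have s: "visits b B (Suc n) 1 = visits b B n 1 + ?c n 1" by (simp add: visits_def)
  have aa: "a = (of_int \<lfloor>b * a\<rfloor> + beta_map b a) / b" using b by (simp add: beta_map_def)
  have "a * visits b B n 1 = (of_int \<lfloor>b * a\<rfloor> * visits b B n 1 + beta_map b a * visits b B n 1) / b"
    by (subst aa) (simp add: algebra_simps add_divide_distrib)
  then have "visits b B (Suc n) a - a * visits b B (Suc n) 1
      = (?c 0 a - a * ?c n 1) + (visits b B n (beta_map b a) - beta_map b a * visits b B n 1) / b"
    unfolding e s by (simp add: algebra_simps add_divide_distrib diff_divide_distrib)
  moreover have "\<bar>?c 0 a - a * ?c n 1\<bar> \<le> 1"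
  proof -
    have "?c 0 a \<le> a" "0 \<le> ?c 0 a" "0 \<le> ?c n 1" "?c n 1 \<le> 1"
      using Suc.prems B measure_iter_set_le by auto
    moreover have "a * ?c n 1 \<le> 1 * 1"
      using Suc.prems measure_iter_set_le[of 1 B b n] B by (intro mult_mono) auto
    moreover have "0 \<le> a * ?c n 1" using Suc.prems by (intro mult_nonneg_nonneg measure_nonneg)
    ultimately show ?thesis using Suc.prems by linarith
  qed
  moreover have "\<bar>(visits b B n (beta_map b a) - beta_map b a * visits b B n 1) / b\<bar> \<le> (b / (b - 1)) / b"
    using b beta_map_range[of b a] divide_right_mono[OF Suc.IH[of "beta_map b a"], of b]
    by (simp add: abs_divide)
  \<comment> \<open>The constant of the lemma is the solution of
    \<open>C = 1 + C / b\<close>.\<close>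
  moreover have "1 + (b / (b - 1)) / b = b / (b - 1)" using b by (simp add: field_simps)
  ultimately show ?case by linarith
qed

section \<open>Mean independence of integrable functions and preimages\<close>

abbreviation unit_leb :: "real measure" where
  "unit_leb \<equiv> restrict_space lborel {0..<1}"

lemma sets_unit_leb: "B \<in> sets unit_leb \<longleftrightarrow> B \<subseteq> {0..<1} \<and> B \<in> sets borel"
  by (auto simp: sets_restrict_space_iff)

lemma space_unit_leb [simp]: "space unit_leb = {0..<1}"
  by (simp add: space_restrict_space)

lemma prob_space_unit_leb: "prob_space unit_leb"
  by (rule prob_spaceI) (simp add: emeasure_restrict_space)

lemma measure_unit_leb: "B \<subseteq> {0..<1} \<Longrightarrow> measure unit_leb B = measure lborel B"
  by (intro measure_restrict_space) auto

text \<open>Cesaro mean of the covariances, under Lebesgue measure, between \<open>f\<close> and the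
  indicators of the preimages of \<open>B\<close>. That it tends to 0 for every integrable
  \<open>f\<close> takes the place of ergodicity.\<close>

definition defect :: "real \<Rightarrow> real set \<Rightarrow> nat \<Rightarrow> (real \<Rightarrow> real) \<Rightarrow> real" where
  "defect b B n f = (\<Sum>k<n. (\<integral>x. f x * indicator (iter_set b B k 1) x \<partial>unit_leb)
     - (\<integral>x. f x \<partial>unit_leb) * measure lborel (iter_set b B k 1)) / real n"

lemma integrable_mult_iter:
  fixes f :: "real \<Rightarrow> real"
  assumes "integrable unit_leb f" "B \<in> sets borel"
  shows "integrable unit_leb (\<lambda>x. f x * indicator (iter_set b B k 1) x)"
  using iter_set_1[of b B k] iter_set_borel[OF assms(2)]
  by (intro integrable_real_mult_indicator[OF _ assms(1)]) (simp add: sets_unit_leb)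

lemma defect_diff:
  assumes "integrable unit_leb f" "integrable unit_leb g" "B \<in> sets borel"
  shows "defect b B n (\<lambda>x. f x - g x) = defect b B n f - defect b B n g"
  unfolding defect_def diff_divide_distrib[symmetric] sum_subtractf[symmetric] left_diff_distrib
  using assms by (simp add: integrable_mult_iter algebra_simps)

lemma defect_add:
  assumes "integrable unit_leb f" "integrable unit_leb g" "B \<in> sets borel"
  shows "defect b B n (\<lambda>x. f x + g x) = defect b B n f + defect b B n g"
  unfolding defect_def add_divide_distrib[symmetric] sum.distrib[symmetric] distrib_right
  using assms by (simp add: integrable_mult_iter algebra_simps)

lemma defect_scale: "defect b B n (\<lambda>x. c * f x) = c * defect b B n f"
  unfolding defect_def times_divide_eq_right sum_distrib_left
  by (simp add: algebra_simps)

text \<open>Uniform in \<open>n\<close>, so that functions with vanishing defect are closed under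
  limits in mean.\<close>

lemma defect_bound:
  assumes f: "integrable unit_leb f" and B: "B \<in> sets borel"
  shows "\<bar>defect b B n f\<bar> \<le> 2 * (\<integral>x. \<bar>f x\<bar> \<partial>unit_leb)"
proof -
  let ?I = "\<integral>x. \<bar>f x\<bar> \<partial>unit_leb"
  have I: "0 \<le> ?I" by simp
  have "\<bar>(\<integral>x. f x * indicator (iter_set b B k 1) x \<partial>unit_leb)
     - (\<integral>x. f x \<partial>unit_leb) * measure lborel (iter_set b B k 1)\<bar> \<le> 2 * ?I" for k
  proof -
    have "\<bar>\<integral>x. f x * indicator (iter_set b B k 1) x \<partial>unit_leb\<bar> \<le> (\<integral>x. \<bar>f x * indicator (iter_set b B k 1) x\<bar> \<partial>unit_leb)"
      by (rule integral_abs_bound)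
    also have "\<dots> \<le> ?I"
      using f integrable_mult_iter[OF f B] by (intro integral_mono) (auto simp: indicator_def)
    finally have 1: "\<bar>\<integral>x. f x * indicator (iter_set b B k 1) x \<partial>unit_leb\<bar> \<le> ?I" .
    have "\<bar>(\<integral>x. f x \<partial>unit_leb) * measure lborel (iter_set b B k 1)\<bar> \<le> ?I * 1"
      unfolding abs_mult using measure_iter_set_le[of 1 B b k] B I
      by (intro mult_mono integral_abs_bound) auto
    with 1 show ?thesis by linarith
  qed
  then have "\<bar>\<Sum>k<n. (\<integral>x. f x * indicator (iter_set b B k 1) x \<partial>unit_leb)
     - (\<integral>x. f x \<partial>unit_leb) * measure lborel (iter_set b B k 1)\<bar> \<le> (\<Sum>k<n. 2 * ?I)"
    by (intro order_trans[OF sum_abs] sum_mono)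
  then show ?thesis
    unfolding defect_def using I by (cases "n = 0") (auto simp: abs_divide field_simps)
qed

lemma defect_limit:
  assumes B: "B \<in> sets borel" and g: "\<And>m. integrable unit_leb (g m)"
    "\<And>m. (\<lambda>n. defect b B n (g m)) \<longlonglongrightarrow> 0"
    and f: "f \<in> borel_measurable unit_leb" and w: "integrable unit_leb w"
    and lim: "\<And>x. x \<in> {0..<1} \<Longrightarrow> (\<lambda>m. g m x) \<longlonglongrightarrow> f x"
    and dom: "\<And>m x. x \<in> {0..<1} \<Longrightarrow> \<bar>g m x\<bar> \<le> w x"
  shows "integrable unit_leb f \<and> (\<lambda>n. defect b B n f) \<longlonglongrightarrow> 0"
proof
  have AEl: "AE x in unit_leb. (\<lambda>m. g m x) \<longlonglongrightarrow> f x" using lim by (intro AE_I2) simp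
  have AEd: "AE x in unit_leb. norm (g m x) \<le> w x" for m using dom by (intro AE_I2) simp
  show fi: "integrable unit_leb f"
    by (rule integrable_dominated_convergence[OF f borel_measurable_integrable[OF g(1)] w AEl AEd])
  have fw: "\<bar>f x\<bar> \<le> w x" if "x \<in> {0..<1}" for x
    using lim[OF that] dom[OF that] by (intro LIMSEQ_le_const2[OF tendsto_rabs]) auto
  have "(\<lambda>m. \<integral>x. \<bar>f x - g m x\<bar> \<partial>unit_leb) \<longlonglongrightarrow> (\<integral>x. 0 \<partial>unit_leb)"
  proof (rule integral_dominated_convergence[where w = "\<lambda>x. 2 * w x"])
    show "AE x in unit_leb. (\<lambda>m. \<bar>f x - g m x\<bar>) \<longlonglongrightarrow> 0"
    proof (rule AE_I2)
      fix x assume "x \<in> space unit_leb"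
      then have "(\<lambda>m. \<bar>f x - g m x\<bar>) \<longlonglongrightarrow> \<bar>f x - f x\<bar>" by (intro tendsto_intros lim) simp
      then show "(\<lambda>m. \<bar>f x - g m x\<bar>) \<longlonglongrightarrow> 0" by simp
    qed
    show "AE x in unit_leb. norm \<bar>f x - g m x\<bar> \<le> 2 * w x" for m
    proof (rule AE_I2)
      fix x assume "x \<in> space unit_leb"
      then show "norm \<bar>f x - g m x\<bar> \<le> 2 * w x" using fw[of x] dom[of x m] by simp
    qed
  qed (use f g(1) w in auto)
  then have L: "(\<lambda>m. \<integral>x. \<bar>f x - g m x\<bar> \<partial>unit_leb) \<longlonglongrightarrow> 0" by simp
  show "(\<lambda>n. defect b B n f) \<longlonglongrightarrow> 0"
  proof (rule LIMSEQ_I)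
    fix e :: real assume e: "0 < e"
    then obtain m where m: "\<bar>\<integral>x. \<bar>f x - g m x\<bar> \<partial>unit_leb\<bar> < e / 4"
      using LIMSEQ_D[OF L, of "e / 4"] by auto
    obtain N where N: "\<forall>n\<ge>N. \<bar>defect b B n (g m)\<bar> < e / 2"
      using LIMSEQ_D[OF g(2)[of m], of "e / 2"] e by auto
    have "\<bar>defect b B n f\<bar> < e" if "N \<le> n" for n
    proof -
      have "\<bar>defect b B n (\<lambda>x. f x - g m x)\<bar> \<le> 2 * (\<integral>x. \<bar>f x - g m x\<bar> \<partial>unit_leb)"
        using fi g(1) by (intro defect_bound B) auto
      moreover have "defect b B n f = defect b B n (\<lambda>x. f x - g m x) + defect b B n (g m)"
        by (simp add: defect_diff[OF fi g(1) B])
      moreover have "\<bar>defect b B n (g m)\<bar> < e / 2" using N that by blast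
      ultimately show ?thesis using m by linarith
    qed
    then show "\<exists>N. \<forall>n\<ge>N. norm (defect b B n f - 0) < e" by auto
  qed
qed

lemma sets_unit_leb_sigma:
  "sets unit_leb = sigma_sets {0..<1} ((\<inter>) {0..<1} ` range (lessThan :: real \<Rightarrow> real set))"
proof -
  have "sets (borel :: real measure) = sigma_sets UNIV (range lessThan)"
    by (subst borel_Iio) simp
  moreover have "{0..<1::real} \<in> sets borel" by simp
  ultimately show ?thesis
    by (simp add: sets_restrict_space sigma_sets_Int)
qed

text \<open>For the indicator of an initial interval the defect is the deviation bounded in
  \<open>visits_proportional\<close>, divided by \<open>n\<close>.\<close>

lemma defect_initial:
  assumes b: "1 < b" and B: "B \<in> sets borel" and a: "0 \<le> a" "a \<le> 1"
  shows "(\<lambda>n. defect b B n (indicator {0..<a})) \<longlonglongrightarrow> 0"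
proof -
  have 1: "(\<integral>x. indicator {0..<a} x * indicator (iter_set b B k 1) x \<partial>unit_leb) = measure lborel (iter_set b B k a)" for k
  proof -
    have "(\<integral>x. indicator {0..<a} x * indicator (iter_set b B k 1) x \<partial>unit_leb) = (\<integral>x. (indicator (iter_set b B k a) x :: real) \<partial>unit_leb)"
      by (simp only: indicator_inter_arith[symmetric] Int_commute[of "{0..<a}"] iter_set_Int[OF a(2)])
    also have "\<dots> = measure unit_leb (iter_set b B k a)"
      using a by (subst Bochner_Integration.integral_indicator)
        (auto simp: iter_set_def intro!: arg_cong[where f = "measure unit_leb"])
    also have "\<dots> = measure lborel (iter_set b B k a)" using a by (intro measure_unit_leb) (auto simp: iter_set_def)
    finally show ?thesis .
  qed
  have "(\<integral>x. indicator {0..<a} x \<partial>unit_leb) = (measure unit_leb {0..<a} :: real)"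
    using a by (subst Bochner_Integration.integral_indicator) (auto intro!: arg_cong[where f = "measure unit_leb"])
  also have "\<dots> = a" using a by (subst measure_unit_leb) auto
  finally have 2: "(\<integral>x. indicator {0..<a} x \<partial>unit_leb) = a" .
  have d: "defect b B n (indicator {0..<a}) = (visits b B n a - a * visits b B n 1) / real n" for n
    by (simp only: defect_def 1 2 visits_def sum_subtractf sum_distrib_left)
  have "(\<lambda>n. b / (b - 1) / real n) \<longlonglongrightarrow> 0" by (rule lim_const_over_n)
  moreover have "\<forall>n. norm (defect b B n (indicator {0..<a})) \<le> b / (b - 1) / real n"
    unfolding d using visits_proportional[OF b B a]
    by (auto simp: abs_divide simp del: divide_divide_eq_left intro!: divide_right_mono)
  ultimately show ?thesis by (rule Lim_null_comparison[OF always_eventually, rotated])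
qed

text \<open>Initial intervals are closed under intersection and generate the Borel sets of the unit
  interval, and the sets with vanishing defect form a Dynkin system.\<close>

lemma defect_indicator:
  assumes b: "1 < b" and B: "B \<in> sets borel" and A: "A \<in> sets unit_leb"
  shows "(\<lambda>n. defect b B n (indicator A)) \<longlonglongrightarrow> 0"
proof -
  interpret prob_space unit_leb by (rule prob_space_unit_leb)
  let ?G = "(\<inter>) {0..<1} ` range (lessThan :: real \<Rightarrow> real set)"
  have "Int_stable ?G"
  proof (rule Int_stableI)
    fix X Y assume "X \<in> ?G" "Y \<in> ?G"
    then obtain c d where "X = {0..<1} \<inter> {..<c}" "Y = {0..<1} \<inter> {..<d}" by blast
    then have "X \<inter> Y = {0..<1} \<inter> {..<min c d}" by auto
    then show "X \<inter> Y \<in> ?G" by blast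
  qed
  moreover have "?G \<subseteq> Pow {0..<1}" by auto
  moreover have "A \<in> sigma_sets {0..<1} ?G" using A by (simp only: sets_unit_leb_sigma)
  ultimately show ?thesis
  proof (induction rule: sigma_sets_induct_disjoint)
    case (basic A)
    then obtain c where "A = {0..<1} \<inter> {..<c}" by blast
    then have "A = {0..<max 0 (min 1 c)}" by auto
    then show ?case using defect_initial[OF b B, of "max 0 (min 1 c)"] by simp
  next
    case empty
    then show ?case by (simp add: defect_def)
  next
    case (compl A)
    then have A: "A \<in> sets unit_leb" by (simp only: sets_unit_leb_sigma)
    have "defect b B n (indicator ({0..<1} - A)) = defect b B n (indicator {0..<1}) - defect b B n (indicator A)" for n
    proof -
      have "A \<subseteq> {0..<1}" using A by (simp add: sets_unit_leb)
      then have "indicator ({0..<1} - A) = (\<lambda>x. indicator {0..<1} x - indicator A x :: real)"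
        by (auto simp: indicator_def fun_eq_iff)
      moreover have "{0..<1} \<in> sets unit_leb" by (simp add: sets_unit_leb)
      then have "integrable unit_leb (indicator {0..<1} :: real \<Rightarrow> real)" "integrable unit_leb (indicator A :: real \<Rightarrow> real)"
        using A by (simp_all add: less_top[symmetric])
      ultimately show ?thesis by (simp only: defect_diff B)
    qed
    then show ?case using tendsto_diff[OF defect_initial[OF b B, of 1] compl(2)] by simp
  next
    case (union A)
    have A: "A i \<in> sets unit_leb" for i using union(2) by (auto simp only: sets_unit_leb_sigma)
    define g where "g m = (\<lambda>x. \<Sum>i<m. indicator (A i) x :: real)" for m
    have gi: "integrable unit_leb (g m)" for m
      unfolding g_def using A by (intro Bochner_Integration.integrable_sum) (simp add: less_top[symmetric])
    have gd: "(\<lambda>n. defect b B n (g m)) \<longlonglongrightarrow> 0" for m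
    proof (induction m)
      case 0
      then show ?case by (simp add: g_def defect_def)
    next
      case (Suc m)
      have "defect b B n (g (Suc m)) = defect b B n (g m) + defect b B n (indicator (A m))" for n
        using defect_add[OF gi[of m] _ B, of "indicator (A m)"] A
        by (simp add: g_def less_top[symmetric])
      then show ?case using tendsto_add[OF Suc union(3)[of m]] by simp
    qed
    have ge: "g m x = indicator (\<Union>i<m. A i) x" for m x
      unfolding g_def using union(1)
      by (subst indicator_UN_disjoint) (auto intro: disjoint_family_on_mono)
    have "integrable unit_leb (indicator (\<Union>i. A i) :: real \<Rightarrow> real) \<and> (\<lambda>n. defect b B n (indicator (\<Union>i. A i))) \<longlonglongrightarrow> 0"
    proof (rule defect_limit[OF B gi gd, of _ "\<lambda>x. 1"])
      show "(\<lambda>m. g m x) \<longlonglongrightarrow> indicator (\<Union>i. A i) x" for x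
        unfolding ge by (rule LIMSEQ_indicator_UN)
      show "\<bar>g m x\<bar> \<le> 1" for m x unfolding ge by (simp add: indicator_def)
    qed (use A in auto)
    then show ?case by blast
  qed
qed

lemma defect_integrable:
  assumes b: "1 < b" and B: "B \<in> sets borel" and f: "integrable unit_leb f"
  shows "(\<lambda>n. defect b B n f) \<longlonglongrightarrow> 0"
  using f
proof (induction rule: integrable_induct)
  case (base A c)
  have "defect b B n (\<lambda>x. indicator A x *\<^sub>R c) = c * defect b B n (indicator A)" for n
    by (simp add: defect_scale[symmetric] mult.commute)
  then show ?case using tendsto_mult_right_zero[OF defect_indicator[OF b B base(1)]] by simp
next
  case (add f g)
  then show ?case using tendsto_add[OF add(3,4)] by (simp add: defect_add B)
next
  case (lim f s)
  then show ?case
    using defect_limit[OF B, of s b f "\<lambda>x. 2 * \<bar>f x\<bar>"] by (auto simp: borel_measurable_integrable)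
qed


section \<open>Uniqueness and existence of the invariant measure\<close>

lemma invariant_measure_iter:
  assumes M: "is_invariant_acpm b M" and B: "B \<in> sets unit_leb"
  shows "measure M (iter_set b B k 1) = measure M B"
proof (induction k)
  case 0
  have "iter_set b B 0 1 = B" using B by (auto simp: iter_set_def sets_unit_leb)
  then show ?case by simp
next
  case (Suc k)
  have sM: "sets M = sets unit_leb" and T: "beta_map b \<in> measurable M M" and d: "distr M M (beta_map b) = M"
    using M by (auto simp: is_invariant_acpm_def)
  have spM: "space M = {0..<1}" using sets_eq_imp_space_eq[OF sM] by simp
  have "iter_set b B k 1 \<in> sets M"
    using B iter_set_1[of b B k] by (auto simp: sM sets_unit_leb)
  then have "measure (distr M M (beta_map b)) (iter_set b B k 1) = measure M (beta_map b -` iter_set b B k 1 \<inter> space M)"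
    by (intro measure_distr T)
  moreover have "beta_map b -` iter_set b B k 1 \<inter> space M = iter_set b B (Suc k) 1"
    by (auto simp: iter_set_Suc spM)
  ultimately show ?case using Suc d by simp
qed

text \<open>Apply the vanishing defect to the density \<open>D\<close> of \<open>M\<close>: by
  invariance every preimage of \<open>B\<close> has the same \<open>M\<close>-measure, and
  \<open>D\<close> has integral 1, so the defect is \<open>measure M B\<close> minus the visit
  frequency. The frequency is defined by Lebesgue measure alone, whence the uniqueness of
  \<open>M\<close>.\<close>

lemma visit_frequency:
  assumes b: "1 < b" and M: "is_invariant_acpm b M" and B: "B \<in> sets unit_leb"
  shows "(\<lambda>n. visits b B n 1 / real n) \<longlonglongrightarrow> measure M B"
proof -
  interpret L: prob_space unit_leb by (rule prob_space_unit_leb)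
  interpret M: prob_space M using M by (simp add: is_invariant_acpm_def)
  have sM: "sets M = sets unit_leb" and ac: "absolutely_continuous unit_leb M"
    using M by (auto simp: is_invariant_acpm_def)
  obtain D where D: "D \<in> borel_measurable unit_leb" "AE x in unit_leb. RN_deriv unit_leb M x = ennreal (D x)"
      "\<And>x. 0 \<le> D x"
    using L.real_RN_deriv[OF M.finite_measure_axioms ac sM] by blast
  have dens: "M = density unit_leb (\<lambda>x. ennreal (D x))"
  proof -
    have "M = density unit_leb (RN_deriv unit_leb M)" using L.density_RN_deriv[OF ac sM] by simp
    also have "\<dots> = density unit_leb (\<lambda>x. ennreal (D x))" using D by (intro density_cong) auto
    finally show ?thesis .
  qed
  have meas: "(\<integral>x. D x * indicator A x \<partial>unit_leb) = measure M A \<and> integrable unit_leb (\<lambda>x. D x * indicator A x)"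
    if A: "A \<in> sets unit_leb" for A
  proof -
    have i: "integrable M (indicator A :: real \<Rightarrow> real)" using A sM by (simp add: less_top[symmetric])
    have "measure M A = (\<integral>x. indicator A x \<partial>M)" using sets.sets_into_space[of A M] A sM
      by (simp add: Int_absorb2)
    also have "\<dots> = (\<integral>x. D x * indicator A x \<partial>unit_leb)"
      using A D by (subst dens, subst integral_real_density) auto
    finally have "measure M A = (\<integral>x. D x * indicator A x \<partial>unit_leb)" .
    moreover have "integrable (density unit_leb (\<lambda>x. ennreal (D x))) (indicator A :: real \<Rightarrow> real)"
      using i by (simp only: dens[symmetric])
    then have "integrable unit_leb (\<lambda>x. D x * indicator A x)"
      using A D by (subst (asm) integrable_real_density) auto
    ultimately show ?thesis by simp
  qed
  have uni: "{0..<1} \<in> sets unit_leb" by (simp add: sets_unit_leb)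
  have M1: "measure M {0..<1} = 1" using M.prob_space sets_eq_imp_space_eq[OF sM] by simp
  have Deq: "D x * indicator {0..<1} x = D x" if "x \<in> space unit_leb" for x using that by simp
  have Di: "integrable unit_leb D"
    using meas[OF uni] Bochner_Integration.integrable_cong[of unit_leb unit_leb _ D, OF refl Deq] by blast
  have D1: "(\<integral>x. D x \<partial>unit_leb) = 1"
    using meas[OF uni] M1 Bochner_Integration.integral_cong[of unit_leb unit_leb _ D, OF refl Deq] by simp
  have Bb: "B \<in> sets borel" using B by (simp add: sets_unit_leb)
  have it: "iter_set b B k 1 \<in> sets unit_leb" for k using Bb iter_set_1 by (simp add: sets_unit_leb)
  have "eventually (\<lambda>n. defect b B n D = measure M B - visits b B n 1 / real n) sequentially"
    using eventually_gt_at_top[of 0]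
  proof eventually_elim
    case (elim n)
    have "defect b B n D = (\<Sum>k<n. measure M B - measure lborel (iter_set b B k 1)) / real n"
      unfolding defect_def D1 conjunct1[OF meas[OF it]] invariant_measure_iter[OF M B] by simp
    also have "\<dots> = measure M B - visits b B n 1 / real n"
      using elim by (simp add: sum_subtractf visits_def diff_divide_distrib)
    finally show ?case .
  qed
  then have "(\<lambda>n. measure M B - visits b B n 1 / real n) \<longlonglongrightarrow> 0"
    using defect_integrable[OF b Bb Di] by (rule Lim_transform_eventually[rotated])
  from tendsto_diff[OF tendsto_const[of "measure M B"] this] show ?thesis by simp
qed

lemma invariant_acpm_unique:
  assumes b: "1 < b" and M: "is_invariant_acpm b M" and N: "is_invariant_acpm b N"
  shows "M = N"
proof (rule measure_eqI)
  interpret M: prob_space M using M by (simp add: is_invariant_acpm_def)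
  interpret N: prob_space N using N by (simp add: is_invariant_acpm_def)
  show s: "sets M = sets N" using M N by (simp add: is_invariant_acpm_def)
  fix A assume "A \<in> sets M"
  then have "A \<in> sets unit_leb" using M by (simp add: is_invariant_acpm_def)
  then have "measure M A = measure N A"
    using LIMSEQ_unique[OF visit_frequency[OF b M] visit_frequency[OF b N]] by blast
  then show "emeasure M A = emeasure N A"
    by (simp add: M.emeasure_eq_measure N.emeasure_eq_measure)
qed

text \<open>Parry's density is a normalisation of \<open>x \<mapsto> \<Sum>n. [x < T\<^sup>n 1] / b\<^sup>n\<close>.\<close>

lemma invariant_acpm_exists:
  assumes b: "1 < b"
  shows "\<exists>M. is_invariant_acpm b M"
proof -
  have b0: "0 < b" using b by simp
  define t where "t n = (beta_map b ^^ n) 1" for n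
  have t: "0 \<le> t n" "t n \<le> 1" for n using beta_iter_one_range by (auto simp: t_def)
  define c where "c B n = measure lborel (B \<inter> {0..<t n}) / b ^ n" for B n
  have geo: "summable (\<lambda>n. 1 / b ^ n)"
    using summable_geometric[of "1 / b"] b by (simp add: power_one_over)
  have c0: "0 \<le> c B n" for B n using b by (simp add: c_def)
  have m1: "measure lborel (B \<inter> {0..<t n}) \<le> 1" if "B \<in> sets borel" for B n
  proof -
    have "measure lborel (B \<inter> {0..<t n}) \<le> measure lborel {0..<1::real}"
      using that t[of n] by (intro measure_mono_fmeasurable) (auto simp: fmeasurable_def)
    then show ?thesis by simp
  qed
  have cs: "summable (c B)" if "B \<in> sets borel" for B
  proof (rule summable_comparison_test'[OF geo])
    show "norm (c B n) \<le> 1 / b ^ n" for n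
      using c0[of B n] m1[OF that, of n] b by (simp add: c_def divide_right_mono)
  qed
  define Z where "Z = suminf (c {0..<1})"
  have "c {0..<1} 0 \<le> Z"
    unfolding Z_def using sum_le_suminf[OF cs, of "{0..<1}" "{0}"] c0 by simp
  then have Z: "0 < Z" by (simp add: c_def t_def)
  define r where "r x = (\<Sum>n. ennreal (1 / (Z * b ^ n)) * indicator {0..<t n} x)" for x
  have tn [measurable]: "{0..<t n} \<in> sets unit_leb" for n using t(2)[of n] by (auto simp: sets_unit_leb)
  have [measurable]: "r \<in> borel_measurable unit_leb" unfolding r_def
    by measurable (auto intro: measurable_restrict_space1)
  define M where "M = density unit_leb r"
  have sM: "sets M = sets unit_leb" by (simp add: M_def)
  have spM: "space M = {0..<1}" by (simp add: M_def)
  have eM: "emeasure M B = ennreal (suminf (c B) / Z)" if B: "B \<in> sets unit_leb" for B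
  proof -
    have Bb: "B \<in> sets borel" "B \<subseteq> {0..<1}" using B by (auto simp: sets_unit_leb)
    have "emeasure M B = (\<integral>\<^sup>+x. r x * indicator B x \<partial>unit_leb)"
      unfolding M_def using B by (intro emeasure_density) auto
    also have "\<dots> = (\<integral>\<^sup>+x. (\<Sum>n. ennreal (1 / (Z * b ^ n)) * indicator (B \<inter> {0..<t n}) x) \<partial>unit_leb)"
      unfolding r_def ennreal_suminf_multc[symmetric]
      by (intro nn_integral_cong suminf_cong) (auto simp: indicator_def)
    also have "\<dots> = (\<Sum>n. \<integral>\<^sup>+x. ennreal (1 / (Z * b ^ n)) * indicator (B \<inter> {0..<t n}) x \<partial>unit_leb)"
      using B tn by (intro nn_integral_suminf) auto
    also have "\<dots> = (\<Sum>n. ennreal (c B n / Z))"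
    proof (intro suminf_cong)
      fix n
      have "(\<integral>\<^sup>+x. ennreal (1 / (Z * b ^ n)) * indicator (B \<inter> {0..<t n}) x \<partial>unit_leb)
        = ennreal (1 / (Z * b ^ n)) * emeasure unit_leb (B \<inter> {0..<t n})"
        using B tn by (intro nn_integral_cmult_indicator) auto
      also have "emeasure unit_leb (B \<inter> {0..<t n}) = ennreal (measure lborel (B \<inter> {0..<t n}))"
        using B tn Bb(2) by (subst measure_unit_leb[symmetric])
          (auto intro!: finite_measure.emeasure_eq_measure prob_space.finite_measure prob_space_unit_leb)
      finally show "(\<integral>\<^sup>+x. ennreal (1 / (Z * b ^ n)) * indicator (B \<inter> {0..<t n}) x \<partial>unit_leb) = ennreal (c B n / Z)"
        using Z b by (simp add: ennreal_mult'[symmetric] c_def field_simps)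
    qed
    also have "\<dots> = ennreal (\<Sum>n. c B n / Z)"
      using cs[OF Bb(1)] c0 Z by (intro suminf_ennreal2) (auto intro: summable_divide)
    also have "(\<Sum>n. c B n / Z) = suminf (c B) / Z" using cs[OF Bb(1)] by (rule suminf_divide)
    finally show ?thesis .
  qed
  have uni: "{0..<1} \<in> sets unit_leb" by (simp add: sets_unit_leb)
  have prob: "prob_space M"
    by (rule prob_spaceI) (use eM[OF uni] Z in \<open>simp add: spM Z_def[symmetric]\<close>)
  have T: "beta_map b \<in> measurable M M"
  proof (rule measurableI)
    fix A assume "A \<in> sets M"
    then have A: "A \<in> sets borel" by (simp add: sM sets_unit_leb)
    have "beta_map b -` A \<inter> space M = {0..<1} \<inter> (beta_map b -` A \<inter> space borel)" by (auto simp: spM)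
    also have "\<dots> \<in> sets borel" by (rule sets.Int[OF _ measurable_sets[OF measurable_beta_map A]]) simp
    finally show "beta_map b -` A \<inter> space M \<in> sets M" by (auto simp: sM sets_unit_leb spM)
  qed (use beta_map_range in \<open>simp add: spM\<close>)
  \<comment> \<open>On \<open>{0..<t n}\<close> the map covers the unit interval
    \<open>beta_digit b (Suc n) 1\<close> times and then \<open>{0..<t (Suc n)}\<close> once.
    Summing over \<open>n\<close> loses layer 0, and the expansion of 1 gives back exactly one copy
    of Lebesgue measure, which is layer 0.\<close>
  have inv: "suminf (c {x \<in> {0..<1}. beta_map b x \<in> B}) = suminf (c B)" if B: "B \<in> sets unit_leb" for B
  proof -
    have Bb: "B \<in> sets borel" "B \<subseteq> {0..<1}" using B by (auto simp: sets_unit_leb)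
    let ?e = "\<lambda>n. of_int (beta_digit b (Suc n) 1) / b ^ Suc n :: real"
    have step: "c {x \<in> {0..<1}. beta_map b x \<in> B} n = measure lborel B * ?e n + c B (Suc n)" for n
    proof -
      have "{x \<in> {0..<1}. beta_map b x \<in> B} \<inter> {0..<t n} = {x \<in> {0..<t n}. beta_map b x \<in> B}"
        using t(2)[of n] by auto
      then show ?thesis
        using measure_branches[OF b0 t(1)[of n] Bb] b
        by (simp add: c_def beta_digit_def t_def field_simps)
    qed
    have S1: "?e sums 1"
    proof -
      have "(\<lambda>n. 1 / b ^ n) \<longlonglongrightarrow> 0" using geo by (rule summable_LIMSEQ_zero)
      then have "(\<lambda>n. t n / b ^ n) \<longlonglongrightarrow> 0"
        by (rule Lim_null_comparison[OF always_eventually, rotated]) (use t b in \<open>auto intro!: divide_right_mono\<close>)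
      then have "(\<lambda>n. 1 - t n / b ^ n) \<longlonglongrightarrow> 1 - 0" by (intro tendsto_intros)
      moreover have "(\<Sum>i<n. ?e i) = 1 - t n / b ^ n" for n
        using digit_expansion[OF b0, of 1 n] by (simp add: t_def sum.atLeast1_atMost_eq)
      ultimately show ?thesis by (simp add: sums_def)
    qed
    have S2: "(\<lambda>n. c B (Suc n)) sums (suminf (c B) - c B 0)"
      using cs[OF Bb(1)] by (simp add: sums_Suc_iff summable_sums)
    have "c {x \<in> {0..<1}. beta_map b x \<in> B} = (\<lambda>n. measure lborel B * ?e n + c B (Suc n))"
      using step by (rule ext)
    then have "c {x \<in> {0..<1}. beta_map b x \<in> B} sums (measure lborel B * 1 + (suminf (c B) - c B 0))"
      using sums_add[OF sums_mult[OF S1] S2] by (simp only:)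
    moreover have "c B 0 = measure lborel B"
      using Bb by (simp add: c_def t_def Int_absorb2)
    ultimately show ?thesis by (simp add: sums_iff)
  qed
  have "distr M M (beta_map b) = M"
  proof (rule measure_eqI)
    fix A assume "A \<in> sets (distr M M (beta_map b))"
    then have A: "A \<in> sets M" by simp
    have "beta_map b -` A \<inter> space M = {x \<in> {0..<1}. beta_map b x \<in> A}" by (auto simp: spM)
    then show "emeasure (distr M M (beta_map b)) A = emeasure M A"
      using A measurable_sets[OF T A] inv[of A] by (simp add: emeasure_distr[OF T] eM sM)
  qed simp
  \<comment> \<open>The layer with index 0 is Lebesgue measure, so \<open>M\<close> dominates a
    positive multiple of it.\<close>
  moreover have "absolutely_continuous M unit_leb"
    unfolding absolutely_continuous_def
  proof
    fix A assume A: "A \<in> null_sets M"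
    then have As: "A \<in> sets unit_leb" using sM by auto
    then have Ab: "A \<in> sets borel" "A \<subseteq> {0..<1}" by (auto simp: sets_unit_leb)
    have "suminf (c A) / Z \<le> 0" using A eM[OF As] by (auto simp: null_sets_def ennreal_eq_0_iff)
    then have "suminf (c A) \<le> 0" using Z by (simp add: divide_le_0_iff)
    moreover have "c A 0 \<le> suminf (c A)"
      using sum_le_suminf[OF cs[OF Ab(1)], of "{0}"] c0 by simp
    ultimately have "measure unit_leb A \<le> 0"
      using Ab by (simp add: measure_unit_leb c_def t_def Int_absorb2)
    then have "measure unit_leb A = 0" using measure_nonneg[of unit_leb A] by linarith
    then show "A \<in> null_sets unit_leb"
      using As finite_measure.emeasure_eq_measure[OF prob_space.finite_measure[OF prob_space_unit_leb]]
      by (auto simp: null_sets_def)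
  qed
  moreover have "absolutely_continuous unit_leb M"
    unfolding absolutely_continuous_def M_def
    by (rule subsetI, subst null_sets_density_iff) (auto simp: AE_not_in null_setsD2 intro: AE_mp[OF AE_not_in])
  ultimately have "is_invariant_acpm b M" using prob sM T by (simp add: is_invariant_acpm_def)
  then show ?thesis by blast
qed

lemma beta_measure_invariant: "1 < b \<Longrightarrow> is_invariant_acpm b (beta_measure b)"
  unfolding beta_measure_def using invariant_acpm_exists invariant_acpm_unique by (metis theI)


text \<open>A digit is the number of thresholds \<open>Suc j / b\<close> that a point has reached,
  which turns digit means into measures of sets. Allowing a map \<open>f\<close> covers both the
  first digit under the invariant measure and every digit under Lebesgue measure.\<close>

lemma digit_integral_visits:
  assumes b: "1 < b" and M: "prob_space M" "sets M = sets unit_leb"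
    and f: "f \<in> measurable M unit_leb"
  shows "(\<integral>x. of_int \<lfloor>b * f x\<rfloor> \<partial>M) =
    (\<Sum>j<nat \<lfloor>b\<rfloor>. measure M (f -` {real (Suc j) / b..<1} \<inter> space M))"
proof -
  interpret prob_space M by (rule M(1))
  have fr: "0 \<le> f x \<and> f x < 1" if "x \<in> space M" for x
    using measurable_space[OF f that] by simp
  have S: "f -` {real (Suc j) / b..<1} \<inter> space M \<in> sets M" for j
    using b by (intro measurable_sets[OF f]) (auto simp: sets_unit_leb)
  have "(\<integral>x. of_int \<lfloor>b * f x\<rfloor> \<partial>M) = (\<integral>x. (\<Sum>j<nat \<lfloor>b\<rfloor>. indicator (f -` {real (Suc j) / b..<1} \<inter> space M) x :: real) \<partial>M)"
  proof (intro Bochner_Integration.integral_cong refl)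
    fix x assume x: "x \<in> space M"
    define m where "m = nat \<lfloor>b * f x\<rfloor>"
    have bf: "0 \<le> b * f x" "b * f x \<le> b" using fr[OF x] b by auto
    then have mle: "m \<le> nat \<lfloor>b\<rfloor>" unfolding m_def by (intro nat_mono floor_mono)
    have "indicator (f -` {real (Suc j) / b..<1} \<inter> space M) x = (if j < m then 1 else 0 :: real)" for j
    proof -
      have "real (Suc j) / b \<le> f x \<longleftrightarrow> real (Suc j) \<le> b * f x" using b by (simp add: pos_divide_le_eq mult.commute)
      also have "\<dots> \<longleftrightarrow> int (Suc j) \<le> \<lfloor>b * f x\<rfloor>" by (simp only: le_floor_iff of_int_of_nat_eq)
      also have "\<dots> \<longleftrightarrow> j < m" unfolding m_def using bf by linarith
      finally show ?thesis using fr[OF x] x by (simp add: indicator_def)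
    qed
    then have "(\<Sum>j<nat \<lfloor>b\<rfloor>. indicator (f -` {real (Suc j) / b..<1} \<inter> space M) x :: real)
        = (\<Sum>j\<in>{..<nat \<lfloor>b\<rfloor>} \<inter> {j. j < m}. 1)"
      by (simp add: sum.If_cases)
    also have "{..<nat \<lfloor>b\<rfloor>} \<inter> {j. j < m} = {..<m}" using mle by auto
    finally show "of_int \<lfloor>b * f x\<rfloor> = (\<Sum>j<nat \<lfloor>b\<rfloor>. indicator (f -` {real (Suc j) / b..<1} \<inter> space M) x :: real)"
      using bf by (simp add: m_def)
  qed
  also have "\<dots> = (\<Sum>j<nat \<lfloor>b\<rfloor>. \<integral>x. (indicator (f -` {real (Suc j) / b..<1} \<inter> space M) x :: real) \<partial>M)"
    using S by (intro Bochner_Integration.integral_sum) (simp add: less_top[symmetric])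
  also have "\<dots> = (\<Sum>j<nat \<lfloor>b\<rfloor>. measure M (f -` {real (Suc j) / b..<1} \<inter> space M))"
    by (simp add: Int_absorb2 Int_assoc)
  finally show ?thesis .
qed

lemma measurable_beta_iter_unit: "(beta_map b ^^ k) \<in> measurable unit_leb unit_leb"
proof (rule measurableI)
  fix A assume "A \<in> sets unit_leb"
  then have "A \<in> sets borel" by (simp add: sets_unit_leb)
  then have "iter_set b A k 1 \<in> sets unit_leb" using iter_set_1 by (simp add: sets_unit_leb)
  moreover have "(beta_map b ^^ k) -` A \<inter> space unit_leb = iter_set b A k 1" by (auto simp: iter_set_def)
  ultimately show "(beta_map b ^^ k) -` A \<inter> space unit_leb \<in> sets unit_leb" by simp
qed (use beta_iter_range in simp)

lemma integrable_digit:
  assumes b: "1 < b"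
  shows "integrable unit_leb (\<lambda>x. real_of_int (beta_digit b (Suc k) x))"
proof -
  interpret prob_space unit_leb by (rule prob_space_unit_leb)
  have "(\<lambda>x. real_of_int (beta_digit b (Suc k) x)) \<in> borel_measurable borel"
    unfolding beta_digit_def by measurable
  then have "(\<lambda>x. real_of_int (beta_digit b (Suc k) x)) \<in> borel_measurable unit_leb"
    by (intro measurable_restrict_space1) simp
  moreover have "AE x in unit_leb. norm (real_of_int (beta_digit b (Suc k) x)) \<le> b"
  proof (rule AE_I2)
    fix x assume "x \<in> space unit_leb"
    then have "0 \<le> (beta_map b ^^ k) x" "(beta_map b ^^ k) x \<le> 1" using beta_iter_range[where x = x and b = b and n = k] by auto
    then have "0 \<le> b * (beta_map b ^^ k) x" "b * (beta_map b ^^ k) x \<le> b" using b by auto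
    then show "norm (real_of_int (beta_digit b (Suc k) x)) \<le> b"
      unfolding beta_digit_def diff_Suc_1 real_norm_def
      by (subst abs_of_nonneg) (auto intro: order_trans[OF of_int_floor_le])
  qed
  ultimately show ?thesis by (intro integrable_const_bound)
qed

lemma digit_average_eq: "digit_average b n x = (\<Sum>k<n. real_of_int (beta_digit b (Suc k) x)) / real n"
  by (simp add: digit_average_def digit_sum_def sum.atLeast1_atMost_eq)

text \<open>Both means are sums over the thresholds of \<open>digit_integral_visits\<close>, and
  \<open>visit_frequency\<close> gives the convergence term by term.\<close>

lemma mean_digit_average_tendsto:
  assumes b: "1 < b"
  shows "(\<lambda>n. \<integral>x. digit_average b n x \<partial>unit_leb) \<longlonglongrightarrow> typical_average b"
proof -
  let ?M = "beta_measure b" and ?J = "nat \<lfloor>b\<rfloor>"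
  let ?B = "\<lambda>j. {real (Suc j) / b..<1}"
  have inv: "is_invariant_acpm b ?M" by (rule beta_measure_invariant[OF b])
  have M: "prob_space ?M" "sets ?M = sets unit_leb" using inv by (auto simp: is_invariant_acpm_def)
  have spM: "space ?M = {0..<1}" using sets_eq_imp_space_eq[OF M(2)] by simp
  have B: "?B j \<in> sets unit_leb" for j using b by (auto simp: sets_unit_leb)
  have "(\<lambda>x. x) \<in> measurable ?M unit_leb" using M(2) by (simp add: measurable_ident_sets)
  from digit_integral_visits[OF b M this]
  have "(\<integral>x. of_int \<lfloor>b * x\<rfloor> \<partial>?M) = (\<Sum>j<?J. measure ?M ((\<lambda>x. x) -` ?B j \<inter> space ?M))" .
  moreover have "(\<lambda>x. x) -` ?B j \<inter> space ?M = ?B j" for j using B[of j] by (auto simp: spM sets_unit_leb)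
  ultimately have typical: "typical_average b = (\<Sum>j<?J. measure ?M (?B j))"
    by (simp add: typical_average_def beta_digit_def)
  have "(\<integral>x. digit_average b n x \<partial>unit_leb) = (\<Sum>j<?J. visits b (?B j) n 1 / real n)" for n
  proof -
    have "(\<integral>x. digit_average b n x \<partial>unit_leb) = (\<Sum>k<n. \<integral>x. of_int (beta_digit b (Suc k) x) \<partial>unit_leb) / real n"
      unfolding digit_average_eq using integrable_digit[OF b] by (simp add: Bochner_Integration.integral_sum)
    also have "(\<Sum>k<n. \<integral>x. of_int (beta_digit b (Suc k) x) \<partial>unit_leb) = (\<Sum>k<n. \<Sum>j<?J. measure lborel (iter_set b (?B j) k 1))"
    proof (intro sum.cong refl)
      fix k
      have "(\<integral>x. of_int (beta_digit b (Suc k) x) \<partial>unit_leb) = (\<Sum>j<?J. measure unit_leb ((beta_map b ^^ k) -` ?B j \<inter> space unit_leb))"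
        unfolding beta_digit_def diff_Suc_1
        by (rule digit_integral_visits[OF b prob_space_unit_leb refl measurable_beta_iter_unit])
      also have "\<dots> = (\<Sum>j<?J. measure lborel (iter_set b (?B j) k 1))"
      proof (intro sum.cong refl)
        fix j
        have "(beta_map b ^^ k) -` ?B j \<inter> space unit_leb = iter_set b (?B j) k 1" by (auto simp: iter_set_def)
        then show "measure unit_leb ((beta_map b ^^ k) -` ?B j \<inter> space unit_leb) = measure lborel (iter_set b (?B j) k 1)"
          using measure_unit_leb[OF iter_set_1] by simp
      qed
      finally show "(\<integral>x. of_int (beta_digit b (Suc k) x) \<partial>unit_leb) = (\<Sum>j<?J. measure lborel (iter_set b (?B j) k 1))" .
    qed
    also have "\<dots> = (\<Sum>j<?J. visits b (?B j) n 1)" unfolding visits_def by (rule sum.swap)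
    finally show ?thesis by (simp add: sum_divide_distrib)
  qed
  then show ?thesis unfolding typical by (simp only:) (intro tendsto_sum visit_frequency[OF b inv B])
qed

text \<open>A cylinder lies in an interval of length \<open>1 / b ^ n\<close>. This turns a lower
  bound on a probability into one on a number of words.\<close>

lemma measure_digit_words_le:
  assumes b: "0 < b" and V: "V \<subseteq> admissible_words b n"
  shows "measure unit_leb {x \<in> {0..<1}. digit_word b n x \<in> V} \<le> real (card V) / b ^ n"
proof -
  have fin: "finite V" using V finite_admissible_words[OF b] finite_subset by blast
  let ?I = "\<lambda>w. {wjoin b w 0..wjoin b w 0 + 1 / b ^ n}"
  have "{x \<in> {0..<1}. digit_word b n x \<in> V} \<subseteq> (\<Union>w\<in>V. ?I w)"
  proof
    fix x assume x: "x \<in> {x \<in> {0..<1}. digit_word b n x \<in> V}"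
    let ?w = "digit_word b n x" and ?y = "(beta_map b ^^ n) x"
    have "x = wjoin b ?w ?y" using digit_word_fits[OF b, of x n] x by auto
    also have "\<dots> = wjoin b ?w 0 + ?y / b ^ n" using b by (subst join_affine) auto
    finally have "x = wjoin b ?w 0 + ?y / b ^ n" .
    moreover have "0 \<le> ?y / b ^ n" "?y / b ^ n \<le> 1 / b ^ n"
      using beta_iter_range[where x = x and b = b and n = n] x b by (auto intro!: divide_right_mono)
    ultimately have "x \<in> ?I ?w" by auto
    with x show "x \<in> (\<Union>w\<in>V. ?I w)" by blast
  qed
  then have "emeasure lborel {x \<in> {0..<1}. digit_word b n x \<in> V} \<le> emeasure lborel (\<Union>w\<in>V. ?I w)"
    using fin by (intro emeasure_mono) auto
  also have "\<dots> \<le> (\<Sum>w\<in>V. emeasure lborel (?I w))"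
    using fin by (intro emeasure_subadditive_finite) auto
  also have "\<dots> = (\<Sum>w\<in>V. ennreal (1 / b ^ n))" using b by (intro sum.cong) auto
  also have "\<dots> = ennreal (real (card V) / b ^ n)"
    using b by (simp add: ennreal_of_nat_eq_real_of_nat ennreal_mult[symmetric])
  finally have "measure lborel {x \<in> {0..<1}. digit_word b n x \<in> V} \<le> real (card V) / b ^ n"
    unfolding measure_def using b by (intro enn2real_leI) auto
  then show ?thesis by (subst measure_unit_leb) auto
qed

text \<open>Only the first moment of the digit average enters: it yields exponentially full families
  of words with mean above and below the typical average, which are then mixed.\<close>

lemma rich_typical:
  assumes b: "1 < b"
  shows "rich b (typical_average b) 1"
  unfolding rich_def
proof (intro allI impI)
  fix h :: real assume h: "0 < h"
  interpret prob_space unit_leb by (rule prob_space_unit_leb)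
  let ?a = "typical_average b"
  have b0: "0 < b" using b by simp
  define e where "e = h / 4"
  have e: "0 < e" using h by (simp add: e_def)
  \<comment> \<open>\<open>K\<close> bounds how far a digit average in \<open>[0,b]\<close> can lie
    above \<open>?a - 2 * e\<close> or below \<open>?a + 2 * e\<close>. As the mean is within
    \<open>e\<close> of \<open>?a\<close>, the averages of at least \<open>?a - 2 * e\<close>, and
    likewise those of at most \<open>?a + 2 * e\<close>, have probability at least
    \<open>e / K\<close>.\<close>
  define K where "K = b + \<bar>?a\<bar> + 2 * e"
  have K: "0 < K" using b e by (simp add: K_def)
  then have eK: "0 < e / K" using e by simp
  have "eventually (\<lambda>n. \<bar>(\<integral>x. digit_average b n x \<partial>unit_leb) - ?a\<bar> < e) sequentially"
    using tendstoD[OF mean_digit_average_tendsto[OF b] e] by (simp add: dist_real_def)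
  from eventually_happens[OF eventually_conj[OF this
      eventually_conj[OF rich_at_pigeonhole[OF b e eK, of 1] eventually_ge_at_top[of 1]]]]
  obtain n where n: "\<bar>(\<integral>x. digit_average b n x \<partial>unit_leb) - ?a\<bar> < e" "1 \<le> n"
    and pig: "\<And>V. V \<subseteq> admissible_words b n \<Longrightarrow> e / K * b powr (real n * 1) \<le> real (card V) \<Longrightarrow>
      \<exists>w\<in>V. rich_at b (real_of_int (sum_list w) / real n) 1 e" by auto
  have ia: "integrable unit_leb (digit_average b n)"
    unfolding digit_average_eq[abs_def] using integrable_digit[OF b] by auto
  have bound: "0 \<le> digit_average b n x \<and> digit_average b n x \<le> b" if "x \<in> {0..<1}" for x
  proof -
    have "0 \<le> sum_list (digit_word b n x) \<and> real_of_int (sum_list (digit_word b n x)) \<le> b * real n"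
      using sum_list_fits[OF b0, of "digit_word b n x"] digit_word_fits[OF b0, of x n] that by auto
    then show ?thesis using n(2) by (simp add: sum_list_digit_word digit_average_def pos_divide_le_eq)
  qed
  have sets: "{x \<in> {0..<1}. digit_average b n x \<in> A} \<in> events" if "A \<in> sets borel" for A
    using measurable_sets[OF borel_measurable_integrable[OF ia] that]
    by (simp add: vimage_def Int_def conj_commute)
  have word: "\<exists>w. w \<in> admissible_words b n \<and> real_of_int (sum_list w) / real n \<in> A \<and> rich_at b (real_of_int (sum_list w) / real n) 1 e"
    if A: "e / K \<le> prob {x \<in> {0..<1}. digit_average b n x \<in> A}" for A
  proof -
    let ?V = "{w \<in> admissible_words b n. real_of_int (sum_list w) / real n \<in> A}"
    have "{x \<in> {0..<1}. digit_average b n x \<in> A} = {x \<in> {0..<1}. digit_word b n x \<in> ?V}"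
      using digit_word_admissible[OF b0, of _ n] by (auto simp: sum_list_digit_word digit_average_def)
    with A have "e / K \<le> prob {x \<in> {0..<1}. digit_word b n x \<in> ?V}" by (simp only:)
    also have "\<dots> \<le> real (card ?V) / b ^ n" by (rule measure_digit_words_le[OF b0]) auto
    finally have "e / K * b ^ n \<le> real (card ?V)" using b0 by (simp add: pos_le_divide_eq)
    then have "e / K * b powr (real n * 1) \<le> real (card ?V)" using b0 by (simp add: powr_realpow)
    then have "\<exists>w\<in>?V. rich_at b (real_of_int (sum_list w) / real n) 1 e" by (intro pig) auto
    then show ?thesis by blast
  qed
  have iu: "integrable unit_leb (\<lambda>x. c + d * indicator {x \<in> {0..<1}. digit_average b n x \<in> A} x)"
    and eu: "(\<integral>x. c + d * indicator {x \<in> {0..<1}. digit_average b n x \<in> A} x \<partial>unit_leb)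
      = c + d * prob {x \<in> {0..<1}. digit_average b n x \<in> A}" if A: "A \<in> sets borel" for A and c d :: real
  proof -
    let ?S = "{x \<in> {0..<1}. digit_average b n x \<in> A}"
    have i: "integrable unit_leb (indicator ?S :: real \<Rightarrow> real)" using sets[OF A] by (simp add: less_top[symmetric])
    then show "integrable unit_leb (\<lambda>x. c + d * indicator ?S x)" by simp
    have "(\<integral>x. c + d * indicator ?S x \<partial>unit_leb) = c + d * (\<integral>x. indicator ?S x \<partial>unit_leb)"
      using i prob_space by (subst Bochner_Integration.integral_add) auto
    also have "(\<integral>x. indicator ?S x \<partial>unit_leb) = (prob ?S :: real)"
      by (subst Bochner_Integration.integral_indicator) (auto intro!: arg_cong[where f = prob])
    finally show "(\<integral>x. c + d * indicator ?S x \<partial>unit_leb) = c + d * prob ?S" .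
  qed
  have "e / K \<le> prob {x \<in> {0..<1}. digit_average b n x \<in> {?a - 2 * e..}}"
  proof -
    have "(\<integral>x. digit_average b n x \<partial>unit_leb) \<le>
        (\<integral>x. (?a - 2 * e) + K * indicator {x \<in> {0..<1}. digit_average b n x \<in> {?a - 2 * e..}} x \<partial>unit_leb)"
    proof (intro integral_mono ia iu)
      fix x assume "x \<in> space unit_leb"
      then show "digit_average b n x \<le> (?a - 2 * e) + K * indicator {x \<in> {0..<1}. digit_average b n x \<in> {?a - 2 * e..}} x"
        using bound[of x] by (auto simp: indicator_def K_def)
    qed simp
    also have "\<dots> = (?a - 2 * e) + K * prob {x \<in> {0..<1}. digit_average b n x \<in> {?a - 2 * e..}}"
      by (rule eu) simp
    finally have "e \<le> K * prob {x \<in> {0..<1}. digit_average b n x \<in> {?a - 2 * e..}}" using n(1) by linarith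
    then show ?thesis using K by (simp add: pos_divide_le_eq mult.commute)
  qed
  from word[OF this] obtain u where u: "?a - 2 * e \<le> real_of_int (sum_list u) / real n"
    "rich_at b (real_of_int (sum_list u) / real n) 1 e" by auto
  have "e / K \<le> prob {x \<in> {0..<1}. digit_average b n x \<in> {..?a + 2 * e}}"
  proof -
    have "(\<integral>x. (?a + 2 * e) + (- K) * indicator {x \<in> {0..<1}. digit_average b n x \<in> {..?a + 2 * e}} x \<partial>unit_leb)
       \<le> (\<integral>x. digit_average b n x \<partial>unit_leb)"
    proof (intro integral_mono ia iu)
      fix x assume "x \<in> space unit_leb"
      then show "(?a + 2 * e) + (- K) * indicator {x \<in> {0..<1}. digit_average b n x \<in> {..?a + 2 * e}} x \<le> digit_average b n x"
        using bound[of x] b by (auto simp: indicator_def K_def)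
    qed simp
    moreover have "(\<integral>x. (?a + 2 * e) + (- K) * indicator {x \<in> {0..<1}. digit_average b n x \<in> {..?a + 2 * e}} x \<partial>unit_leb)
      = (?a + 2 * e) + (- K) * prob {x \<in> {0..<1}. digit_average b n x \<in> {..?a + 2 * e}}"
      by (rule eu) simp
    ultimately have "e \<le> K * prob {x \<in> {0..<1}. digit_average b n x \<in> {..?a + 2 * e}}" using n(1) by linarith
    then show ?thesis using K by (simp add: pos_divide_le_eq mult.commute)
  qed
  from word[OF this] obtain v where v: "real_of_int (sum_list v) / real n \<le> ?a + 2 * e"
    "rich_at b (real_of_int (sum_list v) / real n) 1 e" by auto
  let ?u = "real_of_int (sum_list u) / real n" and ?v = "real_of_int (sum_list v) / real n"
  show "rich_at b ?a 1 h"
  \<comment> \<open>If \<open>?u \<le> ?a\<close> or \<open>?a \<le> ?v\<close>, that mean is within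
    \<open>2 * e\<close> of \<open>?a\<close> and suffices alone; otherwise \<open>?v\<close> and
    \<open>?u\<close> bracket \<open>?a\<close>.\<close>
  proof (cases "?u \<le> ?a \<or> ?a \<le> ?v")
    case True
    then show ?thesis
    proof
      assume "?u \<le> ?a"
      then show ?thesis using rich_at_weaken[OF b u(2), of ?a h 1] u(1) h by (simp add: e_def)
    next
      assume "?a \<le> ?v"
      then show ?thesis using rich_at_weaken[OF b v(2), of ?a h 1] v(1) h by (simp add: e_def)
    qed
  next
    case False
    then have "rich_at b ?a 1 (2 * e)" using rich_at_between[OF b e _ _ order_refl order_refl v(2) u(2)] by simp
    then show ?thesis using rich_at_weaken[OF b, of ?a 1 "2 * e" ?a h 1] h by (simp add: e_def)
  qed
qed

section \<open>Hausdorff dimension: upper bounds\<close>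

lemma hausdorff_dim_nonneg: "0 \<le> hausdorff_dim E"
  unfolding hausdorff_dim_def by (intro Inf_greatest) auto

lemma hausdorff_dim_le: "0 \<le> s \<Longrightarrow> hausdorff_measure s E = 0 \<Longrightarrow> hausdorff_dim E \<le> ereal s"
  unfolding hausdorff_dim_def by (intro Inf_lower) auto

lemma hausdorff_dim_ge:
  assumes "\<And>r. 0 \<le> r \<Longrightarrow> r < s \<Longrightarrow> hausdorff_measure r E \<noteq> 0"
  shows "ereal s \<le> hausdorff_dim E"
  unfolding hausdorff_dim_def
proof (rule Inf_greatest)
  fix z assume "z \<in> ereal ` {s. 0 \<le> s \<and> hausdorff_measure s E = 0}"
  then obtain r where r: "z = ereal r" "0 \<le> r" "hausdorff_measure r E = 0" by auto
  with assms[of r] have "s \<le> r" by (cases "r < s") auto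
  with r show "ereal s \<le> z" by simp
qed

text \<open>Each point lies in a set of level \<open>n\<close> for all large \<open>n\<close>, so
  the levels from any \<open>m\<close> on form a cover; their total cost is a tail of a convergent
  series.\<close>

lemma hausdorff_measure_zeroI:
  fixes E :: "'a::metric_space set"
  assumes s: "0 < s" and fin: "\<And>n. finite (I n)" and d0: "\<And>n. 0 \<le> d n" and d: "d \<longlonglongrightarrow> 0"
    and U: "\<And>n i. i \<in> I n \<Longrightarrow> bounded (U n i) \<and> diameter (U n i) \<le> d n"
    and sm: "summable (\<lambda>n. real (card (I n)) * d n powr s)"
    and cov: "\<And>x. x \<in> E \<Longrightarrow> eventually (\<lambda>n. \<exists>i\<in>I n. x \<in> U n i) sequentially"
  shows "hausdorff_measure s E = 0"
proof -
  have small: "hausdorff_premeasure s \<delta> E \<le> ennreal e" if \<delta>: "0 < \<delta>" and e: "0 < e" for \<delta> e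
  proof -
    let ?f = "\<lambda>n. real (card (I n)) * d n powr s"
    have f0: "0 \<le> ?f n" for n by simp
    obtain n1 where n1: "\<And>n. n1 \<le> n \<Longrightarrow> d n \<le> \<delta>"
      using order_tendstoD(2)[OF d \<delta>] by (auto simp: eventually_sequentially intro: less_imp_le)
    obtain n2 where n2: "\<And>n. n2 \<le> n \<Longrightarrow> norm (\<Sum>i. ?f (i + n)) < e"
      using suminf_exist_split[OF e sm] by blast
    define m where "m = max n1 n2"
    obtain g where g: "\<And>n. bij_betw (g n) {..<card (I n)} (I n)"
      using ex_bij_betw_nat_finite[OF fin] by (metis atLeast0LessThan)
    \<comment> \<open>Each level is padded with empty sets, whose gauge is 0, and the levels are
      merged by \<open>prod_decode\<close> into the single sequence that
      \<open>hausdorff_premeasure\<close> asks for.\<close>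
    define V where "V = (\<lambda>(n, j). if j < card (I (n + m)) then U (n + m) (g (n + m) j) else {})"
    have gI: "g n j \<in> I n" if "j < card (I n)" for n j
      using g[of n] that by (auto simp: bij_betw_def)
    have V: "bounded (V p) \<and> diameter (V p) \<le> \<delta>" for p
    proof (cases p)
      case (Pair n j)
      show ?thesis
      proof (cases "j < card (I (n + m))")
        case True
        have "d (n + m) \<le> \<delta>" by (intro n1) (simp add: m_def)
        then show ?thesis using U[OF gI[OF True]] True Pair by (auto simp: V_def)
      qed (use \<delta> Pair in \<open>simp add: V_def diameter_empty\<close>)
    qed
    have "E \<subseteq> (\<Union>k. V (prod_decode k))"
    proof
      fix x assume "x \<in> E"
      then obtain n0 where n0: "\<And>n. n0 \<le> n \<Longrightarrow> \<exists>i\<in>I n. x \<in> U n i"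
        using cov[unfolded eventually_sequentially] by blast
      obtain i where i: "i \<in> I (n0 + m)" "x \<in> U (n0 + m) i" using n0[of "n0 + m"] by auto
      then have "i \<in> g (n0 + m) ` {..<card (I (n0 + m))}" using g by (simp add: bij_betw_def)
      then obtain j where "j < card (I (n0 + m))" "g (n0 + m) j = i" by blast
      then have "x \<in> V (n0, j)" using i by (simp add: V_def)
      then have "x \<in> V (prod_decode (prod_encode (n0, j)))" by simp
      then show "x \<in> (\<Union>k. V (prod_decode k))" by blast
    qed
    then have "hausdorff_premeasure s \<delta> E \<le> (\<Sum>k. hausdorff_gauge s (V (prod_decode k)))"
      unfolding hausdorff_premeasure_def by (intro INF_lower2[of "\<lambda>k. V (prod_decode k)"]) (use V in auto)
    also have "\<dots> = (\<Sum>n. \<Sum>j. hausdorff_gauge s (V (n, j)))"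
      using suminf_ennreal_2dimen[of "\<lambda>n. \<Sum>j. hausdorff_gauge s (V (n, j))" "\<lambda>p. hausdorff_gauge s (V p)"] by simp
    also have "\<dots> \<le> (\<Sum>n. ennreal (?f (n + m)))"
    proof (intro suminf_le allI)
      fix n
      have "(\<Sum>j. hausdorff_gauge s (V (n, j))) = (\<Sum>j<card (I (n + m)). hausdorff_gauge s (V (n, j)))"
        by (intro suminf_finite) (auto simp: V_def hausdorff_gauge_def)
      also have "\<dots> \<le> (\<Sum>j<card (I (n + m)). ennreal (d (n + m) powr s))"
      proof (intro sum_mono)
        fix j assume "j \<in> {..<card (I (n + m))}"
        then have B: "bounded (V (n, j))" "diameter (V (n, j)) \<le> d (n + m)"
          using U[OF gI] by (auto simp: V_def)
        then have "diameter (V (n, j)) powr s \<le> d (n + m) powr s"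
          using s by (intro powr_mono2) (auto intro: diameter_ge_0)
        then show "hausdorff_gauge s (V (n, j)) \<le> ennreal (d (n + m) powr s)"
          using s by (auto simp: hausdorff_gauge_def intro: ennreal_leI)
      qed
      also have "\<dots> = ennreal (?f (n + m))"
        by (simp add: ennreal_of_nat_eq_real_of_nat ennreal_mult)
      finally show "(\<Sum>j. hausdorff_gauge s (V (n, j))) \<le> ennreal (?f (n + m))" .
    qed auto
    also have "\<dots> = ennreal (\<Sum>n. ?f (n + m))"
      using summable_ignore_initial_segment[OF sm, of m] by (intro suminf_ennreal2) auto
    also have "\<dots> \<le> ennreal e"
      using n2[of m] by (intro ennreal_leI) (auto simp: m_def)
    finally show ?thesis .
  qed
  have "hausdorff_premeasure s \<delta> E \<le> 0" if "0 < \<delta>" for \<delta>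
    by (rule ennreal_le_epsilon) (use small[OF that] in auto)
  then show ?thesis
    unfolding hausdorff_measure_def by (intro antisym SUP_least) auto
qed

lemma hausdorff_dim_unit_interval_le:
  assumes E: "E \<subseteq> {0..<1::real}"
  shows "hausdorff_dim E \<le> 1"
proof (rule ereal_le_epsilon2)
  fix e :: real assume e: "0 < e"
  have "hausdorff_measure (1 + e) E = 0"
  proof (rule hausdorff_measure_zeroI[where I = "\<lambda>n. {..<2 ^ n :: nat}" and d = "\<lambda>n. (1 / 2) ^ n"
        and U = "\<lambda>n i. {real i / 2 ^ n..(real i + 1) / 2 ^ n}"])
    show "summable (\<lambda>n. real (card {..<2 ^ n :: nat}) * ((1 / 2) ^ n) powr (1 + e))"
    proof -
      have "real (card {..<2 ^ n :: nat}) * ((1 / 2) ^ n) powr (1 + e) = ((1 / 2) powr e) ^ n" for n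
      proof -
        have "((1 / 2) ^ n) powr (1 + e) = (1 / 2) ^ n * ((1 / 2) ^ n) powr e"
          by (simp add: powr_add)
        also have "((1 / 2) ^ n) powr e = ((1 / 2) powr e) ^ n"
          by (simp add: powr_realpow[symmetric] powr_powr mult.commute)
        finally show ?thesis by (simp add: power_one_over)
      qed
      moreover have "(1 / 2 :: real) powr e < (1 / 2) powr 0" using e by (intro powr_less_mono') auto
      ultimately show ?thesis by (simp add: summable_geometric)
    qed
    show "eventually (\<lambda>n. \<exists>i\<in>{..<2 ^ n :: nat}. x \<in> {real i / 2 ^ n..(real i + 1) / 2 ^ n}) sequentially"
      if "x \<in> E" for x
    proof (intro always_eventually allI)
      fix n :: nat
      have x: "0 \<le> x" "x < 1" using E that by auto
      define i where "i = nat \<lfloor>x * 2 ^ n\<rfloor>"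
      have "0 \<le> x * 2 ^ n" using x by simp
      then have i: "real i \<le> x * 2 ^ n" "x * 2 ^ n < real i + 1" unfolding i_def by linarith+
      have "x * 2 ^ n < 2 ^ n" using x by simp
      with i(1) have "real i < 2 ^ n" by linarith
      then have "i < 2 ^ n" by simp
      with i show "\<exists>i\<in>{..<2 ^ n :: nat}. x \<in> {real i / 2 ^ n..(real i + 1) / 2 ^ n}"
        by (intro bexI[of _ i]) (auto simp: field_simps)
    qed
    show "bounded {real i / 2 ^ n..(real i + 1) / 2 ^ n} \<and> diameter {real i / 2 ^ n..(real i + 1) / 2 ^ n} \<le> (1 / 2) ^ n" for i n :: nat
      by (auto simp: power_one_over add_divide_distrib intro!: diameter_le)
  qed (use e in \<open>auto intro: LIMSEQ_realpow_zero\<close>)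
  then have "hausdorff_dim E \<le> ereal (1 + e)" using e by (intro hausdorff_dim_le) auto
  then show "hausdorff_dim E \<le> 1 + ereal e" by (simp add: one_ereal_def)
qed

text \<open>At level \<open>n\<close> at most \<open>b powr (n * r)\<close> intervals of length
  \<open>(1 / b) ^ n\<close> cover, so the costs for exponent \<open>s\<close> decay geometrically
  with ratio \<open>b powr (r - s)\<close>.\<close>

lemma sparse_words_null:
  assumes b: "1 < b" and s: "0 < s" "r < s"
    and count: "eventually (\<lambda>n. real (card {w \<in> admissible_words b n. of_int (sum_list w) \<le> a * real n}) \<le> b powr (real n * r)) sequentially"
    and E: "\<And>x. x \<in> E \<Longrightarrow> 0 \<le> x \<and> x < 1 \<and> eventually (\<lambda>n. of_int (digit_sum b n x) \<le> a * real n) sequentially"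
  shows "hausdorff_measure s E = 0"
proof (rule hausdorff_measure_zeroI[OF s(1), where I = "\<lambda>n. {w \<in> admissible_words b n. of_int (sum_list w) \<le> a * real n}"
      and d = "\<lambda>n. (1 / b) ^ n" and U = "\<lambda>n w. {wjoin b w 0..wjoin b w 0 + (1 / b) ^ n}"])
  have b0: "0 < b" using b by simp
  let ?I = "\<lambda>n. {w \<in> admissible_words b n. of_int (sum_list w) \<le> a * real n}"
  show "finite (?I n)" for n using finite_admissible_words[OF b0] by simp
  show "0 \<le> (1 / b) ^ n" for n using b by simp
  show "(\<lambda>n. (1 / b) ^ n) \<longlonglongrightarrow> 0" using b by (intro LIMSEQ_realpow_zero) auto
  show "bounded {wjoin b w 0..wjoin b w 0 + (1 / b) ^ n} \<and> diameter {wjoin b w 0..wjoin b w 0 + (1 / b) ^ n} \<le> (1 / b) ^ n" for n w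
    using b by (auto intro!: diameter_le)
  show "summable (\<lambda>n. real (card (?I n)) * ((1 / b) ^ n) powr s)"
  proof (rule summable_comparison_test_ev)
    have "b powr (r - s) < b powr 0" using b s by (intro powr_less_mono) auto
    then show "summable (\<lambda>n. (b powr (r - s)) ^ n)" using b by (intro summable_geometric) auto
    show "eventually (\<lambda>n. norm (real (card (?I n)) * ((1 / b) ^ n) powr s) \<le> (b powr (r - s)) ^ n) sequentially"
      using count
    proof eventually_elim
      case (elim n)
      have e1: "((1 / b) ^ n) powr s = b powr (- (s * real n))"
        using b by (simp add: power_one_over powr_realpow[symmetric] powr_minus_divide[symmetric] powr_powr mult.commute)
      have "norm (real (card (?I n)) * ((1 / b) ^ n) powr s) \<le> b powr (real n * r) * b powr (- (s * real n))"
        using elim unfolding e1 by (simp add: mult_right_mono)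
      also have "\<dots> = b powr ((r - s) * real n)" by (simp add: powr_add[symmetric] algebra_simps)
      also have "\<dots> = (b powr (r - s)) ^ n" by (rule powr_mult_nat[OF b])
      finally show ?case .
    qed
  qed
  fix x assume "x \<in> E"
  then have x: "0 \<le> x" "x < 1" "eventually (\<lambda>n. of_int (digit_sum b n x) \<le> a * real n) sequentially"
    using E by auto
  show "eventually (\<lambda>n. \<exists>i\<in>?I n. x \<in> {wjoin b i 0..wjoin b i 0 + (1 / b) ^ n}) sequentially"
    using x(3)
  proof eventually_elim
    case (elim n)
    let ?w = "digit_word b n x" and ?y = "(beta_map b ^^ n) x"
    have "x = wjoin b ?w ?y" using digit_word_fits[OF b0 x(1,2), of n] by auto
    also have "\<dots> = wjoin b ?w 0 + ?y * (1 / b) ^ n" using b by (subst join_affine) (auto simp: power_one_over)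
    finally have "x = wjoin b ?w 0 + ?y * (1 / b) ^ n" .
    moreover have "0 \<le> ?y * (1 / b) ^ n" "?y * (1 / b) ^ n \<le> 1 * (1 / b) ^ n"
      using beta_iter_range[OF x(1,2), where n = n and b = b] b by (auto intro!: mult_right_mono)
    ultimately have "x \<in> {wjoin b ?w 0..wjoin b ?w 0 + (1 / b) ^ n}" by auto
    moreover have "?w \<in> ?I n"
      using digit_word_admissible[OF b0 x(1,2), of n] elim by (simp add: sum_list_digit_word)
    ultimately show ?case by blast
  qed
qed

section \<open>Digit sums of points with given window averages\<close>

lemma digit_bounds:
  assumes "0 < b" "0 \<le> x" "x < 1"
  shows "0 \<le> beta_digit b n x \<and> real_of_int (beta_digit b n x) \<le> b"
proof -
  have "0 \<le> (beta_map b ^^ (n - 1)) x" "(beta_map b ^^ (n - 1)) x \<le> 1"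
    using beta_iter_range[OF assms(2,3), where n = "n - 1" and b = b] by auto
  then have "0 \<le> b * (beta_map b ^^ (n - 1)) x" "b * (beta_map b ^^ (n - 1)) x \<le> b" using assms(1) by auto
  then show ?thesis
    unfolding beta_digit_def by (auto intro: order_trans[OF of_int_floor_le])
qed

lemma digit_sum_mono_bound:
  assumes "0 < b" "0 \<le> x" "x < 1" "m \<le> n"
  shows "digit_sum b m x \<le> digit_sum b n x"
    and "real_of_int (digit_sum b n x) \<le> real_of_int (digit_sum b m x) + b * real (n - m)"
proof -
  have "digit_sum b (m + k) x = digit_sum b m x + (\<Sum>i=m+1..m+k. beta_digit b i x)" for k
    unfolding digit_sum_def using sum.ub_add_nat[of 1 m "\<lambda>i. beta_digit b i x" k] by simp
  from this[of "n - m"] have e: "digit_sum b n x = digit_sum b m x + (\<Sum>i=m+1..n. beta_digit b i x)"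
    using assms(4) by simp
  show "digit_sum b m x \<le> digit_sum b n x"
    unfolding e using digit_bounds[OF assms(1-3)] by (simp add: sum_nonneg)
  have "(\<Sum>i=m+1..n. real_of_int (beta_digit b i x)) \<le> (\<Sum>i=m+1..n. b)"
    using digit_bounds[OF assms(1-3)] by (intro sum_mono) blast
  then show "real_of_int (digit_sum b n x) \<le> real_of_int (digit_sum b m x) + b * real (n - m)"
    unfolding e by (simp add: mult.commute)
qed

lemma ER_average_window:
  assumes "i \<le> n - k" "0 < k"
  shows "real_of_int (digit_sum b (i + k) x - digit_sum b i x) \<le> real k * ER_average b n k x"
proof -
  have "digit_sum b (i + k) x - digit_sum b i x \<le> Max ((\<lambda>i. digit_sum b (i + k) x - digit_sum b i x) ` {0..n - k})"
    using assms by (intro Max_ge) auto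
  then show ?thesis using assms(2) by (simp add: ER_average_def)
qed

lemma ER_set_digit_sum:
  assumes b: "1 < b" and x: "x \<in> ER_set b \<phi> a" and e: "0 < e"
    and inf: "filterlim \<phi> at_top sequentially" and sub: "(\<lambda>n. real (\<phi> n) / real n) \<longlonglongrightarrow> 0"
  shows "eventually (\<lambda>n. of_int (digit_sum b n x) \<le> (a + e) * real n) sequentially"
proof -
  have b0: "0 < b" using b by simp
  have x01: "0 \<le> x" "x < 1" and lim: "(\<lambda>n. ER_average b n (\<phi> n) x) \<longlonglongrightarrow> a"
    using x by (auto simp: ER_set_def)
  have "a < a + e / 2" "0 < min 1 (e / (2 * b))" using e b by auto
  note ev = order_tendstoD(2)[OF lim this(1)] order_tendstoD(2)[OF sub this(2)]
  have "eventually (\<lambda>n. 1 \<le> \<phi> n) sequentially" using inf by (simp add: filterlim_at_top)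
  with ev eventually_gt_at_top[of 0] show ?thesis
  proof eventually_elim
    case (elim n)
    define k where "k = \<phi> n"
    define A where "A = ER_average b n k x"
    have k: "0 < k" using elim by (simp add: k_def)
    have kn: "real k < real n" "b * real k \<le> e / 2 * real n"
      using elim(2,3) b by (auto simp: k_def pos_divide_less_eq field_simps)
    \<comment> \<open>Nonnegativity of \<open>A\<close> is what allows \<open>?q * k\<close> to be
      enlarged to \<open>n\<close> in the final estimate.\<close>
    have "0 \<le> real_of_int (digit_sum b (0 + k) x - digit_sum b 0 x)"
      using digit_sum_mono_bound(1)[OF b0 x01, of 0 k] by simp
    also have "\<dots> \<le> real k * A" unfolding A_def using k by (intro ER_average_window) auto
    finally have A0: "0 \<le> A" using k by (simp add: zero_le_mult_iff)
    have step: "real_of_int (digit_sum b (j * k) x) \<le> real j * (real k * A)" if "j * k \<le> n" for j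
      using that
    proof (induction j)
      case (Suc j)
      then have "j * k \<le> n - k" by simp
      from ER_average_window[OF this k, of b x] Suc show ?case
        by (simp add: A_def algebra_simps)
    qed (simp add: digit_sum_def)
    let ?q = "n div k"
    have q: "?q * k \<le> n" "n - ?q * k \<le> k"
      using div_mult_mod_eq[of n k] mod_less_divisor[OF k, of n] by linarith+
    have "real_of_int (digit_sum b n x) \<le> real_of_int (digit_sum b (?q * k) x) + b * real (n - ?q * k)"
      by (rule digit_sum_mono_bound(2)[OF b0 x01 q(1)])
    also have "\<dots> \<le> real ?q * (real k * A) + b * real k"
      using step[OF q(1)] of_nat_mono[OF q(2), where ?'a = real] b0 by (intro add_mono mult_left_mono) auto
    also have "real ?q * (real k * A) = real (?q * k) * A" by simp
    also have "\<dots> \<le> real n * A" using q(1) A0 by (intro mult_right_mono of_nat_mono)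
    also have "\<dots> \<le> real n * (a + e / 2)" using elim(1) by (intro mult_left_mono) (auto simp: A_def k_def)
    finally show ?case using kn(2) by (simp add: algebra_simps)
  qed
qed

text \<open>An \<open>r\<close> strictly between the entropy and the dimension is not rich, so by
  \<open>rich_of_sparse_count\<close> words of mean at most \<open>a + e\<close> are eventually few;
  each point of the set eventually stays in the cylinders of such words.\<close>

lemma ER_set_dim_le:
  assumes b: "1 < b" and a: "0 \<le> a" "ereal a \<le> max_average b" "a \<le> typical_average b"
    and inf: "filterlim \<phi> at_top sequentially" and sub: "(\<lambda>n. real (\<phi> n) / real n) \<longlonglongrightarrow> 0"
  shows "hausdorff_dim (ER_set b \<phi> a) \<le> digit_entropy b a"
proof (rule ccontr)
  assume "\<not> ?thesis"
  then obtain s where s: "digit_entropy b a < ereal s" "ereal s < hausdorff_dim (ER_set b \<phi> a)"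
    using ereal_dense2 by (metis not_le)
  \<comment> \<open>A second exponent is interposed because \<open>sparse_words_null\<close> sets a
    count of rate \<open>r\<close> against a cost of strictly larger exponent
    \<open>s\<close>.\<close>
  from s(1) obtain r where r: "digit_entropy b a < ereal r" "ereal r < ereal s" using ereal_dense2 by blast
  have "ER_set b \<phi> a \<subseteq> {0..<1}" by (auto simp: ER_set_def)
  from less_le_trans[OF s(2) hausdorff_dim_unit_interval_le[OF this]] have "s < 1" by simp
  with r(2) have r1: "r \<le> 1" by simp
  have "ereal 0 \<le> digit_entropy b a" by (rule entropy_ge_of_rich[OF b rich_of_le_max_average[OF b a(1,2)]])
  with s(1) have s0: "0 < s" by (metis ereal_less(2) le_less_trans zero_ereal_def ereal_less_eq(3) less_eq_ereal_def less_ereal.simps(1))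
  have "\<not> rich b a r" using entropy_ge_of_rich[OF b, of a r] r(1) by auto
  then obtain e where e: "0 < e" "\<not> (\<exists>\<^sub>F n in sequentially. b powr (real n * r)
       \<le> real (card {w \<in> admissible_words b n. of_int (sum_list w) \<le> (a + e) * real n}))"
    using rich_of_sparse_count[OF b rich_typical[OF b] a(3) r1] by blast
  then have "eventually (\<lambda>n. real (card {w \<in> admissible_words b n. of_int (sum_list w) \<le> (a + e) * real n}) \<le> b powr (real n * r)) sequentially"
    by (auto simp: not_frequently not_le elim: eventually_mono)
  then have "hausdorff_measure s (ER_set b \<phi> a) = 0"
    using r(2) ER_set_digit_sum[OF b _ e(1) inf sub]
    by (intro sparse_words_null[OF b s0, of r]) (auto simp: ER_set_def)
  then have "hausdorff_dim (ER_set b \<phi> a) \<le> ereal s" using s0 by (intro hausdorff_dim_le) auto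
  with s(2) show False by simp
qed

section \<open>Cantor sets of concatenated blocks\<close>

text \<open>The value at tail 1 is the supremum of the values over tails below 1, all of which are
  less than 1.\<close>

lemma full_wjoin_le_1:
  assumes b: "0 < b" and w: "full b w" and y: "y \<le> 1"
  shows "wjoin b w y \<le> 1"
proof -
  define c where "c = 1 / b ^ length w"
  have c: "0 < c" using b by (simp add: c_def)
  have aff: "wjoin b w z = wjoin b w 0 + z * c" for z using b by (subst join_affine) (auto simp: c_def)
  have lt: "wjoin b w 0 + z * c < 1" if "0 \<le> z" "z < 1" for z
    using fits_join[OF b fullD[OF w that]] aff[of z] by simp
  have "wjoin b w 0 + c \<le> 1"
  proof (rule ccontr)
    assume "\<not> wjoin b w 0 + c \<le> 1"
    then have "1 - wjoin b w 0 < c" by simp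
    moreover have "0 < 1 - wjoin b w 0" using lt[of 0] by simp
    ultimately have "0 \<le> (1 - wjoin b w 0) / c" "(1 - wjoin b w 0) / c < 1"
      using c by (simp_all only: divide_less_eq_1_pos divide_nonneg_pos less_imp_le)
    from lt[OF this] c show False by simp
  qed
  moreover have "wjoin b w y \<le> wjoin b w 1" using b y by (intro join_mono)
  ultimately show ?thesis using aff[of 1] by simp
qed

text \<open>The value at tail 1 decreases strictly with the base, so fullness in a smaller base
  leaves a gap below 1. This keeps the limit points of the construction off the right ends of
  cylinders, where the greedy expansion is a different one.\<close>

lemma full_wjoin_1_less:
  assumes b: "0 < c" "c < b" and w: "full c w" "w \<noteq> []"
  shows "wjoin b w 1 < 1"
proof -
  have n: "\<forall>d\<in>set w. 0 \<le> d" using fits_digits[OF full_fits0[OF w(1)]] by blast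
  have "1 / b ^ length w < 1 / c ^ length w"
    using b w(2) by (intro divide_strict_left_mono power_strict_mono mult_pos_pos) auto
  moreover have "wjoin b w 0 \<le> wjoin c w 0" using b n by (intro join_antimono_base) auto
  moreover have "wjoin b w 1 = wjoin b w 0 + 1 / b ^ length w" "wjoin c w 1 = wjoin c w 0 + 1 / c ^ length w"
    using b by (subst join_affine; simp)+
  ultimately show ?thesis using full_wjoin_le_1[OF b(1) w(1), of 1] by linarith
qed

section \<open>Digit sums over windows of concatenated blocks\<close>

lemma sum_list_take_bound:
  assumes "\<forall>d\<in>set w. real_of_int d \<le> D" "0 \<le> D"
  shows "real_of_int (sum_list (take k w)) \<le> D * real k"
  using assms
proof (induction w arbitrary: k)
  case (Cons d w)
  show ?case
  proof (cases k)
    case (Suc j)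
    then show ?thesis using Cons.IH[of j] Cons.prems by (auto simp: algebra_simps)
  qed (use Cons.prems in simp)
qed simp

text \<open>Complete blocks have mean at most \<open>a\<close>; only the last, cut block can exceed
  it, and it contributes at most \<open>D * L\<close>.\<close>

lemma concat_prefix_sum:
  assumes "\<forall>c\<in>set bl. (\<forall>d\<in>set c. real_of_int d \<le> D) \<and> real_of_int (sum_list c) \<le> a * real (length c) \<and> length c \<le> L"
    and "0 \<le> D" "0 \<le> a"
  shows "real_of_int (sum_list (take k (concat bl))) \<le> a * real k + D * real L"
  using assms
proof (induction bl arbitrary: k)
  case (Cons c bl)
  show ?case
  proof (cases "length c \<le> k")
    case True
    have "real_of_int (sum_list (take (k - length c) (concat bl))) \<le> a * real (k - length c) + D * real L"
      using Cons.prems by (intro Cons.IH) auto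
    moreover have "real_of_int (sum_list c) \<le> a * real (length c)" using Cons.prems(1) by simp
    moreover have "a * real k = a * real (length c) + a * real (k - length c)"
      using True by (simp add: of_nat_diff flip: distrib_left)
    moreover have "sum_list (take k (concat (c # bl))) = sum_list c + sum_list (take (k - length c) (concat bl))"
      using True by simp
    ultimately show ?thesis by (simp only: of_int_add)
  next
    case False
    have "real_of_int (sum_list (take k c)) \<le> D * real k"
      using Cons.prems by (intro sum_list_take_bound) auto
    also have "\<dots> \<le> D * real L" using Cons.prems False by (intro mult_left_mono) auto
    also have "\<dots> \<le> a * real k + D * real L" using Cons.prems by simp
    finally show ?thesis using False by simp
  qed
qed simp

text \<open>The first block met by the window may be cut as well, hence a second
  \<open>D * L\<close>.\<close>

lemma concat_window_sum:
  assumes "\<forall>c\<in>set bl. (\<forall>d\<in>set c. real_of_int d \<le> D) \<and> real_of_int (sum_list c) \<le> a * real (length c) \<and> length c \<le> L"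
    and "0 \<le> D" "0 \<le> a"
  shows "real_of_int (sum_list (take k (drop i (concat bl)))) \<le> a * real k + 2 * D * real L"
  using assms
proof (induction bl arbitrary: i)
  case (Cons c bl)
  show ?case
  proof (cases "length c \<le> i")
    case True
    then show ?thesis using Cons by auto
  next
    case False
    let ?u = "take k (drop i c)" and ?m = "k - (length c - i)"
    have "\<forall>d\<in>set ?u. real_of_int d \<le> D"
      using Cons.prems(1) by (auto dest!: in_set_takeD in_set_dropD)
    from sum_list_take_bound[OF this Cons.prems(2), of "length ?u"]
    have "real_of_int (sum_list ?u) \<le> D * real (length ?u)" by (simp only: take_all[OF order_refl])
    also have "\<dots> \<le> D * real L" using Cons.prems by (intro mult_left_mono) auto
    finally have 1: "real_of_int (sum_list ?u) \<le> D * real L" .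
    have "real_of_int (sum_list (take ?m (concat bl))) \<le> a * real ?m + D * real L"
      using Cons.prems by (intro concat_prefix_sum) auto
    also have "\<dots> \<le> a * real k + D * real L" using Cons.prems by (intro add_mono mult_left_mono) auto
    finally show ?thesis using 1 False by simp
  qed
qed simp

lemma sum_list_take_diff: "sum_list (take k (drop i w)) = sum_list (take (i + k) w) - (sum_list (take i w) :: int)"
  by (simp add: take_add)

lemma take_digit_word: "n \<le> m \<Longrightarrow> take n (digit_word b m x) = digit_word b n x"
  by (simp add: digit_word_def take_map)

text \<open>The lower counterpart for prefixes of a periodic word: at most one incomplete period is
  given away.\<close>

lemma sum_list_power_prefix:
  fixes u :: "int list"
  assumes a: "0 \<le> a" "0 \<le> h" and u: "0 < length u" "\<forall>d\<in>set u. 0 \<le> d"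
    "(a - h) * real (length u) \<le> of_int (sum_list u)" "of_int (sum_list u) \<le> a * real (length u)"
    and k: "k \<le> r * length u"
  shows "(a - h) * real k - a * real (length u) \<le> of_int (sum_list (take k (concat (replicate r u))))"
  using k
proof (induction r arbitrary: k)
  case 0
  then show ?case using a by simp
next
  case (Suc r)
  show ?case
  proof (cases "length u \<le> k")
    case True
    have "(a - h) * real (k - length u) - a * real (length u) \<le> of_int (sum_list (take (k - length u) (concat (replicate r u))))"
      using Suc.prems True by (intro Suc.IH) auto
    moreover have "(a - h) * real k = (a - h) * real (length u) + (a - h) * real (k - length u)"
      using True by (simp add: of_nat_diff flip: distrib_left)
    moreover have "sum_list (take k (concat (replicate (Suc r) u))) = sum_list u + sum_list (take (k - length u) (concat (replicate r u)))"
      using True by simp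
    ultimately show ?thesis using u(3) by (simp only: of_int_add)
  next
    case False
    have "(a - h) * real k \<le> a * real k" using a by (intro mult_right_mono) auto
    also have "\<dots> \<le> a * real (length u)" using False a by (intro mult_left_mono) auto
    finally have "(a - h) * real k - a * real (length u) \<le> 0" by simp
    moreover have "0 \<le> sum_list (take k u)" using u(2) by (intro sum_list_nonneg) (auto dest: in_set_takeD)
    ultimately show ?thesis using False by simp
  qed
qed

text \<open>Every real \<open>t\<close> in the unit interval is encoded through its base \<open>K\<close> digits: the digit with
  index \<open>i\<close> selects a word \<open>e j\<close> of fixed length, which is followed by the fixed words \<open>sp i\<close>.\<close>

locale block_coding =
  fixes b a :: real and N K :: nat and e :: "nat \<Rightarrow> int list" and sp :: "nat \<Rightarrow> int list list"
    and L :: "nat \<Rightarrow> nat"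
  assumes b: "1 < b" and a: "0 \<le> a" and N: "0 < N" and K: "1 < K"
    and e: "j < K \<Longrightarrow> length (e j) = N \<and> full b (e j) \<and> wjoin b (e j) 1 < 1 \<and> of_int (sum_list (e j)) \<le> a * real N"
    and inj: "inj_on e {..<K}"
    and sp: "w \<in> set (sp i) \<Longrightarrow> full b w \<and> of_int (sum_list w) \<le> a * real (length w) \<and> length w \<le> L i"
    and L: "mono L" "N \<le> L 0"
begin

text \<open>In an integer base \<open>beta_digit\<close> is the ordinary digit, so the facts about
  greedy expansions apply to the parameter as well. Digits are numbered from 1, hence
  \<open>Suc i\<close>.\<close>

definition code :: "real \<Rightarrow> nat \<Rightarrow> nat" where
  "code t i = nat (beta_digit (real K) (Suc i) t)"

definition blocks :: "real \<Rightarrow> nat \<Rightarrow> int list list" where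
  "blocks t q = concat (map (\<lambda>i. e (code t i) # sp i) [0..<q])"

definition prefix_word :: "real \<Rightarrow> nat \<Rightarrow> int list" where
  "prefix_word t q = concat (blocks t q)"

definition pos :: "nat \<Rightarrow> nat" where
  "pos q = (\<Sum>i<q. N + length (concat (sp i)))"

text \<open>The intervals from \<open>wjoin b (prefix_word t q) 0\<close> to
  \<open>wjoin b (prefix_word t q) 1\<close> are nested, and the supremum of their left ends lies in
  all of them.\<close>

definition point :: "real \<Rightarrow> real" where
  "point t = (SUP q. wjoin b (prefix_word t q) 0)"

lemma b0: "0 < b" using b by simp

lemma code_less: "0 \<le> t \<Longrightarrow> t < 1 \<Longrightarrow> code t i < K"
proof -
  assume t: "0 \<le> t" "t < 1"
  have K0: "0 < real K" using K by simp
  define z where "z = (beta_map (real K) ^^ i) t"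
  have z: "0 \<le> z" "z < 1" using beta_iter_range[OF t, where b = "real K" and n = i] by (auto simp: z_def)
  have "real K * z < real K * 1" using z K0 by (intro mult_strict_left_mono) auto
  moreover have "0 \<le> real K * z" using z by simp
  ultimately have "0 \<le> \<lfloor>real K * z\<rfloor>" "\<lfloor>real K * z\<rfloor> < int K" by (simp_all add: floor_less_iff)
  then show "code t i < K" by (simp add: code_def beta_digit_def z_def nat_less_iff)
qed

lemma prefix_word_Suc: "prefix_word t (Suc q) = prefix_word t q @ e (code t q) @ concat (sp q)"
  by (simp add: prefix_word_def blocks_def)

lemma length_prefix_word: "0 \<le> t \<Longrightarrow> t < 1 \<Longrightarrow> length (prefix_word t q) = pos q"
proof (induction q)
  case (Suc q)
  then show ?case using e[OF code_less[of t q]] by (simp add: prefix_word_Suc pos_def)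
qed (simp add: prefix_word_def blocks_def pos_def)

lemma blocks_full: "0 \<le> t \<Longrightarrow> t < 1 \<Longrightarrow> w \<in> set (blocks t q) \<Longrightarrow>
    full b w \<and> of_int (sum_list w) \<le> a * real (length w) \<and> length w \<le> L q"
proof -
  assume t: "0 \<le> t" "t < 1" and w: "w \<in> set (blocks t q)"
  then obtain i where i: "i < q" "w = e (code t i) \<or> w \<in> set (sp i)" by (auto simp: blocks_def)
  have "L i \<le> L q" "N \<le> L q" using L i(1) monoD[OF L(1), of i q] monoD[OF L(1), of 0 q] by auto
  with i(2) show ?thesis using e[OF code_less[OF t, of i]] sp[of w i] by auto
qed

lemma full_prefix_word: "0 \<le> t \<Longrightarrow> t < 1 \<Longrightarrow> full b (prefix_word t q)"
  unfolding prefix_word_def using blocks_full by (intro full_concat b0) blast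

lemma prefix_word_add: "\<exists>u. prefix_word t (q + m) = prefix_word t q @ u \<and> (0 \<le> t \<longrightarrow> t < 1 \<longrightarrow> full b u)"
proof (induction m)
  case 0
  then show ?case using full_Nil by (intro exI[of _ "[]"]) simp
next
  case (Suc m)
  then obtain u where u: "prefix_word t (q + m) = prefix_word t q @ u" "0 \<le> t \<longrightarrow> t < 1 \<longrightarrow> full b u" by blast
  have "full b (concat (sp (q + m)))" using sp by (intro full_concat b0) blast
  then have "0 \<le> t \<longrightarrow> t < 1 \<longrightarrow> full b (u @ e (code t (q + m)) @ concat (sp (q + m)))"
    using u(2) e[OF code_less[of t "q + m"]] b0 by (auto intro!: full_append)
  with u(1) show ?case
    by (intro exI[of _ "u @ e (code t (q + m)) @ concat (sp (q + m))"]) (simp add: prefix_word_Suc)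
qed

lemma left_end_le:
  assumes t: "0 \<le> t" "t < 1"
  shows "wjoin b (prefix_word t p) 0 \<le> wjoin b (prefix_word t q) 1"
    and "p \<le> q \<Longrightarrow> wjoin b (prefix_word t p) 0 \<le> wjoin b (prefix_word t q) 0"
proof -
  have inc: "wjoin b (prefix_word t p) 0 \<le> wjoin b (prefix_word t q) 0" if pq: "p \<le> q" for p q
  proof -
    obtain u where u: "prefix_word t q = prefix_word t p @ u" "full b u"
      using prefix_word_add[of t p "q - p"] pq t by auto
    have "0 \<le> wjoin b u 0" using fits_join[OF b0 full_fits0[OF u(2)]] by simp
    then show ?thesis unfolding u(1) join_append by (intro join_mono b0)
  qed
  then show "p \<le> q \<Longrightarrow> wjoin b (prefix_word t p) 0 \<le> wjoin b (prefix_word t q) 0" .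
  show "wjoin b (prefix_word t p) 0 \<le> wjoin b (prefix_word t q) 1"
  proof (cases "p \<le> q")
    case True
    then show ?thesis using inc[OF True] join_mono[OF b0, of 0 1 "prefix_word t q"] by simp
  next
    case False
    then obtain u where u: "prefix_word t p = prefix_word t q @ u" "full b u"
      using prefix_word_add[of t q "p - q"] t by auto
    show ?thesis unfolding u(1) join_append using full_wjoin_le_1[OF b0 u(2), of 0] by (intro join_mono b0) simp
  qed
qed

lemma point_between:
  assumes t: "0 \<le> t" "t < 1"
  shows "wjoin b (prefix_word t q) 0 \<le> point t \<and> point t \<le> wjoin b (prefix_word t q) 1"
proof
  have "bdd_above (range (\<lambda>q. wjoin b (prefix_word t q) 0))"
    using left_end_le(1)[OF t, of _ 0] by (intro bdd_aboveI2)
  then show "wjoin b (prefix_word t q) 0 \<le> point t" unfolding point_def by (intro cSUP_upper) auto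
  show "point t \<le> wjoin b (prefix_word t q) 1" unfolding point_def
    by (intro cSUP_least left_end_le(1)[OF t]) auto
qed

text \<open>Nesting puts the tail in the closed unit interval. The value 1 is excluded by the next
  coded block, whose right end is below 1 by the assumption on \<open>e\<close>.\<close>

lemma point_tail:
  assumes t: "0 \<le> t" "t < 1"
  shows "\<exists>y. 0 \<le> y \<and> y < 1 \<and> point t = wjoin b (prefix_word t q) y"
proof -
  have ex: "\<exists>y. 0 \<le> y \<and> y \<le> 1 \<and> point t = wjoin b (prefix_word t q) y" for q
  proof -
    let ?w = "prefix_word t q"
    define y where "y = (point t - wjoin b ?w 0) * b ^ length ?w"
    have 1: "wjoin b ?w 1 = wjoin b ?w 0 + 1 / b ^ length ?w" using b0 by (subst join_affine) auto
    have "wjoin b ?w y = point t" using b0 by (subst join_affine) (auto simp: y_def)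
    moreover have "0 \<le> y" "y \<le> 1" using point_between[OF t, of q] 1 b0 by (auto simp: y_def field_simps)
    ultimately show ?thesis by metis
  qed
  obtain y where y: "0 \<le> y" "y \<le> 1" "point t = wjoin b (prefix_word t q) y" using ex by blast
  obtain z where z: "0 \<le> z" "z \<le> 1" "point t = wjoin b (prefix_word t (Suc q)) z" using ex by blast
  have "wjoin b (prefix_word t q) y = wjoin b (prefix_word t q) (wjoin b (e (code t q) @ concat (sp q)) z)"
    using y(3) z(3) by (simp add: prefix_word_Suc join_append)
  then have "y = wjoin b (e (code t q) @ concat (sp q)) z"
    using b0 by (subst (asm) (1 2) join_affine) auto
  also have "\<dots> \<le> wjoin b (e (code t q)) 1"
    unfolding join_append using sp z(2)
    by (intro join_mono b0 full_wjoin_le_1 full_concat) blast+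
  also have "\<dots> < 1" using e[OF code_less[OF t]] by blast
  finally show ?thesis using y by blast
qed

lemma point_range: "0 \<le> t \<Longrightarrow> t < 1 \<Longrightarrow> 0 \<le> point t \<and> point t < 1"
  using point_tail[of t 0] by (auto simp: prefix_word_def blocks_def)

lemma digit_word_point:
  assumes t: "0 \<le> t" "t < 1" shows "digit_word b (pos q) (point t) = prefix_word t q"
proof -
  obtain y where y: "0 \<le> y" "y < 1" "point t = wjoin b (prefix_word t q) y" using point_tail[OF t] by blast
  have "fits b (prefix_word t q) y" using full_prefix_word[OF t] y by (intro fullD)
  from digit_word_join[OF b0 this] show ?thesis by (simp only: y(3) length_prefix_word[OF t])
qed

lemma window_sum_eq:
  assumes t: "0 \<le> t" "t < 1" and i: "i + k \<le> pos q"
  shows "digit_sum b (i + k) (point t) - digit_sum b i (point t) = sum_list (take k (drop i (prefix_word t q)))"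
proof -
  have "digit_sum b n (point t) = sum_list (take n (prefix_word t q))" if "n \<le> pos q" for n
    using that by (simp add: digit_word_point[OF t, symmetric] take_digit_word sum_list_digit_word)
  then show ?thesis using i by (simp add: sum_list_take_diff)
qed

lemma window_sum_le:
  assumes t: "0 \<le> t" "t < 1" and i: "i + k \<le> pos q"
  shows "of_int (digit_sum b (i + k) (point t) - digit_sum b i (point t)) \<le> a * real k + 2 * b * real (L q)"
  unfolding window_sum_eq[OF assms] prefix_word_def
proof (rule concat_window_sum)
  show "\<forall>c\<in>set (blocks t q). (\<forall>d\<in>set c. real_of_int d \<le> b) \<and> real_of_int (sum_list c) \<le> a * real (length c) \<and> length c \<le> L q"
    using blocks_full[OF t] fits_digit_le[OF b0 full_fits0] by blast
qed (use a b in auto)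

lemma pos_Suc: "pos (Suc q) = pos q + N + length (concat (sp q))"
  by (simp add: pos_def)

lemma pos_strict_mono: "p < q \<Longrightarrow> pos p < pos q"
  by (rule lift_Suc_mono_less[of pos]) (use N in \<open>auto simp: pos_Suc\<close>)

lemma pos_ge: "q \<le> pos q"
  using N by (induction q) (auto simp: pos_Suc)

lemma sum_special_window:
  assumes t: "0 \<le> t" "t < 1" and k: "k \<le> length (concat (sp q))"
  shows "digit_sum b (pos q + N + k) (point t) - digit_sum b (pos q + N) (point t) = sum_list (take k (concat (sp q)))"
proof -
  have "drop (pos q + N) (prefix_word t (Suc q)) = concat (sp q)"
    using e[OF code_less[OF t, of q]] by (simp add: prefix_word_Suc length_prefix_word[OF t])
  then show ?thesis using window_sum_eq[OF t, of "pos q + N" k "Suc q"] k by (simp add: pos_Suc)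
qed

text \<open>Each coded block has a fixed length and determines its digit, so parameters with equal
  prefixes share their first \<open>q\<close> base \<open>K\<close> digits.\<close>

lemma prefix_word_inj:
  assumes t: "0 \<le> t" "t < 1" and u: "0 \<le> u" "u < 1" and eq: "prefix_word t q = prefix_word u q"
  shows "\<bar>t - u\<bar> \<le> (1 / real K) ^ q"
proof -
  have K0: "0 < real K" using K by simp
  have "prefix_word t q = prefix_word u q \<Longrightarrow> \<forall>i<q. code t i = code u i"
  proof (induction q)
    case (Suc q)
    have "length (prefix_word t q) = length (prefix_word u q)" by (simp add: length_prefix_word t u)
    with Suc.prems have "prefix_word t q = prefix_word u q" "e (code t q) @ concat (sp q) = e (code u q) @ concat (sp q)"
      by (auto simp: prefix_word_Suc)
    moreover from this(2) have "code t q = code u q"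
      using inj_onD[OF inj] code_less t u by auto
    ultimately show ?case using Suc.IH by (auto simp: less_Suc_eq)
  qed simp
  with eq have c: "\<forall>i<q. code t i = code u i" by blast
  have nn: "0 \<le> beta_digit (real K) i t" "0 \<le> beta_digit (real K) i u" for i
    using digit_bounds[OF K0 t] digit_bounds[OF K0 u] by auto
  have dw: "digit_word (real K) q t = digit_word (real K) q u"
    unfolding digit_word_def using c nn by (auto simp: code_def eq_nat_nat_iff)
  let ?w = "digit_word (real K) q t"
  have x: "x = wjoin (real K) (digit_word (real K) q x) 0 + (beta_map (real K) ^^ q) x * (1 / real K) ^ q"
    if "0 \<le> x" "x < 1" for x
  proof -
    have "x = wjoin (real K) (digit_word (real K) q x) ((beta_map (real K) ^^ q) x)"
      using digit_word_fits[OF K0 that, of q] by auto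
    also have "\<dots> = wjoin (real K) (digit_word (real K) q x) 0 + (beta_map (real K) ^^ q) x * (1 / real K) ^ q"
      using K0 by (subst join_affine) (auto simp: power_one_over)
    finally show ?thesis .
  qed
  let ?T = "\<lambda>x. (beta_map (real K) ^^ q) x"
  have "t - u = (?T t - ?T u) * (1 / real K) ^ q"
    using x[OF t] x[OF u] unfolding dw by (simp add: algebra_simps)
  moreover have "\<bar>?T t - ?T u\<bar> \<le> 1"
    using beta_iter_range[OF t, where b = "real K" and n = q] beta_iter_range[OF u, where b = "real K" and n = q] by linarith
  ultimately show ?thesis using K0 by (simp add: abs_mult mult_left_le_one_le)
qed

section \<open>Size of the set of coded points\<close>

lemma prefix_separated:
  assumes t: "0 \<le> t" "t < 1" and u: "0 \<le> u" "u < 1" and ne: "prefix_word t q \<noteq> prefix_word u q"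
  shows "1 / b ^ pos q \<le> \<bar>wjoin b (prefix_word t q) 0 - wjoin b (prefix_word u q) 0\<bar>"
  using assms by (intro full_separated b0 full_prefix_word length_prefix_word) auto

lemma point_offset:
  assumes t: "0 \<le> t" "t < 1"
  shows "0 \<le> point t - wjoin b (prefix_word t q) 0 \<and> point t - wjoin b (prefix_word t q) 0 < 1 / b ^ pos q"
proof -
  obtain y where y: "0 \<le> y" "y < 1" "point t = wjoin b (prefix_word t q) y" using point_tail[OF t] by blast
  have "point t = wjoin b (prefix_word t q) 0 + y / b ^ pos q"
    unfolding y(3) using b0 by (subst join_affine) (auto simp: length_prefix_word[OF t])
  moreover have "y / b ^ pos q < 1 / b ^ pos q" "0 \<le> y / b ^ pos q"
    using y b0 by (auto simp: divide_strict_right_mono)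
  ultimately show ?thesis by auto
qed

text \<open>Half-open intervals of equal length that are disjoint: a set of smaller diameter meets at
  most two of them.\<close>

lemma preimage_cover:
  assumes S: "\<And>x y. x \<in> S \<Longrightarrow> y \<in> S \<Longrightarrow> \<bar>x - y\<bar> < 1 / b ^ pos q"
  shows "\<exists>A. A \<in> sets borel \<and> {t \<in> {0..<1}. point t \<in> S} \<subseteq> A \<and> emeasure lborel A \<le> ennreal (4 * (1 / real K) ^ q)"
proof (cases "{t \<in> {0..<1}. point t \<in> S} = {}")
  case True
  then show ?thesis by (intro exI[of _ "{}"]) auto
next
  case False
  let ?T = "{t \<in> {0..<1}. point t \<in> S}" and ?r = "(1 / real K) ^ q"
  obtain u where u: "u \<in> ?T" using False by blast
  have "\<exists>v\<in>?T. \<forall>t\<in>?T. prefix_word t q = prefix_word u q \<or> prefix_word t q = prefix_word v q"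
  proof (cases "\<exists>v\<in>?T. prefix_word v q \<noteq> prefix_word u q")
    case True
    then obtain v where v: "v \<in> ?T" "prefix_word v q \<noteq> prefix_word u q" by blast
    have "prefix_word t q = prefix_word u q \<or> prefix_word t q = prefix_word v q" if t: "t \<in> ?T" for t
    proof (rule ccontr)
      assume "\<not> ?thesis"
      then have "1 / b ^ pos q \<le> \<bar>wjoin b (prefix_word t q) 0 - wjoin b (prefix_word u q) 0\<bar>"
        "1 / b ^ pos q \<le> \<bar>wjoin b (prefix_word t q) 0 - wjoin b (prefix_word v q) 0\<bar>"
        "1 / b ^ pos q \<le> \<bar>wjoin b (prefix_word v q) 0 - wjoin b (prefix_word u q) 0\<bar>"
        using t u v by (auto intro!: prefix_separated)
      moreover have "\<bar>point t - point u\<bar> < 1 / b ^ pos q" "\<bar>point t - point v\<bar> < 1 / b ^ pos q" "\<bar>point v - point u\<bar> < 1 / b ^ pos q"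
        using S t u v by auto
      \<comment> \<open>Of three left ends that are pairwise \<open>1 / b ^ pos q\<close> apart, the
        extreme two differ by at least twice that; offsets in \<open>[0, 1 / b ^ pos q)\<close>
        cannot bring their points within \<open>1 / b ^ pos q\<close>.\<close>
      ultimately show False
        using point_offset[of t q] point_offset[of u q] point_offset[of v q] t u v by (smt (verit) atLeastLessThan_iff mem_Collect_eq)
    qed
    with v show ?thesis by blast
  qed (use u in blast)
  then obtain v where v: "v \<in> ?T" "\<And>t. t \<in> ?T \<Longrightarrow> prefix_word t q = prefix_word u q \<or> prefix_word t q = prefix_word v q" by blast
  \<comment> \<open>By \<open>prefix_word_inj\<close> the parameters of each of the two prefixes lie
    in an interval of length \<open>2 * ?r\<close>; together they give the constant 4.\<close>
  let ?A = "{u - ?r..u + ?r} \<union> {v - ?r..v + ?r}"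
  have "?T \<subseteq> ?A"
  proof
    fix t assume t: "t \<in> ?T"
    with v(2) have "\<bar>t - u\<bar> \<le> ?r \<or> \<bar>t - v\<bar> \<le> ?r"
      using prefix_word_inj[of t u q] prefix_word_inj[of t v q] u v(1) by auto
    then show "t \<in> ?A" by (auto simp: abs_le_iff)
  qed
  moreover have "emeasure lborel ?A \<le> ennreal (4 * ?r)"
  proof -
    have r: "0 \<le> ?r" by simp
    have "emeasure lborel ?A \<le> emeasure lborel {u - ?r..u + ?r} + emeasure lborel {v - ?r..v + ?r}"
      by (intro emeasure_subadditive) auto
    also have "\<dots> = ennreal (2 * ?r) + ennreal (2 * ?r)" using r by simp
    also have "\<dots> = ennreal (4 * ?r)" using r by (subst ennreal_plus[symmetric]) auto
    finally show ?thesis .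
  qed
  ultimately show ?thesis by (intro exI[of _ ?A]) auto
qed

text \<open>Mass distribution argument, with the mass transported from Lebesgue measure on the
  parameters: a cover of \<open>E\<close> pulls back to a cover of the unit interval, and a set of
  diameter below \<open>d\<close> has its preimage in a Borel set of measure at most
  \<open>4 * d powr s\<close>. In \<open>growth\<close> the position is taken at
  \<open>Suc q\<close> because \<open>d\<close> lies between two consecutive scales.\<close>

lemma hausdorff_measure_image_pos:
  assumes s: "0 < s" "0 \<le> r" "r \<le> s"
    and growth: "\<And>q. q0 \<le> q \<Longrightarrow> s * ln b * real (pos (Suc q)) \<le> real q * ln (real K)"
    and E: "\<And>t. 0 \<le> t \<Longrightarrow> t < 1 \<Longrightarrow> point t \<in> E"
  shows "hausdorff_measure r E \<noteq> 0"
proof -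
  define d0 where "d0 = 1 / b ^ pos q0"
  have d0: "0 < d0" "d0 \<le> 1" using b by (auto simp: d0_def)
  have cover: "\<exists>A. A \<in> sets borel \<and> {t \<in> {0..<1}. point t \<in> S} \<subseteq> A \<and> emeasure lborel A \<le> ennreal (4 * d powr s)"
    if S: "bounded S" "diameter S < d" and d: "d \<le> d0" for S d
  proof -
    have dp: "0 < d" using S diameter_ge_0[OF S(1)] by simp
    have ex: "\<exists>q. 1 / b ^ pos (Suc q) < d"
    proof -
      obtain m where m: "1 / d < b ^ m" using real_arch_pow[OF b] by blast
      have "b ^ m \<le> b ^ pos (Suc m)" using b pos_ge[of "Suc m"] by (intro power_increasing) auto
      with m have "1 / d < b ^ pos (Suc m)" by linarith
      then have "1 / b ^ pos (Suc m) < d" using dp b0 by (simp add: field_simps)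
      then show ?thesis by blast
    qed
    \<comment> \<open>Minimality, or \<open>d \<le> d0\<close> if \<open>q = q0\<close>, gives
      \<open>1 / b ^ pos (Suc q) < d\<close> and \<open>d \<le> 1 / b ^ pos q\<close>.\<close>
    define q where "q = (LEAST q. 1 / b ^ pos (Suc q) < d)"
    have q1: "1 / b ^ pos (Suc q) < d" unfolding q_def by (rule LeastI_ex[OF ex])
    have q0: "q0 \<le> q"
    proof (rule ccontr)
      assume "\<not> q0 \<le> q"
      then have "Suc q \<le> q0" by simp
      then have "pos (Suc q) \<le> pos q0" using pos_strict_mono[of "Suc q" q0] by (cases "Suc q = q0") auto
      then have "b ^ pos (Suc q) \<le> b ^ pos q0" using b by (intro power_increasing) auto
      then have "d0 \<le> 1 / b ^ pos (Suc q)" using b0 by (auto simp: d0_def intro: divide_left_mono)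
      with q1 d show False by simp
    qed
    have q2: "d \<le> 1 / b ^ pos q"
    proof (cases "q = q0")
      case True
      with d show ?thesis by (simp add: d0_def)
    next
      case False
      with q0 obtain p where p: "q = Suc p" by (cases q) auto
      then have "\<not> 1 / b ^ pos (Suc p) < d" 
        using not_less_Least[of p "\<lambda>q. 1 / b ^ pos (Suc q) < d", folded q_def] by simp
      with p show ?thesis by simp
    qed
    have "\<bar>x - y\<bar> < 1 / b ^ pos q" if "x \<in> S" "y \<in> S" for x y
      using diameter_bounded_bound[OF S(1) that] S(2) q2 by (simp add: dist_real_def)
    from preimage_cover[OF this] obtain A where A: "A \<in> sets borel" "{t \<in> {0..<1}. point t \<in> S} \<subseteq> A" "emeasure lborel A \<le> ennreal (4 * (1 / real K) ^ q)"
      by blast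
    have K0: "0 < real K" using K by simp
    have "(1 / real K) ^ q = exp (- (real q * ln (real K)))"
      using K0 by (simp only: exp_minus exp_of_nat_mult exp_ln) (simp add: divide_inverse power_inverse)
    also have "\<dots> \<le> exp (- (s * ln b * real (pos (Suc q))))" using growth[OF q0] by simp
    also have "\<dots> = (1 / b ^ pos (Suc q)) powr s"
      using b0 by (simp add: powr_def ln_div ln_realpow algebra_simps)
    also have "\<dots> \<le> d powr s" using q1 s b0 by (intro powr_mono2) auto
    finally have "ennreal (4 * (1 / real K) ^ q) \<le> ennreal (4 * d powr s)" by (intro ennreal_leI) simp
    with A show ?thesis by (meson order_trans)
  qed
  have low: "ennreal (1 / 8) \<le> (\<Sum>i. hausdorff_gauge r (U i))"
    if U: "E \<subseteq> (\<Union>i. U i)" "\<And>i. bounded (U i) \<and> diameter (U i) \<le> d0 / 2" for U :: "nat \<Rightarrow> real set"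
  proof -
    \<comment> \<open>The slacks sum to 1/8, so that the total mass 1, being at most 4 times the
      gauges plus slacks, leaves at least 1/8 for the gauges.\<close>
    define \<epsilon> where "\<epsilon> i = (1 / 2) ^ i / (16 :: real)" for i :: nat
    have "\<exists>A. A \<in> sets borel \<and> {t \<in> {0..<1}. point t \<in> U i} \<subseteq> A \<and> emeasure lborel A \<le> 4 * (hausdorff_gauge r (U i) + ennreal (\<epsilon> i))" for i
    proof (cases "U i = {}")
      case True
      then show ?thesis by (intro exI[of _ "{}"]) auto
    next
      case False
      let ?g = "diameter (U i)"
      have g: "0 \<le> ?g" "?g \<le> d0 / 2" using U(2) by (auto intro: diameter_ge_0)
      have eps: "0 < \<epsilon> i" by (simp add: \<epsilon>_def)
      \<comment> \<open>\<open>cover\<close> wants a strict bound on the diameter, which may be 0;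
        the slack provides a \<open>d\<close> above it with \<open>d powr s\<close> at most
        \<open>?g powr s + \<epsilon> i\<close>.\<close>
      define d where "d = min d0 ((?g powr s + \<epsilon> i) powr (1 / s))"
      have "?g < (?g powr s + \<epsilon> i) powr (1 / s)"
      proof -
        have "?g = (?g powr s) powr (1 / s)" using s(1) g(1) by (cases "?g = 0") (auto simp: powr_powr)
        also have "\<dots> < (?g powr s + \<epsilon> i) powr (1 / s)" using s(1) eps by (intro powr_less_mono2) auto
        finally show ?thesis .
      qed
      moreover have "?g < d0" using g d0 by linarith
      ultimately have d: "?g < d" "d \<le> d0" by (auto simp: d_def)
      obtain A where A: "A \<in> sets borel" "{t \<in> {0..<1}. point t \<in> U i} \<subseteq> A" "emeasure lborel A \<le> ennreal (4 * d powr s)"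
        using cover[OF _ d] U(2) by blast
      have "d powr s \<le> ((?g powr s + \<epsilon> i) powr (1 / s)) powr s"
        using s(1) d g by (intro powr_mono2) (auto simp: d_def)
      also have "\<dots> = ?g powr s + \<epsilon> i" using s(1) eps by (simp add: powr_powr add_nonneg_pos)
      finally have "ennreal (4 * d powr s) \<le> ennreal (4 * (?g powr s + \<epsilon> i))" by (intro ennreal_leI) simp
      also have "\<dots> = 4 * (ennreal (?g powr s) + ennreal (\<epsilon> i))"
        using eps by (simp add: ennreal_mult)
      also have "ennreal (?g powr s) \<le> hausdorff_gauge r (U i)"
      proof (cases "r = 0")
        case True
        have "?g powr s \<le> 1" using g d0 s by (intro powr_le1) auto
        with True False show ?thesis by (simp add: hausdorff_gauge_def)
      next
        case r0: False
        have "?g powr s \<le> ?g powr r"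
          using g d0 s by (cases "?g = 0") (auto intro: powr_mono')
        with r0 False show ?thesis by (auto simp: hausdorff_gauge_def intro: ennreal_leI)
      qed
      finally have "ennreal (4 * d powr s) \<le> 4 * (hausdorff_gauge r (U i) + ennreal (\<epsilon> i))"
        by (simp add: add_right_mono mult_left_mono)
      with A show ?thesis by (meson order_trans)
    qed
    then have "\<forall>i. \<exists>A. A \<in> sets borel \<and> {t \<in> {0..<1}. point t \<in> U i} \<subseteq> A
        \<and> emeasure lborel A \<le> 4 * (hausdorff_gauge r (U i) + ennreal (\<epsilon> i))" by (rule allI)
    from choice[OF this] obtain A where A: "\<And>i. A i \<in> sets borel" "\<And>i. {t \<in> {0..<1}. point t \<in> U i} \<subseteq> A i"
      "\<And>i. emeasure lborel (A i) \<le> 4 * (hausdorff_gauge r (U i) + ennreal (\<epsilon> i))" by blast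
    have "{0..<1} \<subseteq> (\<Union>i. A i)"
    proof
      fix t :: real assume t: "t \<in> {0..<1}"
      then have "point t \<in> E" using E by auto
      then obtain i where "point t \<in> U i" using U(1) by blast
      with t A(2)[of i] show "t \<in> (\<Union>i. A i)" by blast
    qed
    then have "emeasure lborel {0..<1::real} \<le> emeasure lborel (\<Union>i. A i)"
      using A(1) by (intro emeasure_mono) auto
    also have "\<dots> \<le> (\<Sum>i. emeasure lborel (A i))" using A(1) by (intro emeasure_subadditive_countably) auto
    also have "\<dots> \<le> (\<Sum>i. 4 * (hausdorff_gauge r (U i) + ennreal (\<epsilon> i)))"
      using A(3) by (intro suminf_le) auto
    also have "\<dots> = 4 * ((\<Sum>i. hausdorff_gauge r (U i)) + (\<Sum>i. ennreal (\<epsilon> i)))"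
      by (simp only: ennreal_suminf_cmult suminf_add[OF summableI summableI, symmetric])
    also have "(\<Sum>i. ennreal (\<epsilon> i)) = ennreal (1 / 8)"
    proof -
      have "\<epsilon> sums (2 / 16)"
        unfolding \<epsilon>_def using sums_divide[OF geometric_sums[of "1 / 2 :: real"], of 16] by simp
      then show ?thesis by (subst suminf_ennreal_eq[of \<epsilon>]) (auto simp: \<epsilon>_def)
    qed
    finally have "1 \<le> 4 * ((\<Sum>i. hausdorff_gauge r (U i)) + ennreal (1 / 8))" by simp
    then show ?thesis
    proof (cases "(\<Sum>i. hausdorff_gauge r (U i))" rule: ennreal_cases)
      case (real x)
      have "ennreal (4 * (x + 1 / 8)) = ennreal 4 * ennreal (x + 1 / 8)"
        using real(1) by (intro ennreal_mult) auto
      also have "\<dots> = 4 * (ennreal x + ennreal (1 / 8))" using real(1) by (subst ennreal_plus) auto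
      finally have "ennreal 1 \<le> ennreal (4 * (x + 1 / 8))"
        using \<open>1 \<le> 4 * ((\<Sum>i. hausdorff_gauge r (U i)) + ennreal (1 / 8))\<close>
        by (simp only: real(2) ennreal_1)
      then have "1 \<le> 4 * (x + 1 / 8)" using real(1) by (subst (asm) ennreal_le_iff) auto
      then show ?thesis using real by (auto intro: ennreal_leI)
    qed simp
  qed
  have "ennreal (1 / 8) \<le> hausdorff_premeasure r (d0 / 2) E"
    unfolding hausdorff_premeasure_def by (intro INF_greatest low) auto
  also have "\<dots> \<le> hausdorff_measure r E"
    unfolding hausdorff_measure_def using d0 by (intro SUP_upper) auto
  finally show ?thesis by auto
qed

end

section \<open>Hausdorff dimension: lower bound\<close>

text \<open>From some index on, one step multiplies \<open>f\<close> by at most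
  \<open>1 / (1 - 1 / (2 * (n + 1)))\<close>, and the square root grows at least by this factor.
  Hence \<open>f\<close> is bounded by a multiple of the square root.\<close>

lemma slowly_varying_sublinear:
  assumes "slowly_varying \<theta>"
  shows "(\<lambda>n. \<theta> n / real n) \<longlonglongrightarrow> 0"
proof -
  obtain f K where f: "\<And>n. 1 \<le> n \<Longrightarrow> 0 < f n" and r: "(\<lambda>n. \<theta> n / f n) \<longlonglongrightarrow> K"
    and g: "(\<lambda>n. real n * (1 - f (n - 1) / f n)) \<longlonglongrightarrow> 0"
    using assms unfolding slowly_varying_def by blast
  have "eventually (\<lambda>n. real n * (1 - f (n - 1) / f n) < 1 / 2) sequentially"
    using order_tendstoD(2)[OF g, of "1 / 2"] by simp
  then obtain n0 where n0: "\<And>n. n0 \<le> n \<Longrightarrow> real n * (1 - f (n - 1) / f n) < 1 / 2"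
    unfolding eventually_sequentially by blast
  define m where "m = max 1 n0"
  define C where "C = f m / sqrt (real m)"
  have m: "1 \<le> m" "n0 \<le> m" by (auto simp: m_def)
  have C: "0 < C" using f[OF m(1)] m by (simp add: C_def)
  have bound: "f n \<le> C * sqrt (real n)" if "m \<le> n" for n
    using that
  proof (induction n rule: dec_induct)
    case base
    show ?case using m by (simp add: C_def)
  next
    case (step n)
    define c where "c = 1 - 1 / (2 * real (Suc n))"
    have c: "0 < c" by (simp add: c_def)
    have fp: "0 < f (Suc n)" using f by simp
    have "real (Suc n) * (1 - f n / f (Suc n)) < 1 / 2" using n0[of "Suc n"] step m by simp
    then have "1 - f n / f (Suc n) < 1 / 2 / real (Suc n)" by (subst pos_less_divide_eq) (auto simp: mult.commute)
    then have "c < f n / f (Suc n)" by (simp add: c_def)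
    then have 1: "f (Suc n) * c \<le> f n" using fp by (simp add: pos_less_divide_eq mult.commute)
    have "x * (1 - 1 / (2 * x))\<^sup>2 = x - 1 + 1 / (4 * x)" if "0 < x" for x :: real
      using that by (simp add: power2_eq_square field_simps)
    from this[of "real (Suc n)"] have "real (Suc n) * c\<^sup>2 = real n + 1 / (4 * real (Suc n))"
      unfolding c_def by simp
    then have "real n \<le> real (Suc n) * c\<^sup>2" by simp
    then have "sqrt (real n) \<le> sqrt (real (Suc n) * c\<^sup>2)" by (rule real_sqrt_le_mono)
    also have "\<dots> = sqrt (real (Suc n)) * c" using c by (simp add: real_sqrt_mult)
    finally have "C * sqrt (real n) \<le> C * sqrt (real (Suc n)) * c" using C by simp
    with 1 step.IH have "f (Suc n) * c \<le> C * sqrt (real (Suc n)) * c" by linarith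
    then show ?case using c by (simp only: mult_le_cancel_right_pos)
  qed
  have "(\<lambda>n. f n / real n) \<longlonglongrightarrow> 0"
  proof (rule Lim_null_comparison)
    show "eventually (\<lambda>n. norm (f n / real n) \<le> C / sqrt (real n)) sequentially"
      using eventually_ge_at_top[of m]
    proof eventually_elim
      case (elim n)
      have n: "0 < real n" using elim m by simp
      have "norm (f n / real n) \<le> C * sqrt (real n) / real n"
        using bound[OF elim] f[of n] elim m n by (simp add: divide_right_mono)
      also have "\<dots> = C / sqrt (real n)" using n by (simp add: field_simps real_div_sqrt)
      finally show ?case .
    qed
    show "(\<lambda>n. C / sqrt (real n)) \<longlonglongrightarrow> 0" by real_asymp
  qed
  from tendsto_mult[OF r this] have "(\<lambda>n. \<theta> n / f n * (f n / real n)) \<longlonglongrightarrow> 0" by simp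
  moreover have "eventually (\<lambda>n. \<theta> n / f n * (f n / real n) = \<theta> n / real n) sequentially"
    using eventually_ge_at_top[of 1] by eventually_elim (use f in fastforce)
  ultimately show ?thesis by (rule Lim_transform_eventually)
qed

text \<open>The words whose means approach \<open>a\<close> may be arbitrarily long. Advancing their
  index slowly enough keeps the length of the word in use small compared with
  \<open>\<phi>\<close>.\<close>

lemma slow_index:
  fixes l \<phi> :: "nat \<Rightarrow> nat"
  assumes inf: "filterlim \<phi> at_top sequentially"
  shows "\<exists>j L. mono L \<and> N \<le> L 0 \<and> filterlim j at_top sequentially \<and> (\<forall>i. l (j i) \<le> L i) \<and>
    (\<lambda>n. real (L n) / real (\<phi> n)) \<longlonglongrightarrow> 0"
proof -
  define l' where "l' J = N + (\<Sum>i\<le>J. l i)" for J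
  have l': "l J \<le> l' J" "N \<le> l' J" for J
    using member_le_sum[of J "{..J}" l] by (auto simp: l'_def)
  have ml: "J \<le> J' \<Longrightarrow> l' J \<le> l' J'" for J J' unfolding l'_def by (intro add_left_mono sum_mono2) auto
  \<comment> \<open>\<open>\<phi>\<close> need not be monotone, so the bound is required for all
    \<open>m \<ge> i\<close>, which makes \<open>S\<close> increasing. The factor
    \<open>J + 1\<close> is what bounds the quotient by \<open>1 / j n\<close>; inserting 0 keeps
    \<open>S i\<close> nonempty.\<close>
  define S where "S i = insert 0 {J. J \<le> i \<and> (\<forall>m\<ge>i. (J + 1) * l' J \<le> \<phi> m)}" for i
  define j where "j i = Max (S i)" for i
  have fin: "finite (S i)" for i by (rule finite_subset[of _ "{..i}"]) (auto simp: S_def)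
  have jS: "j i \<in> S i" for i unfolding j_def by (intro Max_in fin) (simp add: S_def)
  have ge: "J \<le> j i" if "J \<in> S i" for J i unfolding j_def using fin that by (intro Max_ge)
  have mj: "j i \<le> j i'" if "i \<le> i'" for i i'
  proof -
    have "S i \<subseteq> S i'" using that by (auto simp: S_def)
    then show ?thesis using jS[of i] by (intro ge) blast
  qed
  have inf_j: "filterlim j at_top sequentially"
    unfolding filterlim_at_top
  proof
    fix J
    have "eventually (\<lambda>m. (J + 1) * l' J \<le> \<phi> m) sequentially" using inf unfolding filterlim_at_top by blast
    then obtain m0 where m0: "\<And>m. m0 \<le> m \<Longrightarrow> (J + 1) * l' J \<le> \<phi> m" unfolding eventually_sequentially by blast
    show "eventually (\<lambda>i. J \<le> j i) sequentially"
      using eventually_ge_at_top[of "max J m0"]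
    proof eventually_elim
      case (elim i)
      then have "J \<in> S i" using m0 by (auto simp: S_def)
      then show ?case by (rule ge)
    qed
  qed
  have "(\<lambda>n. real (l' (j n)) / real (\<phi> n)) \<longlonglongrightarrow> 0"
  proof (rule Lim_null_comparison)
    show "eventually (\<lambda>n. norm (real (l' (j n)) / real (\<phi> n)) \<le> 1 / real (j n)) sequentially"
      using inf_j[unfolded filterlim_at_top, rule_format, of 1] inf[unfolded filterlim_at_top, rule_format, of 1]
    proof eventually_elim
      case (elim n)
      then have "(j n + 1) * l' (j n) \<le> \<phi> n" using jS[of n] by (auto simp: S_def)
      then have "j n * l' (j n) \<le> \<phi> n" by simp
      then have "real (j n) * real (l' (j n)) \<le> real (\<phi> n)" by (simp flip: of_nat_mult)
      then show ?case using elim by (simp add: field_simps)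
    qed
    have "filterlim (\<lambda>n. real (j n)) at_top sequentially"
      using filterlim_compose[OF filterlim_real_sequentially inf_j] .
    then show "(\<lambda>n. 1 / real (j n)) \<longlonglongrightarrow> 0" by (intro real_tendsto_divide_at_top) auto
  qed
  moreover have "mono (\<lambda>i. l' (j i))" by (intro monoI ml mj)
  ultimately have "mono (\<lambda>i. l' (j i)) \<and> N \<le> l' (j 0) \<and> filterlim j at_top sequentially \<and>
    (\<forall>i. l (j i) \<le> l' (j i)) \<and> (\<lambda>n. real (l' (j n)) / real (\<phi> n)) \<longlonglongrightarrow> 0"
    using l' inf_j by blast
  then show ?thesis by - (rule exI[where x = j], rule exI[where x = "\<lambda>i. l' (j i)"], simp)
qed

lemma Max_image_sublinear:
  fixes \<phi> :: "nat \<Rightarrow> nat"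
  assumes sub: "(\<lambda>n. real (\<phi> n) / real n) \<longlonglongrightarrow> 0" and e: "0 < e"
  shows "eventually (\<lambda>i. real (Max (\<phi> ` {..M * i})) \<le> e * real i) sequentially"
proof -
  have e': "0 < e / (real M + 1)" using e by simp
  obtain n0 where n0: "\<And>n. n0 \<le> n \<Longrightarrow> real (\<phi> n) / real n < e / (real M + 1)"
    using order_tendstoD(2)[OF sub e'] unfolding eventually_sequentially by blast
  define B where "B = Max (\<phi> ` {..max 1 n0})"
  show ?thesis using eventually_ge_at_top[of "nat \<lceil>real B / e\<rceil>"]
  proof eventually_elim
    case (elim i)
    then have "real B / e \<le> real i" by linarith
    then have Bi: "real B \<le> e * real i" using e by (simp add: field_simps)
    have "real (\<phi> m) \<le> e * real i" if m: "m \<le> M * i" for m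
    proof (cases "m \<le> max 1 n0")
      case True
      then have "\<phi> m \<le> B" unfolding B_def by (intro Max_ge) auto
      with Bi show ?thesis by linarith
    next
      case False
      then have m0: "0 < real m" "n0 \<le> m" by auto
      then have "real (\<phi> m) \<le> e / (real M + 1) * real m" using n0[of m] by (simp add: pos_divide_less_eq)
      also have "\<dots> \<le> e / (real M + 1) * ((real M + 1) * real i)"
      proof (intro mult_left_mono)
        have "real m \<le> real M * real i" using m by (metis of_nat_le_iff of_nat_mult)
        then show "real m \<le> (real M + 1) * real i" by (simp add: algebra_simps)
      qed (use e in simp)
      also have "\<dots> = e * real i" by simp
      finally show ?thesis .
    qed
    moreover have "Max (\<phi> ` {..M * i}) \<in> \<phi> ` {..M * i}" by (intro Max_in) auto
    then obtain m where "Max (\<phi> ` {..M * i}) = \<phi> m" "m \<le> M * i" by blast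
    ultimately show ?case by simp
  qed
qed

text \<open>Makes runs of length \<open>o(i)\<close>, inserted only at powers of two
  \<open>i\<close>, a set of positions of density zero.\<close>

lemma sum_powers_of_two_le:
  "(\<Sum>i<q. if \<exists>p. i = 2 ^ p then real i else 0) \<le> 2 * real q"
proof (cases "q = 0")
  case False
  define P where "P = (LEAST P. q \<le> 2 ^ P)"
  have ex: "\<exists>P. q \<le> 2 ^ P" using less_exp[of q] by (intro exI[of _ q]) simp
  have P: "q \<le> 2 ^ P" unfolding P_def by (rule LeastI_ex[OF ex])
  have P2: "2 ^ p < q" if "p < P" for p
    using not_less_Least[of p "\<lambda>P. q \<le> 2 ^ P", folded P_def] that by simp
  have set: "{i \<in> {..<q}. \<exists>p. i = 2 ^ p} = (\<lambda>p. 2 ^ p) ` {..<P}"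
  proof (intro set_eqI iffI)
    fix i assume "i \<in> {i \<in> {..<q}. \<exists>p. i = 2 ^ p}"
    then obtain p where p: "i = 2 ^ p" "2 ^ p < q" by auto
    have "p < P"
    proof (rule ccontr)
      assume "\<not> p < P"
      then have "(2::nat) ^ P \<le> 2 ^ p" by (intro power_increasing) auto
      with P p show False by simp
    qed
    with p show "i \<in> (\<lambda>p. 2 ^ p) ` {..<P}" by blast
  qed (use P2 in auto)
  have "(\<Sum>i<q. if \<exists>p. i = 2 ^ p then real i else 0) = (\<Sum>i\<in>{i \<in> {..<q}. \<exists>p. i = 2 ^ p}. real i)"
    by (rule sum.inter_filter[symmetric]) simp
  also have "\<dots> = (\<Sum>p<P. 2 ^ p)"
    unfolding set by (subst sum.reindex) (auto simp: inj_on_def)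
  also have "\<dots> = 2 ^ P - 1" using geometric_sum[of "2 :: real" P] by simp
  also have "\<dots> \<le> 2 * real q"
  proof (cases P)
    case (Suc p)
    have "2 ^ p < q" using P2[of p] Suc by simp
    then have "(2::real) ^ p \<le> real q" by (metis less_imp_le of_nat_le_iff of_nat_numeral of_nat_power)
    then show ?thesis unfolding Suc power_Suc by linarith
  qed simp
  finally show ?thesis .
qed simp

text \<open>\<open>\<sigma>\<close> is the exponential rate of the free blocks \<open>W\<close>,
  whose source is left open so that the same construction yields the entropy and the value
  1.\<close>

lemma ER_set_dim_ge:
  fixes \<phi> :: "nat \<Rightarrow> nat"
  assumes b: "1 < b" and apos: "0 < a" and ra: "rich b a 0"
    and inf: "filterlim \<phi> at_top sequentially" and sub: "(\<lambda>n. real (\<phi> n) / real n) \<longlonglongrightarrow> 0"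
    and c: "1 \<le> c" "c < b" and N: "1 \<le> N" and W: "finite W"
    "\<And>w. w \<in> W \<Longrightarrow> length w = N \<and> full c w \<and> of_int (sum_list w) \<le> a * real N"
    and card: "b powr (\<sigma> * real N) \<le> real (card W)"
  shows "ereal \<sigma> \<le> hausdorff_dim (ER_set b \<phi> a)"
proof (cases "\<sigma> \<le> 0")
  case True
  then have "ereal \<sigma> \<le> 0" by simp
  then show ?thesis using hausdorff_dim_nonneg by (rule order_trans)
next
  case False
  then have \<sigma>: "0 < \<sigma>" by simp
  have b0: "0 < b" using b by simp
  define K where "K = card W"
  have "1 < b powr (\<sigma> * real N)" using b \<sigma> N by (intro gr_one_powr) auto
  with card have K: "1 < K" by (simp add: K_def)
  obtain e where "bij_betw e {0..<K} W" using ex_bij_betw_nat_finite[OF W(1)] by (auto simp: K_def)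
  then have e: "inj_on e {..<K}" "\<And>j. j < K \<Longrightarrow> e j \<in> W" by (auto simp: bij_betw_def atLeast0LessThan)
  \<comment> \<open>The words for the runs. Exponent 0 suffices, as one word for each
    \<open>j\<close> is wanted.\<close>
  have "\<exists>v. full b v \<and> 0 < length v \<and> (a - 1 / real (Suc j)) * real (length v) \<le> of_int (sum_list v)
      \<and> of_int (sum_list v) \<le> a * real (length v)" for j
  proof -
    have h: "0 < 1 / real (Suc j)" by simp
    obtain c' V M where V: "1 \<le> c'" "c' < b" "1 \<le> M" "b powr ((0 - 1 / real (Suc j)) * real M) \<le> real (card V)"
      "\<forall>w\<in>V. length w = M \<and> full c' w \<and> (a - 1 / real (Suc j)) * real M \<le> of_int (sum_list w) \<and> of_int (sum_list w) \<le> a * real M"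
      using rich_below[OF b ra apos h] by blast
    have "0 < b powr ((0 - 1 / real (Suc j)) * real M)" using b by simp
    with V(4) have "0 < card V" by linarith
    then obtain v where v: "v \<in> V" by (metis card_gt_0_iff ex_in_conv)
    have "full b v" using V(1,2,5) v full_mono_base[of c' b v] by auto
    with V(3,5) v show ?thesis by (intro exI[of _ v]) auto
  qed
  then obtain v where v: "\<And>j. full b (v j)" "\<And>j. 0 < length (v j)"
    "\<And>j. (a - 1 / real (Suc j)) * real (length (v j)) \<le> of_int (sum_list (v j))"
    "\<And>j. of_int (sum_list (v j)) \<le> a * real (length (v j))" by metis
  obtain j L where jL: "mono L" "N \<le> L 0" "filterlim j at_top sequentially" "\<And>i. length (v (j i)) \<le> L i"
    "(\<lambda>n. real (L n) / real (\<phi> n)) \<longlonglongrightarrow> 0"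
    using slow_index[OF inf, of N "\<lambda>j. length (v j)"] by blast
  define u where "u i = v (j i)" for i
  \<comment> \<open>For given \<open>n\<close>, the run at the least power of two \<open>i\<close>
    with \<open>n < 8 * N * i\<close> will be used, so it must accommodate every
    \<open>\<phi> m\<close> with \<open>m \<le> 8 * N * i\<close>. By minimality
    \<open>4 * N * i \<le> n\<close>, and \<open>pos (Suc i) \<le> 4 * N * i\<close> puts the run
    among the first \<open>n\<close> digits.\<close>
  define R where "R i = Max (\<phi> ` {..8 * N * i})" for i
  define pow2 where "pow2 i \<longleftrightarrow> (\<exists>p. i = 2 ^ p)" for i :: nat
  \<comment> \<open>The extra copy makes up for the rounding in \<open>div\<close>, so that the run
    has length at least \<open>R i\<close>.\<close>
  define sp where "sp i = (if pow2 i then replicate (R i div length (u i) + 1) (u i) else [])" for i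
  have len_sp: "length (concat (sp i)) \<le> (if pow2 i then R i + L i else 0)"
    and sp_len: "pow2 i \<Longrightarrow> R i \<le> length (concat (sp i))" for i
  proof -
    have "length (concat (replicate r w)) = r * length w" for r and w :: "int list" by (induction r) auto
    moreover define d where "d = R i div length (u i)"
    moreover obtain m where "R i = d * length (u i) + m" "m < length (u i)"
      using v(2)[of "j i"] unfolding d_def u_def by (metis div_mult_mod_eq mod_less_divisor)
    moreover have "length (u i) \<le> L i" using jL(4) by (simp add: u_def)
    ultimately show "length (concat (sp i)) \<le> (if pow2 i then R i + L i else 0)"
      and "pow2 i \<Longrightarrow> R i \<le> length (concat (sp i))"
      unfolding sp_def d_def[symmetric] by auto
  qed
  interpret block_coding b a N K e sp L
  proof
    show "length (e i) = N \<and> full b (e i) \<and> wjoin b (e i) 1 < 1 \<and> of_int (sum_list (e i)) \<le> a * real N" if "i < K" for i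
    proof -
      have "length (e i) = N" "full c (e i)" "of_int (sum_list (e i)) \<le> a * real N" using W(2) e(2)[OF that] by auto
      moreover have "e i \<noteq> []" using calculation(1) N by auto
      ultimately show ?thesis
        using c full_mono_base[of c b "e i"] full_wjoin_1_less[of c b "e i"] by auto
    qed
    show "full b w \<and> of_int (sum_list w) \<le> a * real (length w) \<and> length w \<le> L i" if "w \<in> set (sp i)" for w i
      using that v jL(4) by (auto simp: sp_def u_def split: if_splits)
  qed (use b apos N K e jL in auto)
  have ev\<phi>: "eventually (\<lambda>n. 1 \<le> \<phi> n) sequentially" using inf unfolding filterlim_at_top by blast
  \<comment> \<open>Free blocks use \<open>N\<close> digits per step; up to a constant, the runs add
    at most \<open>\<epsilon> * q\<close> in total.\<close>
  have growth: "\<exists>C. \<forall>q. real (pos q) \<le> (real N + \<epsilon>) * real q + C" if \<epsilon>: "0 < \<epsilon>" for \<epsilon>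
  proof -
    have "0 < \<epsilon> / 4" using \<epsilon> by simp
    note Max_image_sublinear[OF sub this, of "8 * N"] Max_image_sublinear[OF sub this, of 1]
    then have "eventually (\<lambda>i. real (R i + L i) \<le> \<epsilon> / 2 * real i) sequentially"
      using order_tendstoD(2)[OF jL(5) zero_less_one] ev\<phi>
    proof eventually_elim
      case (elim i)
      have "real (L i) \<le> real (\<phi> i)" using elim(3,4) by (simp add: divide_less_eq_1)
      also have "\<dots> \<le> real (Max (\<phi> ` {..1 * i}))" by (intro of_nat_mono Max_ge) auto
      finally show ?case using elim(1,2) by (simp add: R_def)
    qed
    then obtain i0 where i0: "\<And>i. i0 \<le> i \<Longrightarrow> real (R i + L i) \<le> \<epsilon> / 2 * real i"
      unfolding eventually_sequentially by blast
    let ?l = "\<lambda>i. real (length (concat (sp i)))"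
    have "real (pos q) \<le> (real N + \<epsilon>) * real q + (\<Sum>i<i0. ?l i)" for q
    proof -
      have "(\<Sum>i<q. ?l i) \<le> (\<Sum>i<q. (if i < i0 then ?l i else 0) + \<epsilon> / 2 * (if pow2 i then real i else 0))"
      proof (rule sum_mono)
        fix i
        show "?l i \<le> (if i < i0 then ?l i else 0) + \<epsilon> / 2 * (if pow2 i then real i else 0)"
        proof (cases "i < i0")
          case True
          then show ?thesis using \<epsilon> by simp
        next
          case False
          have "?l i \<le> real (if pow2 i then R i + L i else 0)" using len_sp by (rule of_nat_mono)
          also have "\<dots> \<le> \<epsilon> / 2 * (if pow2 i then real i else 0)" using i0[of i] False by simp
          finally show ?thesis using False by simp
        qed
      qed
      also have "\<dots> = (\<Sum>i<q. if i < i0 then ?l i else 0) + \<epsilon> / 2 * (\<Sum>i<q. if pow2 i then real i else 0)"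
        by (simp add: sum.distrib sum_distrib_left)
      also have "\<dots> \<le> (\<Sum>i<i0. ?l i) + \<epsilon> / 2 * (2 * real q)"
      proof (intro add_mono mult_left_mono)
        have "(\<Sum>i<q. if i < i0 then ?l i else 0) = (\<Sum>i\<in>{i \<in> {..<q}. i < i0}. ?l i)"
          by (rule sum.inter_filter[symmetric]) simp
        also have "\<dots> \<le> (\<Sum>i<i0. ?l i)" by (intro sum_mono2) auto
        finally show "(\<Sum>i<q. if i < i0 then ?l i else 0) \<le> (\<Sum>i<i0. ?l i)" .
        show "(\<Sum>i<q. if pow2 i then real i else 0) \<le> 2 * real q"
          unfolding pow2_def by (rule sum_powers_of_two_le)
      qed (use \<epsilon> in simp)
      finally show ?thesis by (simp add: pos_def sum.distrib algebra_simps)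
    qed
    then show ?thesis by blast
  qed
  have point_ER: "point t \<in> ER_set b \<phi> a" if t: "0 \<le> t" "t < 1" for t
  proof -
    have "0 < (1::real) / 2" by simp
    from growth[OF this] obtain C where C: "\<And>q. real (pos q) \<le> (real N + 1 / 2) * real q + C" by blast
    have "(\<lambda>n. ER_average b n (\<phi> n) (point t)) \<longlonglongrightarrow> a"
    proof (rule LIMSEQ_I)
      fix \<epsilon> :: real assume \<epsilon>: "0 < \<epsilon>"
      have "filterlim (\<lambda>i. real (Suc (j i))) at_top sequentially"
        using filterlim_compose[OF filterlim_real_sequentially filterlim_compose[OF filterlim_Suc jL(3)]] .
      then have "(\<lambda>i. 1 / real (Suc (j i))) \<longlonglongrightarrow> 0" by (intro real_tendsto_divide_at_top) auto
      from order_tendstoD(2)[OF this, of "\<epsilon> / 2"] \<epsilon>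
      obtain i1 where i1: "\<And>i. i1 \<le> i \<Longrightarrow> 1 / real (Suc (j i)) < \<epsilon> / 2"
        unfolding eventually_sequentially by auto
      define M where "M = max (max 1 i1) (nat \<lceil>C\<rceil>)"
      have "0 < min (\<epsilon> / (2 * b)) (\<epsilon> / (2 * a))" using \<epsilon> b apos by simp
      note ev = order_tendstoD(2)[OF jL(5) this] order_tendstoD(2)[OF sub zero_less_one]
      have "eventually (\<lambda>n. \<bar>ER_average b n (\<phi> n) (point t) - a\<bar> < \<epsilon>) sequentially"
        using ev ev\<phi> eventually_ge_at_top[of "8 * N * M"]
      proof eventually_elim
        case (elim n)
        define k where "k = \<phi> n"
        have k: "0 < k" using elim by (simp add: k_def)
        have "0 < 8 * N * M" using N by (intro mult_pos_pos) (auto simp: M_def)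
        then have n: "0 < n" using elim(4) by linarith
        have kn: "k \<le> n" using elim(2) n by (simp add: k_def)
        have Lk: "2 * b * real (L n) < \<epsilon> * real k" "2 * a * real (L n) < \<epsilon> * real k"
          using elim(1) k b apos by (auto simp: k_def field_simps)
        have "Max ((\<lambda>i. digit_sum b (i + k) (point t) - digit_sum b i (point t)) ` {0..n - k})
            \<in> (\<lambda>i. digit_sum b (i + k) (point t) - digit_sum b i (point t)) ` {0..n - k}"
          by (intro Max_in) auto
        then obtain i where "Max ((\<lambda>i. digit_sum b (i + k) (point t) - digit_sum b i (point t)) ` {0..n - k})
            = digit_sum b (i + k) (point t) - digit_sum b i (point t)" "i \<in> {0..n - k}" by (rule imageE)
        then have i: "i \<le> n - k" "ER_average b n k (point t) =
            of_int (digit_sum b (i + k) (point t) - digit_sum b i (point t)) / real k"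
          by (simp_all only: ER_average_def atLeastAtMost_iff)
        \<comment> \<open>All blocks have mean at most \<open>a\<close>, and those cut by the window
          have length at most \<open>L n\<close>, which is small against \<open>k\<close>.\<close>
        have "real k * ER_average b n k (point t) \<le> a * real k + 2 * b * real (L n)"
        proof -
          have "i + k \<le> pos n" using i(1) kn pos_ge[of n] by linarith
          note window_sum_le[OF t this]
          moreover have "real k \<noteq> 0" using k by simp
          ultimately show ?thesis by (simp only: i(2) times_divide_eq_right nonzero_mult_div_cancel_left simp_thms)
        qed
        also have "\<dots> < real k * (a + \<epsilon>)" using Lk(1) by (simp add: algebra_simps)
        finally have up: "ER_average b n k (point t) < a + \<epsilon>" by (rule mult_left_less_imp_less) simp
        define p where "p = (LEAST p. n < 8 * N * 2 ^ p)"
        have "n < 8 * N * 2 ^ n" using N by (intro less_le_trans[OF less_exp]) simp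
        then have p1: "n < 8 * N * 2 ^ p" unfolding p_def by (rule LeastI)
        define i where "i = (2::nat) ^ p"
        have iM: "M < i"
        proof -
          have "8 * N * M < 8 * N * i" using le_less_trans[OF elim(4) p1] by (simp only: i_def)
          then show ?thesis by simp
        qed
        have p2: "4 * N * i \<le> n"
        proof (cases p)
          case 0
          then show ?thesis using iM by (simp add: i_def M_def)
        next
          case (Suc q)
          then have "\<not> n < 8 * N * 2 ^ q"
            using not_less_Least[of q "\<lambda>p. n < 8 * N * 2 ^ p", folded p_def] by simp
          then show ?thesis by (simp add: i_def Suc)
        qed
        have kR: "k \<le> R i" unfolding R_def k_def using p1 by (intro Max_ge) (auto simp: i_def)
        have pw: "pow2 i" by (auto simp: pow2_def i_def)
        have ksp: "k \<le> length (concat (sp i))" using kR sp_len[OF pw] by linarith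
        have i1': "1 \<le> i" "i1 \<le> i" "C \<le> real i" using iM unfolding M_def by linarith+
        \<comment> \<open>The bound \<open>4 * N * i\<close> splits into \<open>3 * N * i\<close>
          for the linear term, as \<open>i + 1 \<le> 2 * i\<close>, and \<open>N * i\<close> for the
          constant, as \<open>C \<le> i\<close>.\<close>
        have "real (pos (Suc i)) \<le> (real N + 1 / 2) * real (Suc i) + C" by (rule C)
        also have "\<dots> \<le> 4 * real N * real i"
        proof -
          have N1: "1 \<le> real N" using N by simp
          have "(real N + 1 / 2) * real (Suc i) \<le> (3 / 2 * real N) * (2 * real i)"
            using N1 i1' by (intro mult_mono) auto
          moreover have "real i \<le> real N * real i" using N1 mult_right_mono[OF N1, of "real i"] by simp
          ultimately show ?thesis using i1'(3) by linarith
        qed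
        finally have "real (pos (Suc i)) \<le> real (4 * N * i)" by simp
        then have "pos (Suc i) \<le> n" using p2 by (simp only: of_nat_le_iff)
        \<comment> \<open>The window that starts with the run, right after the free block of step
          \<open>i\<close>, is among those of the maximum.\<close>
        then have w: "pos i + N \<le> n - k" using ksp by (simp add: pos_Suc)
        have nn: "\<forall>d\<in>set (u i). 0 \<le> d" using fits_digits[OF full_fits0[OF v(1)]] by (auto simp: u_def)
        have "(a - 1 / real (Suc (j i))) * real k - a * real (length (u i)) \<le> of_int (sum_list (take k (concat (sp i))))"
        proof -
          define r where "r = R i div length (u i) + 1"
          have spi: "sp i = replicate r (u i)" using pw by (simp only: sp_def r_def if_True)
          have "k \<le> r * length (u i)" using ksp unfolding spi by (simp add: length_concat sum_list_replicate)
          then show ?thesis unfolding spi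
            using v nn by (intro sum_list_power_prefix a) (auto simp: u_def)
        qed
        also have "\<dots> = of_int (digit_sum b (pos i + N + k) (point t) - digit_sum b (pos i + N) (point t))"
          by (simp only: sum_special_window[OF t ksp])
        also have "\<dots> \<le> real k * ER_average b n k (point t)" by (rule ER_average_window[OF w k])
        finally have lo: "(a - 1 / real (Suc (j i))) * real k - a * real (length (u i)) \<le> real k * ER_average b n k (point t)" .
        have "i \<le> 4 * N * i" using N by simp
        with p2 have "i \<le> n" by linarith
        then have "length (u i) \<le> L n" using jL(4)[of i] monoD[OF jL(1), of i n] by (simp add: u_def)
        then have "a * real (length (u i)) \<le> a * real (L n)" using a by (intro mult_left_mono) auto
        moreover have "1 / real (Suc (j i)) * real k \<le> \<epsilon> / 2 * real k"
          using i1[OF i1'(2)] by (intro mult_right_mono) auto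
        moreover have "a * real (L n) < \<epsilon> / 2 * real k" using Lk(2) by simp
        moreover have "real k * (a - \<epsilon>) = a * real k - \<epsilon> / 2 * real k - \<epsilon> / 2 * real k"
          by (simp add: algebra_simps)
        ultimately have "real k * (a - \<epsilon>) < real k * ER_average b n k (point t)"
          using lo[unfolded left_diff_distrib] by linarith
        then have "a - \<epsilon> < ER_average b n k (point t)" by (rule mult_left_less_imp_less) simp
        with up show ?case by (simp add: k_def abs_less_iff)
      qed
      then show "\<exists>no. \<forall>n\<ge>no. norm (ER_average b n (\<phi> n) (point t) - a) < \<epsilon>"
        by (simp add: eventually_sequentially)
    qed
    then show ?thesis using point_range[OF t] by (simp add: ER_set_def)
  qed
  show ?thesis
  proof (rule hausdorff_dim_ge)
    fix r assume r: "0 \<le> r" "r < \<sigma>"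
    define s where "s = (r + \<sigma>) / 2"
    have s: "0 < s" "r \<le> s" "s < \<sigma>" using r \<sigma> by (auto simp: s_def)
    \<comment> \<open>Makes \<open>s * (N + \<epsilon>)\<close> the midpoint of \<open>s * N\<close>
      and \<open>\<sigma> * N\<close>; the remaining gap to \<open>\<sigma> * N\<close> absorbs the
      constant \<open>D\<close> once \<open>q \<ge> q0\<close>.\<close>
    define \<epsilon> where "\<epsilon> = real N * (\<sigma> - s) / (2 * s)"
    have "0 < \<epsilon>" using N s by (simp add: \<epsilon>_def)
    from growth[OF this] obtain C where C: "\<And>q. real (pos q) \<le> (real N + \<epsilon>) * real q + C" by blast
    define D where "D = real N * (\<sigma> + s) / 2 + s * C"
    define q0 where "q0 = nat \<lceil>2 * D / (real N * (\<sigma> - s))\<rceil>"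
    have lnK: "\<sigma> * real N * ln b \<le> ln (real K)"
    proof -
      have "ln (b powr (\<sigma> * real N)) \<le> ln (real K)" using card b K by (subst ln_le_cancel_iff) (auto simp: K_def)
      then show ?thesis using b by (simp add: ln_powr)
    qed
    have "s * ln b * real (pos (Suc q)) \<le> real q * ln (real K)" if q: "q0 \<le> q" for q
    proof -
      have Ns: "0 < real N * (\<sigma> - s)" using N s by simp
      have "2 * D / (real N * (\<sigma> - s)) \<le> real q" using q unfolding q0_def by linarith
      then have Dq: "2 * D \<le> real N * (\<sigma> - s) * real q" using Ns by (simp add: pos_divide_le_eq mult.commute)
      have sN: "s * (real N + \<epsilon>) = real N * (\<sigma> + s) / 2" using s by (simp add: \<epsilon>_def field_simps)
      have "s * real (pos (Suc q)) \<le> s * ((real N + \<epsilon>) * real (Suc q) + C)"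
        using C[of "Suc q"] s(1) by (rule mult_left_mono[OF _ less_imp_le])
      also have "\<dots> = s * (real N + \<epsilon>) * real (Suc q) + s * C" by (simp add: algebra_simps)
      also have "\<dots> = real N * (\<sigma> + s) / 2 * real q + D" unfolding sN D_def by (simp add: algebra_simps add_divide_distrib)
      also have "\<dots> \<le> real N * (\<sigma> + s) / 2 * real q + real N * (\<sigma> - s) * real q / 2" using Dq by linarith
      also have "\<dots> = real q * (\<sigma> * real N)" by (simp add: field_simps)
      finally have "s * real (pos (Suc q)) * ln b \<le> real q * (\<sigma> * real N) * ln b"
        using b by (intro mult_right_mono) auto
      also have "\<dots> \<le> real q * ln (real K)" using mult_left_mono[OF lnK, of "real q"] by (simp add: mult.assoc)
      finally show ?thesis by (simp add: mult_ac)
    qed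
    then show "hausdorff_measure r (ER_set b \<phi> a) \<noteq> 0"
      by (rule hausdorff_measure_image_pos[OF s(1) r(1) s(2) _ point_ER])
  qed
qed

text \<open>Makes \<alpha> positive in the second case of the theorem, as
  \<open>ER_set_dim_ge\<close> requires.\<close>

lemma typical_average_nonneg:
  assumes b: "1 < b" shows "0 \<le> typical_average b"
proof (rule LIMSEQ_le_const[OF mean_digit_average_tendsto[OF b]])
  have "0 \<le> (\<integral>x. digit_average b n x \<partial>unit_leb)" for n
  proof (intro integral_nonneg_AE AE_I2)
    fix x assume "x \<in> space unit_leb"
    then show "0 \<le> digit_average b n x"
      using digit_bounds[of b x] b by (auto simp: digit_average_def digit_sum_def intro!: divide_nonneg_nonneg sum_nonneg)
  qed
  then show "\<exists>N. \<forall>n\<ge>N. 0 \<le> (\<integral>x. digit_average b n x \<partial>unit_leb)" by blast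
qed

theorem theorem1p1:
  fixes \<beta> \<alpha> :: real and \<theta> :: "nat \<Rightarrow> real" and \<phi> :: "nat \<Rightarrow> nat"
  assumes "1 < \<beta>"
    and "0 \<le> \<alpha>" and "ereal \<alpha> \<le> max_average \<beta>"
    and "slowly_varying \<theta>"
    and "filterlim \<theta> at_top sequentially"
    and "\<And>n. 1 \<le> n \<Longrightarrow> \<phi> n = nat \<lfloor>\<theta> n\<rfloor>"
  shows "hausdorff_dim (ER_set \<beta> \<phi> \<alpha>) =
           (if \<alpha> \<le> typical_average \<beta> then digit_entropy \<beta> \<alpha> else 1)"
proof -
  have \<theta>0: "(\<lambda>n. \<theta> n / real n) \<longlonglongrightarrow> 0" by (rule slowly_varying_sublinear[OF assms(4)])
  have inf: "filterlim \<phi> at_top sequentially"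
    unfolding filterlim_at_top
  proof
    fix m :: nat
    have "eventually (\<lambda>n. real m \<le> \<theta> n) sequentially" using assms(5) unfolding filterlim_at_top by blast
    then show "eventually (\<lambda>n. m \<le> \<phi> n) sequentially"
      using eventually_ge_at_top[of 1] by eventually_elim (auto simp: assms(6) le_nat_floor)
  qed
  have sub: "(\<lambda>n. real (\<phi> n) / real n) \<longlonglongrightarrow> 0"
  proof (rule Lim_null_comparison[OF _ \<theta>0])
    have "eventually (\<lambda>n. 0 \<le> \<theta> n) sequentially" using assms(5) unfolding filterlim_at_top by blast
    then show "eventually (\<lambda>n. norm (real (\<phi> n) / real n) \<le> \<theta> n / real n) sequentially"
      using eventually_ge_at_top[of 1]
      by eventually_elim (auto simp: assms(6) intro!: divide_right_mono of_nat_floor)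
  qed
  \<comment> \<open>Richness with exponent 0 supplies the words of mean just below \<alpha> that
    fill the runs.\<close>
  have rich0: "rich \<beta> \<alpha> 0" by (rule rich_of_le_max_average[OF assms(1-3)])
  show ?thesis
  proof (cases "\<alpha> \<le> typical_average \<beta>")
    case True
    have "digit_entropy \<beta> \<alpha> \<le> hausdorff_dim (ER_set \<beta> \<phi> \<alpha>)"
    proof (rule ccontr)
      assume "\<not> ?thesis"
      then obtain s where s: "hausdorff_dim (ER_set \<beta> \<phi> \<alpha>) < ereal s" "ereal s < digit_entropy \<beta> \<alpha>"
        using ereal_dense2 by (metis not_le)
      have r: "rich \<beta> \<alpha> s" using s(2) by (intro rich_of_entropy_ge[OF assms(1)]) auto
      have "0 < ereal s" using hausdorff_dim_nonneg s(1) by (rule le_less_trans)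
      then have s0: "0 < s" by simp
      show False
      proof (cases "\<alpha> = 0")
        case True
        then show False using rich_zero_mean_nonpos[OF assms(1)] r s0 by fastforce
      next
        case False
        with assms(2) have \<alpha>: "0 < \<alpha>" by simp
        obtain r' where r': "hausdorff_dim (ER_set \<beta> \<phi> \<alpha>) < ereal r'" "ereal r' < ereal s"
          using ereal_dense2[OF s(1)] by blast
        then have "0 < s - r'" by simp
        from rich_below[OF assms(1) r \<alpha> this] obtain c W N where W: "1 \<le> c" "c < \<beta>" "1 \<le> N" "finite W"
          "\<beta> powr (r' * real N) \<le> real (card W)"
          "\<And>w. w \<in> W \<Longrightarrow> length w = N \<and> full c w \<and> of_int (sum_list w) \<le> \<alpha> * real N" by auto
        have "ereal r' \<le> hausdorff_dim (ER_set \<beta> \<phi> \<alpha>)"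
          by (rule ER_set_dim_ge[OF assms(1) \<alpha> rich0 inf sub W(1-4,6,5)])
        with r'(1) show False by simp
      qed
    qed
    with ER_set_dim_le[OF assms(1-3) True inf sub] True show ?thesis by simp
  next
    case False
    with typical_average_nonneg[OF assms(1)] have \<alpha>: "0 < \<alpha>" by simp
    have "1 \<le> hausdorff_dim (ER_set \<beta> \<phi> \<alpha>)"
    proof (rule ccontr)
      assume "\<not> ?thesis"
      then obtain s where s: "hausdorff_dim (ER_set \<beta> \<phi> \<alpha>) < ereal s" "ereal s < 1"
        using ereal_dense2 by (metis not_le)
      \<comment> \<open>Small enough that typical blocks have digit sums at most
        \<open>\<alpha> * N\<close> and rate at least \<open>s\<close>.\<close>
      define h where "h = min (1 - s) (\<alpha> - typical_average \<beta>)"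
      have h: "0 < h" using s(2) False by (simp add: h_def)
      then obtain c W N where W: "1 \<le> c" "c < \<beta>" "1 \<le> N"
        "block_family c N (typical_average \<beta> * real N) (h * real N) W" "\<beta> powr ((1 - h) * real N) \<le> real (card W)"
        using rich_typical[OF assms(1)] unfolding rich_def rich_at_def by blast
      have "finite W" using W(4) by (simp add: block_family_def)
      moreover have "length w = N \<and> full c w \<and> of_int (sum_list w) \<le> \<alpha> * real N" if "w \<in> W" for w
      proof -
        have "\<bar>real_of_int (sum_list w) - typical_average \<beta> * real N\<bar> \<le> h * real N"
          using W(4) that by (simp add: block_family_def)
        then have "real_of_int (sum_list w) \<le> (typical_average \<beta> + h) * real N" by (simp add: algebra_simps abs_le_iff)
        also have "\<dots> \<le> \<alpha> * real N" by (intro mult_right_mono) (auto simp: h_def)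
        finally show ?thesis using W(4) that by (simp add: block_family_def)
      qed
      moreover have "\<beta> powr (s * real N) \<le> real (card W)"
      proof -
        have "\<beta> powr (s * real N) \<le> \<beta> powr ((1 - h) * real N)"
          using assms(1) by (intro powr_mono mult_right_mono) (auto simp: h_def)
        with W(5) show ?thesis by linarith
      qed
      ultimately have "ereal s \<le> hausdorff_dim (ER_set \<beta> \<phi> \<alpha>)"
        by (intro ER_set_dim_ge[OF assms(1) \<alpha> rich0 inf sub W(1-3)]) auto
      with s(1) show False by simp
    qed
    moreover have "hausdorff_dim (ER_set \<beta> \<phi> \<alpha>) \<le> 1"
      by (rule hausdorff_dim_unit_interval_le) (auto simp: ER_set_def)
    ultimately show ?thesis using False by simp
  qed
qed

end
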